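(* Let $K$ be a field, $n\ge 1$, $S=K[x_1,\ldots,x_n]$, and let $0\le s\le n$. Let $\alpha: a_1<a_2<\cdots<a_s$ and $\beta: b_1<b_2<\cdots<b_s$ be sequences of integers with $1\le a_1$, $b_s\le n$ and $a_i\le b_i$ for all $1\le i\le s$, and let $I_{\alpha,\beta}=(x_{a_1}x_{a_1+1}\cdots x_{b_1},\ldots,x_{a_s}x_{a_s+1}\cdots x_{b_s})\subset S$ (with $I_{\alpha,\beta}=0$ if $s=0$). Then: (1) $\operatorname{depth}(S/I_{\alpha,\beta})=\operatorname{sdepth}(S/I_{\alpha,\beta})=\varphi(\alpha,\beta)$. (2) $\dim(S/I_{\alpha,\beta})=\psi(\alpha,\beta)$.
   Context: Stanley depth: for a finitely generated $\mathbb Z^n$-graded $S$-module $M$, a Stanley decomposition of $M$ is a direct sum $\mathcal D: M=\bigoplus_{i=1}^r m_iK[Z_i]$ as $\mathbb Z^n$-graded $K$-vector spaces, where each $m_i\in M$ is homogeneous for the $\mathbb Z^n$-grading, $Z_i\subset\{x_1,\ldots,x_n\}$, and $m_iK[Z_i]=\{um_i: u\in K[Z_i]\}$ is a free $K[Z_i]$-submodule of $M$. Set $\operatorname{sdepth}(\mathcal D)=\min_i|Z_i|$ and $\operatorname{sdepth}(M)=\max\{\operatorname{sdepth}(\mathcal D):\mathcal D \text{ a Stanley decomposition of } M\}$. Depth is with respect to the graded maximal ideal $(x_1,\ldots,x_n)$. Derived sequences: for $s\ge 1$ let $j=j(\alpha,\beta)=\max\{i: a_i\le b_1\}$. Let $\alpha':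 a_{j+1}<a_{j+2}<\cdots<a_s$ and $\beta': b_{j+1}<b_{j+2}<\cdots<b_s$ (both of length $s-j$, empty if $j=s$). If $s>1$ and $j>1$, define $\alpha'',\beta''$ as follows. If $j<s$ and $a_{j+1}>b_1+1$: $\alpha'': b_1+1<a_{j+1}<a_{j+2}<\cdots<a_s$ and $\beta'': b_2<b_{j+1}<b_{j+2}<\cdots<b_s$ (length $s-j+1$). If $j<s$ and $a_{j+1}=b_1+1$: $\alpha'': b_1+1<a_{j+2}<\cdots<a_s$ and $\beta'': b_2<b_{j+2}<\cdots<b_s$ (length $s-j$). If $j=s$: $\alpha''$ and $\beta''$ are the one-term sequences $b_1+1$ and $b_2$. The numbers $\varphi,\psi$ (for fixed $n$) are defined recursively: $\varphi(\alpha,\beta)=n$ if $s=0$; $\varphi(\alpha,\beta)=\varphi(\alpha',\beta')-1$ if $s\ge1$ and $j=1$; $\varphi(\alpha,\beta)=\varphi(\alpha'',\beta'')-1$ if $s>1$ and $j>1$. And $\psi(\alpha,\beta)=n$ if $s=0$; $\psi(\alpha,\beta)=\psi(\alpha',\beta')-1$ if $s\ge1$. *)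

theory Defs
  imports "HOL-Algebra.Algebra" "HOL-Library.Poly_Mapping"
begin

section \<open>Polynomial rings\<close>

text \<open>
  A monomial is a finitely supported exponent vector \<open>nat \<Rightarrow>\<^sub>0 nat\<close>, a polynomial a finitely
  supported function from monomials to the coefficient field. The type has all of
  \<open>0, 1, 2, \<dots>\<close> as variable indices; \<open>mpol_ring V\<close> is its subring of the polynomials
  in the variables with index in \<open>V\<close>, so that \<open>S = mpol_ring {1..n}\<close> and
  \<open>K[Z] = mpol_ring Z\<close> for \<open>Z \<subseteq> {1..n}\<close>.
\<close>

type_synonym 'k mpol = "(nat \<Rightarrow>\<^sub>0 nat) \<Rightarrow>\<^sub>0 'k"

definition polys_in :: "nat set \<Rightarrow> 'k::field mpol set" where
  "polys_in V = {p. \<forall>t\<in>Poly_Mapping.keys p. Poly_Mapping.keys t \<subseteq> V}"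

definition mpol_ring :: "nat set \<Rightarrow> 'k::field mpol ring" where
  "mpol_ring V = \<lparr>carrier = polys_in V, monoid.mult = (*), one = 1, ring.zero = 0, add = (+)\<rparr>"

lemma polys_in_mult: "p * q \<in> polys_in V" if "p \<in> polys_in V" "q \<in> polys_in V"
proof -
  have "Poly_Mapping.keys t \<subseteq> V" if t: "t \<in> Poly_Mapping.keys (p * q)" for t
  proof -
    obtain u w where "u \<in> Poly_Mapping.keys p" "w \<in> Poly_Mapping.keys q" "t = u + w"
      using t keys_mult[of p q] by auto
    then show ?thesis
      using \<open>p \<in> polys_in V\<close> \<open>q \<in> polys_in V\<close> Poly_Mapping.keys_add[of u w]
      unfolding polys_in_def by blast
  qed
  then show ?thesis
    by (simp add: polys_in_def)
qed

lemma polys_in_add: "p + q \<in> polys_in V" if "p \<in> polys_in V" "q \<in> polys_in V"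
  using that Poly_Mapping.keys_add[of p q] unfolding polys_in_def by blast

lemma cring_mpol_ring: "cring (mpol_ring V :: 'k::field mpol ring)" (is "cring ?S")
proof -
  have 01: "0 \<in> (polys_in V :: 'k mpol set)" "1 \<in> (polys_in V :: 'k mpol set)"
    by (auto simp: polys_in_def)
  have "Group.comm_monoid ?S"
    by (rule Group.comm_monoidI)
      (auto simp: mpol_ring_def polys_in_mult 01 mult.assoc intro: mult.commute)
  moreover have "abelian_group ?S"
  proof (rule abelian_groupI)
    fix p :: "'k mpol" assume p: "p \<in> carrier ?S"
    then have "- p \<in> carrier ?S"
      by (simp add: mpol_ring_def polys_in_def)
    then show "\<exists>q\<in>carrier ?S. q \<oplus>\<^bsub>?S\<^esub> p = \<zero>\<^bsub>?S\<^esub>"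
      by (auto simp: mpol_ring_def intro: bexI[of _ "- p"])
  qed (auto simp: mpol_ring_def polys_in_add 01 add.assoc intro: add.commute)
  ultimately show ?thesis
    by (intro cringI) (simp_all add: mpol_ring_def distrib_right)
qed

definition pvar :: "nat \<Rightarrow> 'k::field mpol" where
  "pvar i = Poly_Mapping.single (Poly_Mapping.single i 1) 1"

definition max_graded_ideal :: "nat \<Rightarrow> 'k::field mpol set" where
  "max_graded_ideal n = Idl\<^bsub>mpol_ring {1..n}\<^esub> (pvar ` {1..n})"

section \<open>Krull dimension and depth\<close>

text \<open>
  Here and below, \<open>Max\<close> of an infinite or empty set of naturals is unspecified, so the
  definitions are meaningful only where the maximum exists. It does for \<open>S/I\<close> with \<open>I\<close> a
  proper monomial ideal.
\<close>

definition krull_dim :: "('a, 'b) ring_scheme \<Rightarrow> nat" where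
  "krull_dim R = Max {k. \<exists>P :: nat \<Rightarrow> 'a set.
     (\<forall>i\<le>k. primeideal (P i) R) \<and> (\<forall>i<k. P i \<subset> P (Suc i))}"

text \<open>The ring \<open>R/I\<close> as an \<open>R\<close>-module.\<close>

definition quot_module :: "('a, 'b) ring_scheme \<Rightarrow> 'a set \<Rightarrow> ('a, 'a set) module" where
  "quot_module R I =
     \<lparr>carrier = carrier (R Quot I), monoid.mult = monoid.mult (R Quot I), one = one (R Quot I),
      ring.zero = ring.zero (R Quot I), add = add (R Quot I),
      smult = (\<lambda>r x. (I +>\<^bsub>R\<^esub> r) \<otimes>\<^bsub>R Quot I\<^esub> x)\<rparr>"

text \<open>The submodule \<open>(f\<^sub>1, \<dots>, f\<^sub>k)M\<close> of \<open>M\<close>.\<close>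

definition seq_submodule :: "('a, 'm) module \<Rightarrow> 'a list \<Rightarrow> 'm set" where
  "seq_submodule M fs =
     {(\<Oplus>\<^bsub>M\<^esub>i\<in>{..<length fs}. (fs ! i) \<odot>\<^bsub>M\<^esub> v i) | v. v \<in> {..<length fs} \<rightarrow> carrier M}"

text \<open>
  The first conjunct says that \<open>f\<^sub>k\<close> is a nonzerodivisor on \<open>M/(f\<^sub>1, \<dots>, f\<^bsub>k-1\<^esub>)M\<close>,
  the second that \<open>M/(f\<^sub>1, \<dots>, f\<^sub>r)M\<close> is nonzero.
\<close>

definition regular_sequence :: "('a, 'm) module \<Rightarrow> 'a list \<Rightarrow> bool" where
  "regular_sequence M fs \<longleftrightarrow>
     (\<forall>k<length fs. \<forall>x\<in>carrier M.
        (fs ! k) \<odot>\<^bsub>M\<^esub> x \<in> seq_submodule M (take k fs) \<longrightarrow> x \<in> seq_submodule M (take k fs)) \<and>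
     seq_submodule M fs \<noteq> carrier M"

definition depth :: "'a set \<Rightarrow> ('a, 'm) module \<Rightarrow> nat" where
  "depth J M = Max {length fs | fs. set fs \<subseteq> J \<and> regular_sequence M fs}"

section \<open>Stanley depth\<close>

text \<open>
  A \<open>\<int>\<^sup>n\<close>-grading of a module is a family \<open>gr\<close> of subsets of it, the homogeneous components,
  indexed by the degrees in \<open>Zn n\<close>.
\<close>

definition Zn :: "nat \<Rightarrow> (nat \<Rightarrow> int) set" where
  "Zn n = {a. \<forall>i. i \<notin> {1..n} \<longrightarrow> a i = 0}"

text \<open>
  For \<open>a \<in> Zn n\<close> this is \<open>K x\<^sup>a\<close> if \<open>a\<close> is nonnegative, and \<open>{0}\<close> otherwise.
\<close>

definition poly_component :: "(nat \<Rightarrow> int) \<Rightarrow> 'k::field mpol set" where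
  "poly_component a =
     {p. \<forall>t\<in>Poly_Mapping.keys p. \<forall>i. int (Poly_Mapping.lookup t i) = a i}"

definition quot_component ::
    "nat \<Rightarrow> 'k::field mpol set \<Rightarrow> (nat \<Rightarrow> int) \<Rightarrow> 'k mpol set set" where
  "quot_component n I a = (\<lambda>p. I +>\<^bsub>mpol_ring {1..n}\<^esub> p) ` poly_component a"

definition stanley_space :: "('k::field mpol, 'm) module \<Rightarrow> 'm \<Rightarrow> nat set \<Rightarrow> 'm set" where
  "stanley_space M m Z = {u \<odot>\<^bsub>M\<^esub> m | u. u \<in> polys_in Z}"

text \<open>
  A decomposition is a list of pairs \<open>(m\<^sub>i, Z\<^sub>i)\<close>, where \<open>Z\<^sub>i\<close> is given by the indices of its
  variables. Injectivity of \<open>u \<mapsto> u m\<^sub>i\<close> on \<open>K[Z\<^sub>i]\<close> is freeness of \<open>m\<^sub>i K[Z\<^sub>i]\<close> with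
  basis \<open>m\<^sub>i\<close>. Since the \<open>m\<^sub>i\<close> are homogeneous, the summands are graded subspaces, and the
  direct sum decomposition is automatically one of graded vector spaces.
\<close>

definition stanley_decomposition ::
    "nat \<Rightarrow> ('k::field mpol, 'm) module \<Rightarrow> ((nat \<Rightarrow> int) \<Rightarrow> 'm set) \<Rightarrow> ('m \<times> nat set) list \<Rightarrow> bool" where
  "stanley_decomposition n M gr D \<longleftrightarrow>
     (\<forall>(m, Z)\<in>set D. m \<in> carrier M \<and> (\<exists>a\<in>Zn n. m \<in> gr a) \<and> Z \<subseteq> {1..n} \<and>
        inj_on (\<lambda>u. u \<odot>\<^bsub>M\<^esub> m) (polys_in Z)) \<and>
     (\<forall>x\<in>carrier M. \<exists>!v.
        v \<in> (\<Pi>\<^sub>E i\<in>{..<length D}. stanley_space M (fst (D ! i)) (snd (D ! i))) \<and>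
        x = (\<Oplus>\<^bsub>M\<^esub>i\<in>{..<length D}. v i))"

definition sdepth_decomposition :: "('m \<times> nat set) list \<Rightarrow> nat" where
  "sdepth_decomposition D = Min ((\<lambda>(m, Z). card Z) ` set D)"

definition sdepth ::
    "nat \<Rightarrow> ('k::field mpol, 'm) module \<Rightarrow> ((nat \<Rightarrow> int) \<Rightarrow> 'm set) \<Rightarrow> nat" where
  "sdepth n M gr = Max {sdepth_decomposition D | D. stanley_decomposition n M gr D}"

section \<open>The ideal of a pair of sequences\<close>

text \<open>
  Sequences are lists: \<open>a\<^sub>i\<close> is \<open>as ! (i - 1)\<close>, and \<open>s\<close> is \<open>length as = length bs\<close>.
\<close>

definition interval_monomial :: "nat \<Rightarrow> nat \<Rightarrow> 'k::field mpol" where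
  "interval_monomial a b = (\<Prod>k\<in>{a..b}. pvar k)"

definition interval_ideal :: "nat \<Rightarrow> nat list \<Rightarrow> nat list \<Rightarrow> 'k::field mpol set" where
  "interval_ideal n as bs =
     Idl\<^bsub>mpol_ring {1..n}\<^esub> {interval_monomial (as ! i) (bs ! i) | i. i < length as}"

section \<open>The numbers \<open>\<phi>\<close> and \<open>\<psi>\<close>\<close>

definition jidx :: "nat list \<Rightarrow> nat list \<Rightarrow> nat" where
  "jidx as bs = Max {i \<in> {1..length as}. as ! (i - 1) \<le> bs ! 0}"

lemma jidx_bounds:
  assumes "as \<noteq> []" and "as ! 0 \<le> bs ! 0"
  shows "1 \<le> jidx as bs" and "jidx as bs \<le> length as"
proof -
  let ?A = "{i \<in> {1..length as}. as ! (i - 1) \<le> bs ! 0}"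
  have "1 \<in> ?A"
    using assms by (cases as) auto
  then have "Max ?A \<in> ?A"
    by (intro Max_in) auto
  then show "1 \<le> jidx as bs" and "jidx as bs \<le> length as"
    by (auto simp: jidx_def)
qed

definition alpha' :: "nat list \<Rightarrow> nat list \<Rightarrow> nat list" where
  "alpha' as bs = drop (jidx as bs) as"

definition beta' :: "nat list \<Rightarrow> nat list \<Rightarrow> nat list" where
  "beta' as bs = drop (jidx as bs) bs"

text \<open>
  For \<open>j < s\<close> the entry \<open>as ! j\<close> is \<open>a\<^bsub>j+1\<^esub>\<close>, which is at least \<open>b\<^sub>1 + 1\<close> by the
  choice of \<open>j\<close>; the last branch is therefore the case of equality.
\<close>

definition alpha'' :: "nat list \<Rightarrow> nat list \<Rightarrow> nat list" where
  "alpha'' as bs = (let j = jidx as bs in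
     if j = length as then [bs ! 0 + 1]
     else if as ! j > bs ! 0 + 1 then (bs ! 0 + 1) # drop j as
     else (bs ! 0 + 1) # drop (j + 1) as)"

definition beta'' :: "nat list \<Rightarrow> nat list \<Rightarrow> nat list" where
  "beta'' as bs = (let j = jidx as bs in
     if j = length as then [bs ! 1]
     else if as ! j > bs ! 0 + 1 then (bs ! 1) # drop j bs
     else (bs ! 1) # drop (j + 1) bs)"

text \<open>
  The branch \<open>undefined\<close> makes the recursions total. It is reached only when \<open>a\<^sub>1 > b\<^sub>1\<close>, which
  cannot happen for the admissible sequences nor for those derived from them.
\<close>

function phi :: "nat \<Rightarrow> nat list \<Rightarrow> nat list \<Rightarrow> int" where
  "phi n as bs =
     (if as = [] then int n
      else if as ! 0 > bs ! 0 then undefined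
      else if jidx as bs = 1 then phi n (alpha' as bs) (beta' as bs) - 1
      else phi n (alpha'' as bs) (beta'' as bs) - 1)"
  by pat_completeness auto
termination
proof (relation "Wellfounded.measure (\<lambda>(n, as, bs). length as)", goal_cases)
  case (2 n as bs)
  then show ?case
    by (simp add: alpha'_def)
next
  case (3 n as bs)
  then show ?case
    using jidx_bounds[of as bs] by (auto simp: alpha''_def Let_def)
qed simp

function psi :: "nat \<Rightarrow> nat list \<Rightarrow> nat list \<Rightarrow> int" where
  "psi n as bs =
     (if as = [] then int n
      else if as ! 0 > bs ! 0 then undefined
      else psi n (alpha' as bs) (beta' as bs) - 1)"
  by pat_completeness auto
termination
proof (relation "Wellfounded.measure (\<lambda>(n, as, bs). length as)", goal_cases)
  case (2 n as bs)
  then show ?case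
    using jidx_bounds[of as bs] by (auto simp: alpha'_def)
qed simp

declare phi.simps [simp del] psi.simps [simp del]

end

theory Submission
  imports Defs
begin

text \<open>
  The ideal \<open>I\<close> is generated by squarefree monomials, so a monomial is nonzero in
  \<open>S/I\<close> iff the set of its variables contains none of the intervals \<open>[a\<^sub>i,
  b\<^sub>i]\<close>. The complements of these sets are the vertex covers of the family of intervals. Let
  \<open>c\<close> be the largest size of an inclusion-minimal cover and \<open>h\<close> the smallest size of
  a cover. The theorem holds because depth and Stanley depth of \<open>S/I\<close> are \<open>n - c\<close>,
  its dimension is \<open>n - h\<close>, and the two recursions compute \<open>\<phi> = n - c\<close> and
  \<open>\<psi> = n - h\<close>.

  \<^emph>\<open>Recursions.\<close> All intervals end at \<open>b\<^sub>1\<close> or later, so a minimal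
  cover has exactly one point up to \<open>b\<^sub>1\<close>. Beyond \<open>b\<^sub>1\<close> it looks like a
  minimal cover of \<open>\<alpha>', \<beta>'\<close> if \<open>j = 1\<close>, and of \<open>\<alpha>'',
  \<beta>''\<close> if \<open>j > 1\<close>, up to an exchange of one point that does not shrink it
  (\<open>ex_minimal_cover\<close>, \<open>card_minimal_cover_le\<close>). For \<open>h\<close> the greedily
  chosen right endpoints are a cover, and their intervals are pairwise disjoint.

  \<^emph>\<open>Upper bounds.\<close> Let \<open>C\<close> be a minimal cover and \<open>w\<close> the
  product of the variables outside \<open>C\<close>. The annihilator of \<open>w\<close> in \<open>S/I\<close>
  is generated by the variables in \<open>C\<close>. A summand \<open>m K[Z]\<close> of a Stanley
  decomposition in which \<open>w\<close> has a component therefore satisfies \<open>Z \<inter> C =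
  {}\<close>. For a regular sequence \<open>f\<^sub>1, \<dots>, f\<^sub>r\<close> in the maximal ideal the
  products \<open>f\<^sup>\<nu> w\<close> are linearly independent over \<open>K\<close>, because a regular
  sequence is quasi-regular (\<open>regular_independent\<close>); as they live in a polynomial ring in
  \<open>n - |C|\<close> variables, counting monomials with bounded exponents gives \<open>r \<le> n -
  |C|\<close> (\<open>count_bound\<close>). The same count bounds a chain of primes \<open>P\<^sub>0 \<subset>
  \<dots> \<subset> P\<^sub>k\<close> over \<open>I\<close>: choose \<open>f\<^sub>i\<close> in
  \<open>P\<^sub>i\<close> but not in \<open>P\<^bsub>i-1\<^esub>\<close>, and note that the variables in
  \<open>P\<^sub>0\<close> form a cover.

  \<^emph>\<open>Lower bounds.\<close> For a set \<open>W\<close> of variables with product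
  \<open>x\<^sub>W\<close>, multiplication by \<open>x\<^sub>W\<close> gives an exact sequence from
  \<open>S/(I : x\<^sub>W)\<close> over \<open>S/I\<close> to \<open>S/(I, x\<^sub>W)\<close>. If
  \<open>W\<close> is the overlap of the first two intervals, both ends come again from families of intervals,
  all of whose minimal covers have at most \<open>c\<close> points; if these intervals are disjoint, the
  variables of the first one are taken as \<open>W\<close> one at a time. Iterating, \<open>S/I\<close> is
  built from quotients by primes generated by at most \<open>c\<close> variables
  (\<open>coord_split_intervals\<close>). On monomials this is a partition into cones, that is, a Stanley
  decomposition. On each of the primes the complete homogeneous polynomials of degrees \<open>1, \<dots>, n -
  c\<close> in all \<open>n\<close> variables form a regular sequence, over any field, hence they do so on
  \<open>S/I\<close> (\<open>weakly_regular_coord_split\<close>).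
\<close>

section \<open>Vertex covers of families of intervals\<close>

text \<open>
  The last clause gives each point of \<open>C\<close> a private member of \<open>H\<close>, one that only
  this point hits; so no proper subset of \<open>C\<close> meets all members.
\<close>

definition minimal_cover :: "nat set \<Rightarrow> nat set set \<Rightarrow> bool" where
  "minimal_cover C H \<longleftrightarrow> finite C \<and> (\<forall>F\<in>H. F \<inter> C \<noteq> {}) \<and> (\<forall>q\<in>C. \<exists>F\<in>H. F \<inter> C = {q})"

lemma minimal_cover_hit: "minimal_cover C H \<Longrightarrow> F \<in> H \<Longrightarrow> F \<inter> C \<noteq> {}"
  and minimal_cover_private: "minimal_cover C H \<Longrightarrow> q \<in> C \<Longrightarrow> \<exists>F\<in>H. F \<inter> C = {q}"
  by (auto simp: minimal_cover_def)

text \<open>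
  The sequences \<open>\<alpha>, \<beta>\<close> are combined into a list of pairs \<open>(a\<^sub>i,
  b\<^sub>i)\<close>.
\<close>

definition intervals :: "(nat \<times> nat) list \<Rightarrow> nat set set" where
  "intervals ps = (\<lambda>(a, b). {a..b}) ` set ps"

text \<open>
  The Stanley-Reisner complex of the ideal generated by the products over the members of \<open>H\<close>: the
  variable sets of the monomials outside the ideal.
\<close>

definition avoiding :: "nat set set \<Rightarrow> nat set set" where
  "avoiding H = {T. \<forall>F\<in>H. \<not> F \<subseteq> T}"

lemma avoiding_insert_subset:
  "W \<subseteq> A \<Longrightarrow> W \<subseteq> B \<Longrightarrow> avoiding (insert W H) = {T \<in> avoiding (insert A (insert B H)). \<not> W \<subseteq> T}"
  unfolding avoiding_def by blast

definition admissible_pairs :: "(nat \<times> nat) list \<Rightarrow> bool" where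
  "admissible_pairs ps \<longleftrightarrow> sorted_wrt (\<lambda>p q. fst p < fst q \<and> snd p < snd q) ps \<and> (\<forall>(a, b)\<in>set ps. a \<le> b)"

lemma admissible_pairs_Cons: "admissible_pairs ((a, b) # ps) \<longleftrightarrow> a \<le> b \<and> (\<forall>(x, y)\<in>set ps. a < x \<and> b < y) \<and> admissible_pairs ps"
  by (auto simp: admissible_pairs_def)

lemma admissible_pairs_Nil [simp]: "admissible_pairs []"
  by (simp add: admissible_pairs_def)

lemma admissible_pairs_filter: "admissible_pairs ps \<Longrightarrow> admissible_pairs (filter P ps)"
  by (auto simp: admissible_pairs_def sorted_wrt_filter)

lemma intervals_Nil [simp]: "intervals [] = {}"
  and intervals_Cons [simp]: "intervals ((a, b) # ps) = insert {a..b} (intervals ps)"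
  by (auto simp: intervals_def)

lemma intervalsE:
  assumes "F \<in> intervals ps"
  obtains a b where "(a, b) \<in> set ps" "F = {a..b}"
  using assms by (auto simp: intervals_def)

lemma intervalsI: "(a, b) \<in> set ps \<Longrightarrow> {a..b} \<in> intervals ps"
  by (auto simp: intervals_def)

text \<open>
  This is \<open>n - \<phi>\<close>, freed from \<open>n\<close> and from the case distinctions: whether or
  not \<open>a\<^bsub>j+1\<^esub> = b\<^sub>1 + 1\<close>, the sequences \<open>\<alpha>'', \<beta>''\<close>
  consist of \<open>(b\<^sub>1 + 1, b\<^sub>2)\<close> and the intervals that start beyond \<open>b\<^sub>1 +
  1\<close>.
\<close>

function greedy_count :: "(nat \<times> nat) list \<Rightarrow> nat" where
  "greedy_count [] = 0"
| "greedy_count [(a, b)] = 1"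
| "greedy_count ((a, b) # (a', b') # ps) =
    (if a' \<le> b then Suc (greedy_count ((b + 1, b') # filter (\<lambda>(x, y). b + 1 < x) ps))
     else Suc (greedy_count ((a', b') # ps)))"
  by pat_completeness auto
termination
  by (relation "measure length") (auto simp: less_Suc_eq_le)

text \<open>
  This is \<open>n - \<psi>\<close>.
\<close>

function disjoint_count :: "(nat \<times> nat) list \<Rightarrow> nat" where
  "disjoint_count [] = 0"
| "disjoint_count ((a, b) # ps) = Suc (disjoint_count (filter (\<lambda>(x, y). b < x) ps))"
  by pat_completeness auto
termination
  by (relation "measure length") (auto simp: less_Suc_eq_le)

text \<open>
  Every interval ends at \<open>b\<close> or later. So if \<open>u < v \<le> b\<close> were both in
  \<open>C\<close>, an interval containing \<open>u\<close> would also contain \<open>v\<close>, and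
  \<open>u\<close> would have no private interval.
\<close>

lemma minimal_cover_initial:
  assumes "admissible_pairs ((a, b) # ps)" and C: "minimal_cover C (intervals ((a, b) # ps))"
  obtains p where "C \<inter> {..b} = {p}" "p \<in> {a..b}" "p \<in> C"
proof -
  obtain p where p: "p \<in> C" "p \<in> {a..b}"
    using minimal_cover_hit[OF C, of "{a..b}"] by (metis IntE intervals_Cons insertI1 ex_in_conv)
  have False if "u \<in> C" "v \<in> C" "u < v" "v \<le> b" for u v
  proof -
    obtain F where F: "F \<in> intervals ((a, b) # ps)" "F \<inter> C = {u}"
      using minimal_cover_private[OF C \<open>u \<in> C\<close>] by blast
    obtain x y where xy: "(x, y) \<in> set ((a, b) # ps)" "F = {x..y}"
      using F(1) by (rule intervalsE)
    then have "b \<le> y" using assms(1) by (auto simp: admissible_pairs_Cons)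
    moreover have "x \<le> u" using F xy by auto
    ultimately have "v \<in> F \<inter> C" using that xy by auto
    with F that show False by auto
  qed
  then have "C \<inter> {..b} = {p}"
    using p by (auto, metis linorder_neqE_nat)
  with p show ?thesis by (intro that) auto
qed

lemma insert_minimal_cover:
  assumes "\<forall>(x, y)\<in>set ps. b < x" and "a \<le> b" and C: "minimal_cover C (intervals ps)"
  shows "minimal_cover (insert a C) (intervals ((a, b) # ps))" and "a \<notin> C"
proof -
  have Cb: "b < q" if q: "q \<in> C" for q
  proof -
    obtain F where "F \<in> intervals ps" "F \<inter> C = {q}"
      using minimal_cover_private[OF C q] by blast
    moreover from this have "q \<in> F" by blast
    ultimately show ?thesis using assms(1) by (auto elim!: intervalsE)
  qed
  then show "a \<notin> C" using assms(2) by force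
  have aF: "a \<notin> F" if "F \<in> intervals ps" for F
    using that assms(1,2) by (auto elim!: intervalsE)
  have "\<exists>F\<in>intervals ((a, b) # ps). F \<inter> insert a C = {q}" if q: "q \<in> insert a C" for q
  proof (cases "q = a")
    case True
    then show ?thesis using Cb assms(2) by (intro bexI[of _ "{a..b}"]) force+
  next
    case False
    then obtain F where "F \<in> intervals ps" "F \<inter> C = {q}"
      using minimal_cover_private[OF C, of q] q by blast
    then show ?thesis using aF by (intro bexI[of _ F]) auto
  qed
  moreover have "F \<inter> insert a C \<noteq> {}" if "F \<in> intervals ((a, b) # ps)" for F
    using that C assms(2) by (auto simp: minimal_cover_def)
  ultimately show "minimal_cover (insert a C) (intervals ((a, b) # ps))"
    using C by (auto simp: minimal_cover_def)
qed

abbreviation drop_overlap :: "nat \<Rightarrow> (nat \<times> nat) list \<Rightarrow> (nat \<times> nat) list" where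
  "drop_overlap b ps \<equiv> filter (\<lambda>(x, y). b < x) ps"

lemma admissible_pairs_link:
  assumes "admissible_pairs ((a, b) # (a', b') # ps)"
  shows "admissible_pairs ((b + 1, b') # drop_overlap (b + 1) ps)"
  using assms admissible_pairs_filter[of ps] by (auto simp: admissible_pairs_Cons)

text \<open>
  Every interval that starts at \<open>b + 1\<close> or before, except the first, contains \<open>[b + 1,
  b']\<close>; so it is hit by \<open>C\<close>. Only the first interval contains \<open>a\<close>, and it is
  missed by \<open>C\<close>.
\<close>

lemma insert_minimal_cover_link:
  assumes A: "admissible_pairs ((a, b) # (a', b') # ps)" and a': "a' \<le> b"
    and C: "minimal_cover C (intervals ((b + 1, b') # drop_overlap (b + 1) ps))"
  shows "minimal_cover (insert a C) (intervals ((a, b) # (a', b') # ps))" and "a \<notin> C"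
proof -
  let ?qs = "(b + 1, b') # drop_overlap (b + 1) ps"
  have o: "a < a'" "a \<le> b" "b < b'" using A by (auto simp: admissible_pairs_Cons)
  have qs: "b < x" if "(x, y) \<in> set ?qs" for x y using that by auto
  have Cb: "b < q" if q: "q \<in> C" for q
  proof -
    obtain F where "F \<in> intervals ?qs" "F \<inter> C = {q}"
      using minimal_cover_private[OF C q] by blast
    moreover from this have "q \<in> F" by blast
    ultimately obtain x y where "(x, y) \<in> set ?qs" "q \<in> {x..y}" using intervalsE by metis
    then show ?thesis using qs[of x y] by auto
  qed
  then show "a \<notin> C" using o by force
  have hit: "F \<inter> C \<noteq> {}" if "F \<in> intervals ?qs" for F
    using minimal_cover_hit[OF C that] .
  have "F \<inter> insert a C \<noteq> {}" if F: "F \<in> intervals ((a, b) # (a', b') # ps)" for F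
  proof -
    consider "F = {a..b}" | "F = {a'..b'}" | x y where "(x, y) \<in> set ps" "F = {x..y}"
      using F by (auto simp: intervals_def)
    then show ?thesis
    proof cases
      case 2
      have "{b + 1..b'} \<subseteq> F" using 2 a' by auto
      then show ?thesis using hit[of "{b + 1..b'}"] by auto
    next
      case 3
      show ?thesis
      proof (cases "b + 1 < x")
        case True
        then show ?thesis using hit[of F] 3 intervalsI[of x y "drop_overlap (b + 1) ps"] by auto
      next
        case False
        have "b' < y" using 3 A by (auto simp: admissible_pairs_Cons)
        then have "{b + 1..b'} \<subseteq> F" using 3 False by auto
        then show ?thesis using hit[of "{b + 1..b'}"] by auto
      qed
    qed (use o in auto)
  qed
  moreover have "\<exists>F\<in>intervals ((a, b) # (a', b') # ps). F \<inter> insert a C = {q}" if q: "q \<in> insert a C" for q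
  proof (cases "q = a")
    case True
    then show ?thesis using Cb o by (intro bexI[of _ "{a..b}"]) force+
  next
    case False
    then obtain F where F: "F \<in> intervals ?qs" "F \<inter> C = {q}"
      using minimal_cover_private[OF C, of q] q by blast
    consider "F = {b + 1..b'}" | x y where "(x, y) \<in> set ps" "b + 1 < x" "F = {x..y}"
      using F(1) by (auto simp: intervals_def)
    then show ?thesis
    proof cases
      case 1
      have "{a'..b'} \<inter> insert a C = F \<inter> C" using 1 Cb o a' by force
      then show ?thesis using F(2) by (intro bexI[of _ "{a'..b'}"]) simp_all
    next
      case 2
      then have "F \<inter> insert a C = F \<inter> C" using o by auto
      then show ?thesis using F 2 by (intro bexI[of _ F]) (auto intro: intervalsI)
    qed
  qed
  ultimately show "minimal_cover (insert a C) (intervals ((a, b) # (a', b') # ps))"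
    using C by (auto simp: minimal_cover_def)
qed

lemma ex_minimal_cover: "admissible_pairs ps \<Longrightarrow> \<exists>C. minimal_cover C (intervals ps) \<and> card C = greedy_count ps"
proof (induction ps rule: greedy_count.induct)
  case 1
  show ?case by (intro exI[of _ "{}"]) (auto simp: minimal_cover_def)
next
  case (2 a b)
  then show ?case using insert_minimal_cover[of "[]" b a "{}"]
    by (intro exI[of _ "{a}"]) (auto simp: minimal_cover_def admissible_pairs_Cons)
next
  case (3 a b a' b' ps)
  show ?case
  proof (cases "a' \<le> b")
    case True
    then obtain C where C: "minimal_cover C (intervals ((b + 1, b') # drop_overlap (b + 1) ps))"
      "card C = greedy_count ((b + 1, b') # drop_overlap (b + 1) ps)"
      using 3(1)[OF True] admissible_pairs_link[OF 3(3)] by blast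
    have "finite C" using C by (auto simp: minimal_cover_def)
    then show ?thesis
      using insert_minimal_cover_link[OF 3(3) True C(1)] C(2) True
      by (intro exI[of _ "insert a C"]) auto
  next
    case False
    then obtain C where C: "minimal_cover C (intervals ((a', b') # ps))" "card C = greedy_count ((a', b') # ps)"
      using 3(2)[OF False] 3(3) by (auto simp: admissible_pairs_Cons)
    have "finite C" using C by (auto simp: minimal_cover_def)
    moreover have "\<forall>(x, y)\<in>set ((a', b') # ps). b < x" "a \<le> b"
      using 3(3) False by (auto simp: admissible_pairs_Cons)
    ultimately show ?thesis
      using insert_minimal_cover[OF _ _ C(1), of b a] C(2) False
      by (intro exI[of _ "insert a C"]) auto
  qed
qed

lemma minimal_cover_tail:
  assumes "\<forall>(x, y)\<in>set ps. b < x" and A: "admissible_pairs ((a, b) # ps)" and C: "minimal_cover C (intervals ((a, b) # ps))"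
  shows "\<exists>p\<in>C. minimal_cover (C - {p}) (intervals ps)"
proof -
  obtain p where p: "C \<inter> {..b} = {p}" "p \<in> {a..b}" "p \<in> C"
    using minimal_cover_initial[OF A C] .
  have pF: "p \<notin> F" if "F \<in> intervals ps" for F
    using that p(2) assms(1) by (auto elim!: intervalsE)
  have "\<exists>F\<in>intervals ps. F \<inter> (C - {p}) = {q}" if q: "q \<in> C - {p}" for q
  proof -
    obtain F where F: "F \<in> intervals ((a, b) # ps)" "F \<inter> C = {q}"
      using minimal_cover_private[OF C, of q] q by blast
    have "F \<noteq> {a..b}"
    proof
      assume "F = {a..b}"
      then have "p \<in> F \<inter> C" using p by simp
      then show False using F(2) q by simp
    qed
    then have F': "F \<in> intervals ps" using F by simp
    then have "F \<inter> (C - {p}) = {q}" using F(2) q pF by blast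
    with F' show ?thesis by blast
  qed
  moreover have "F \<inter> (C - {p}) \<noteq> {}" if "F \<in> intervals ps" for F
    using minimal_cover_hit[OF C, of F] pF[OF that] that by auto
  ultimately have "minimal_cover (C - {p}) (intervals ps)"
    using C by (auto simp: minimal_cover_def)
  with p show ?thesis by blast
qed

text \<open>
  In the overlapping case remove from \<open>C\<close> its one point up to \<open>b\<close>. If the rest
  \<open>D\<close> hits \<open>[b + 1, b']\<close>, it is a minimal cover of the derived family. If not,
  \<open>b + 1\<close> is added. This can deprive a point of its private intervals only if they all start at
  \<open>b + 1\<close> or before, and two such points cannot exist: the private interval of the larger one
  would contain the smaller one. Dropping that point gives a minimal cover of size at least
  \<open>|D|\<close>.
\<close>

lemma card_minimal_cover_le: "admissible_pairs ps \<Longrightarrow> minimal_cover C (intervals ps) \<Longrightarrow> card C \<le> greedy_count ps"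
proof (induction ps arbitrary: C rule: greedy_count.induct)
  case 1
  then show ?case by (auto simp: minimal_cover_def)
next
  case (2 a b)
  obtain p where p: "p \<in> C" "minimal_cover (C - {p}) (intervals [])"
    using minimal_cover_tail[of "[]" b a C] 2 by auto
  have "q \<notin> C - {p}" for q using minimal_cover_private[OF p(2), of q] by auto
  then have "C = {p}" using p(1) by blast
  then show ?case by simp
next
  case (3 a b a' b' ps)
  have fin: "finite C" using 3 by (auto simp: minimal_cover_def)
  show ?case
  proof (cases "a' \<le> b")
    case False
    have "\<forall>(x, y)\<in>set ((a', b') # ps). b < x"
      using 3(3) False by (auto simp: admissible_pairs_Cons)
    then obtain p where p: "p \<in> C" "minimal_cover (C - {p}) (intervals ((a', b') # ps))"
      using minimal_cover_tail[OF _ 3(3,4)] by blast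
    then have "card (C - {p}) \<le> greedy_count ((a', b') # ps)"
      using 3(3) by (intro 3(2)[OF False _ p(2)]) (simp add: admissible_pairs_Cons)
    then show ?thesis using card_Suc_Diff1[OF fin p(1)] False by simp
  next
    case True
    let ?rest = "drop_overlap (b + 1) ps"
    let ?qs = "(b + 1, b') # ?rest"
    obtain p where p: "C \<inter> {..b} = {p}" "p \<in> {a..b}" "p \<in> C"
      using minimal_cover_initial[OF 3(3,4)] .
    define D where "D = C - {p}"
    have Db: "b < q" if "q \<in> D" for q using that p by (force simp: D_def)
    have cardC: "card C = Suc (card D)"
      unfolding D_def using card_Suc_Diff1[OF fin p(3)] by metis
    have rest_hit: "F \<inter> D \<noteq> {}" and rest_p: "F \<inter> C = F \<inter> D" if F: "F \<in> intervals ?rest" for F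
    proof -
      have "p \<notin> F" using F p by (auto elim!: intervalsE)
      moreover have "F \<inter> C \<noteq> {}"
        using minimal_cover_hit[OF 3(4), of F] F by (auto simp: intervals_def)
      ultimately show "F \<inter> C = F \<inter> D" "F \<inter> D \<noteq> {}" by (auto simp: D_def)
    qed
    \<comment> \<open>The points of \<open>D\<close> that stay private when only the intervals beyond \<open>b + 1\<close> are kept.\<close>
    define good where "good q \<longleftrightarrow> (\<exists>F\<in>intervals ?rest. F \<inter> D = {q})" for q
    have bad: "\<exists>x y. (x, y) \<in> set ((a', b') # ps) \<and> x \<le> b + 1 \<and> {x..y} \<inter> C = {q} \<and> b' \<le> y"
      if q: "q \<in> D" "\<not> good q" for q
    proof -
      obtain F where F: "F \<in> intervals ((a, b) # (a', b') # ps)" "F \<inter> C = {q}"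
        using minimal_cover_private[OF 3(4), of q] q unfolding D_def by blast
      have "q \<in> F" using F(2) by blast
      then have "F \<noteq> {a..b}" using Db[OF q(1)] by auto
      then obtain x y where xy: "(x, y) \<in> set ((a', b') # ps)" "F = {x..y}"
        using F(1) by (auto simp: intervals_def)
      have "\<not> b + 1 < x"
      proof
        assume x: "b + 1 < x"
        then have "F \<in> intervals ?rest" using xy True by (auto intro: intervalsI)
        then show False using q(2) F rest_p by (auto simp: good_def)
      qed
      moreover have "b' \<le> y" using xy 3(3) by (auto simp: admissible_pairs_Cons)
      ultimately show ?thesis
        using xy F(2) by (intro exI[of _ x] exI[of _ y] conjI) (simp_all only: not_less)
    qed
    have "\<exists>C'. minimal_cover C' (intervals ?qs) \<and> card D \<le> card C'"
    proof (cases "D \<inter> {b + 1..b'} = {}")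
      case hit: False
      have "\<exists>F\<in>intervals ?qs. F \<inter> D = {q}" if q: "q \<in> D" for q
      proof (cases "good q")
        case True
        then show ?thesis by (auto simp: good_def)
      next
        case False
        then obtain x y where xy: "x \<le> b + 1" "b' \<le> y" "{x..y} \<inter> C = {q}"
          using bad q by blast
        have "{b + 1..b'} \<inter> D \<subseteq> {x..y} \<inter> C" using xy(1,2) by (auto simp: D_def)
        then have "{b + 1..b'} \<inter> D = {q}"
          using hit unfolding xy(3) by (metis Int_commute subset_singletonD)
        then show ?thesis by (intro bexI[of _ "{b + 1..b'}"]) simp_all
      qed
      then have "minimal_cover D (intervals ?qs)"
        using hit fin rest_hit by (auto simp: minimal_cover_def D_def)
      then show ?thesis by blast
    next
      case miss: True
      define C' where "C' = insert (b + 1) {q \<in> D. good q}"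
      have finD: "finite D" using fin by (simp add: D_def)
      have no_two: False if uv: "u \<in> D" "v \<in> D" "u < v" "\<not> good u" "\<not> good v" for u v
      proof -
        obtain x y where xy: "x \<le> b + 1" "{x..y} \<inter> C = {v}"
          using bad[OF uv(2,5)] by blast
        have "v \<in> {x..y}" using xy(2) by blast
        then have "u \<in> {x..y}" using xy(1) Db[OF uv(1)] uv(3) by simp
        moreover have "u \<in> C" using uv(1) by (simp add: D_def)
        ultimately have "u \<in> {x..y} \<inter> C" by simp
        then have "u = v" unfolding xy(2) by simp
        then show False using uv(3) by simp
      qed
      have uniq: "u = v" if "u \<in> D" "v \<in> D" "\<not> good u" "\<not> good v" for u v
        using no_two[of u v] no_two[of v u] that by (meson linorder_neqE_nat)
      have bF: "b + 1 \<notin> F" if "F \<in> intervals ?rest" for F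
        using that by (auto elim!: intervalsE)
      have "\<exists>F\<in>intervals ?qs. F \<inter> C' = {q}" if q: "q \<in> C'" for q
      proof (cases "q = b + 1")
        case True
        have "b < b'" using 3(3) by (simp add: admissible_pairs_Cons)
        then have "{b + 1..b'} \<inter> C' = {q}" using miss True by (auto simp: C'_def)
        then show ?thesis by (intro bexI[of _ "{b + 1..b'}"]) simp_all
      next
        case False
        then obtain F where "F \<in> intervals ?rest" "F \<inter> D = {q}" "good q"
          using q by (auto simp: C'_def good_def)
        then have "F \<inter> C' = {q}" using bF[of F] unfolding C'_def by blast
        then show ?thesis using \<open>F \<in> intervals ?rest\<close> by (intro bexI[of _ F]) simp_all
      qed
      moreover have "F \<inter> C' \<noteq> {}" if F: "F \<in> intervals ?qs" for F
      proof (cases "F \<in> intervals ?rest")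
        case True
        show ?thesis
        proof
          assume e: "F \<inter> C' = {}"
          obtain q where q: "q \<in> F" "q \<in> D" using rest_hit[OF True] by auto
          have nb: "\<not> good u" if "u \<in> F" "u \<in> D" for u
            using e that by (auto simp: C'_def)
          then have "F \<inter> D = {q}" using q uniq by blast
          then have "good q" using True by (auto simp: good_def)
          with nb q show False by blast
        qed
      next
        case False
        then have "F = {b + 1..b'}" using F by auto
        moreover have "b < b'" using 3(3) by (auto simp: admissible_pairs_Cons)
        ultimately show ?thesis by (auto simp: C'_def)
      qed
      ultimately have "minimal_cover C' (intervals ?qs)"
        using finD by (auto simp: minimal_cover_def C'_def)
      moreover have "card D \<le> card C'"
      proof (cases "\<exists>u\<in>D. \<not> good u")
        case True
        then obtain u where u: "u \<in> D" "\<not> good u" by blast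
        have "D \<subseteq> insert u {q \<in> D. good q}" using u uniq by blast
        then have "card D \<le> card (insert u {q \<in> D. good q})"
          using finD by (intro card_mono) auto
        also have "\<dots> \<le> Suc (card {q \<in> D. good q})" using finD by (simp add: card_insert_if)
        also have "b + 1 \<notin> {q \<in> D. good q}"
        proof
          assume "b + 1 \<in> {q \<in> D. good q}"
          moreover have "b < b'" using 3(3) by (auto simp: admissible_pairs_Cons)
          ultimately have "b + 1 \<in> D \<inter> {b + 1..b'}" by simp
          with miss show False by blast
        qed
        then have "Suc (card {q \<in> D. good q}) = card C'"
          using finD by (simp add: C'_def)
        finally show ?thesis .
      next
        case False
        then show ?thesis using finD by (intro card_mono) (auto simp: C'_def)
      qed
      ultimately show ?thesis by blast
    qed
    then obtain C' where C': "minimal_cover C' (intervals ?qs)" "card D \<le> card C'" by blast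
    have "card C' \<le> greedy_count ?qs"
      using 3(1)[OF True admissible_pairs_link[OF 3(3)] C'(1)] .
    then show ?thesis using C'(2) cardC True by simp
  qed
qed

section \<open>Splitting into coordinate subspaces\<close>

text \<open>
  \<open>D\<close> stands for the module with \<open>K\<close>-basis the monomials whose variables form a set
  in \<open>D\<close>. It is assembled from coordinate subspaces of codimension at most \<open>c\<close> by
  splitting the monomials into those divisible by \<open>x\<^sub>W\<close>, where the factor
  \<open>x\<^sub>W\<close> is removed, and the others. The zero module is admitted, since it can arise as a
  part.
\<close>

inductive coord_split :: "nat set \<Rightarrow> nat \<Rightarrow> nat set set \<Rightarrow> bool" for V c where
  empty: "coord_split V c {}"
| leaf: "finite C \<Longrightarrow> card C \<le> c \<Longrightarrow> coord_split V c {T. T \<inter> C = {}}"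
| split: "finite W \<Longrightarrow> W \<subseteq> V \<Longrightarrow> coord_split V c {T. T \<union> W \<in> D} \<Longrightarrow> coord_split V c {T \<in> D. \<not> W \<subseteq> T} \<Longrightarrow> coord_split V c D"

lemma coord_split_delete: "coord_split V c D \<Longrightarrow> coord_split V (Suc c) {T \<in> D. v \<notin> T}"
proof (induction rule: coord_split.induct)
  case empty
  then show ?case by (simp add: coord_split.empty)
next
  case (leaf C)
  have "{T \<in> {T. T \<inter> C = {}}. v \<notin> T} = {T. T \<inter> insert v C = {}}" by auto
  then show ?case using leaf coord_split.leaf[of "insert v C" "Suc c" V] by (simp add: card_insert_if)
next
  case (split W D)
  show ?case
  proof (rule coord_split.split[OF split.hyps(1,2)])
    show "coord_split V (Suc c) {T. T \<union> W \<in> {T \<in> D. v \<notin> T}}"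
    proof (cases "v \<in> W")
      case True
      then have "{T. T \<union> W \<in> {T \<in> D. v \<notin> T}} = {}" by auto
      then show ?thesis by (simp only: coord_split.empty)
    next
      case False
      then have "{T. T \<union> W \<in> {T \<in> D. v \<notin> T}} = {T \<in> {T. T \<union> W \<in> D}. v \<notin> T}" by auto
      then show ?thesis using split.IH by simp
    qed
    have "{T \<in> {T \<in> D. v \<notin> T}. \<not> W \<subseteq> T} = {T \<in> {T \<in> D. \<not> W \<subseteq> T}. v \<notin> T}" by auto
    then show "coord_split V (Suc c) {T \<in> {T \<in> D. v \<notin> T}. \<not> W \<subseteq> T}" using split.IH by simp
  qed
qed

text \<open>
  This handles a generator in variables on which \<open>D\<close> does not depend. Splitting off one variable
  \<open>v \<in> F\<close> at a time leaves \<open>F - {v}\<close> to be avoided on the part divisible by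
  \<open>v\<close>, and costs one dimension on the other part.
\<close>

lemma coord_split_avoid:
  assumes "finite F" "F \<noteq> {}" "F \<subseteq> V" and D: "coord_split V c D"
    and "\<And>T v. v \<in> F \<Longrightarrow> insert v T \<in> D \<longleftrightarrow> T \<in> D"
  shows "coord_split V (Suc c) {T \<in> D. \<not> F \<subseteq> T}"
  using assms(1,2,3,5)
proof (induction F rule: finite_ne_induct)
  case (singleton v)
  then show ?case using coord_split_delete[OF D, of v] by simp
next
  case (insert v F)
  show ?case
  proof (rule coord_split.split[of "{v}"])
    have "{T. T \<union> {v} \<in> {T \<in> D. \<not> insert v F \<subseteq> T}} = {T \<in> D. \<not> F \<subseteq> T}"
      using insert by auto
    then show "coord_split V (Suc c) {T. T \<union> {v} \<in> {T \<in> D. \<not> insert v F \<subseteq> T}}"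
      using insert by simp
    have "{T \<in> {T \<in> D. \<not> insert v F \<subseteq> T}. \<not> {v} \<subseteq> T} = {T \<in> D. v \<notin> T}" by auto
    then show "coord_split V (Suc c) {T \<in> {T \<in> D. \<not> insert v F \<subseteq> T}. \<not> {v} \<subseteq> T}"
      using coord_split_delete[OF D] by simp
  qed (use insert in auto)
qed

text \<open>
  Let \<open>q\<close> be the one point of \<open>C\<close> up to \<open>b\<close>. If some interval other
  than \<open>[a', b]\<close> is private for \<open>q\<close>, then \<open>C\<close> itself is minimal for the
  larger family. Otherwise \<open>q\<close> only serves \<open>[a', b]\<close>, and can be exchanged for
  \<open>a\<close>, which only hits \<open>[a, b]\<close>.
\<close>

lemma minimal_cover_delete:
  assumes A: "admissible_pairs ((a, b) # (a', b') # ps)" and a': "a' \<le> b"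
    and C: "minimal_cover C (intervals ((a', b) # ps))"
  shows "\<exists>C'. minimal_cover C' (intervals ((a, b) # (a', b') # ps)) \<and> card C' = card C"
proof -
  have o: "a < a'" "a \<le> b" "b < b'" using A by (auto simp: admissible_pairs_Cons)
  have ps: "a' < x" "b' < y" if "(x, y) \<in> set ps" for x y using A that by (auto simp: admissible_pairs_Cons)
  have "admissible_pairs ((a', b) # ps)" using A a' by (auto simp: admissible_pairs_Cons)
  then obtain q where q: "C \<inter> {..b} = {q}" "q \<in> {a'..b}" "q \<in> C"
    using minimal_cover_initial[OF _ C] by blast
  have fin: "finite C" using C by (auto simp: minimal_cover_def)
  have hit: "F \<inter> C \<noteq> {}" if "F \<in> intervals ps" for F
    using minimal_cover_hit[OF C, of F] that by auto
  have priv: "\<exists>F\<in>intervals ps. F \<inter> C = {u}" if u: "u \<in> C" "u \<noteq> q" for u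
  proof -
    obtain F where F: "F \<in> intervals ((a', b) # ps)" "F \<inter> C = {u}"
      using minimal_cover_private[OF C u(1)] by blast
    have "F \<noteq> {a'..b}"
    proof
      assume "F = {a'..b}"
      then have "q \<in> F \<inter> C" using q by simp
      then show False using F(2) u by simp
    qed
    then show ?thesis using F by auto
  qed
  show ?thesis
  proof (cases "\<exists>F\<in>insert {a'..b'} (intervals ps). F \<inter> C = {q}")
    case True
    have "minimal_cover C (intervals ((a, b) # (a', b') # ps))"
      unfolding minimal_cover_def
    proof (intro conjI ballI)
      show "F \<inter> C \<noteq> {}" if "F \<in> intervals ((a, b) # (a', b') # ps)" for F
        using that hit q o by auto
      show "\<exists>F\<in>intervals ((a, b) # (a', b') # ps). F \<inter> C = {u}" if "u \<in> C" for u
      proof (cases "u = q")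
        case False
        then show ?thesis using priv[OF that] by auto
      qed (use True in auto)
    qed (rule fin)
    then show ?thesis by blast
  next
    case False
    define C' where "C' = insert a (C - {q})"
    have "a \<notin> C \<inter> {..b}" unfolding q(1) using q(2) o by auto
    then have aC: "a \<notin> C" using o by auto
    have le: "u > b" if "u \<in> C - {q}" for u using that q by force
    have "{a'..b'} \<inter> C \<noteq> {q}" using False by auto
    moreover have "q \<in> {a'..b'} \<inter> C" using q o by auto
    ultimately obtain q2 where q2: "q2 \<in> {a'..b'}" "q2 \<in> C" "q2 \<noteq> q" by blast
    have aF: "a \<notin> F" if "F \<in> intervals ps" for F using that ps o by (fastforce elim!: intervalsE)
    have "minimal_cover C' (intervals ((a, b) # (a', b') # ps))"
      unfolding minimal_cover_def
    proof (intro conjI ballI)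
      show "finite C'" using fin by (simp add: C'_def)
      show "F \<inter> C' \<noteq> {}" if F: "F \<in> intervals ((a, b) # (a', b') # ps)" for F
      proof -
        consider "F = {a..b}" | "F = {a'..b'}" | "F \<in> intervals ps" using F by auto
        then show ?thesis
        proof cases
          case 3
          then obtain u where "u \<in> F" "u \<in> C" "u \<noteq> q" using False hit[OF 3] by blast
          then show ?thesis by (auto simp: C'_def)
        qed (use o q2 in \<open>auto simp: C'_def\<close>)
      qed
      show "\<exists>F\<in>intervals ((a, b) # (a', b') # ps). F \<inter> C' = {u}" if u: "u \<in> C'" for u
      proof (cases "u = a")
        case True
        moreover have "v \<notin> {a..b}" if "v \<in> C - {q}" for v using le[OF that] by simp
        moreover have "a \<in> {a..b}" using o(2) by simp
        ultimately have "{a..b} \<inter> C' = {u}" unfolding C'_def by blast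
        then show ?thesis by (intro bexI[of _ "{a..b}"]) simp_all
      next
        case ne: False
        then obtain F where F: "F \<in> intervals ps" "F \<inter> C = {u}"
          using u priv[of u] by (auto simp: C'_def)
        then have "F \<inter> C' = {u}" using ne u aF[OF F(1)] unfolding C'_def by blast
        then show ?thesis using F by (intro bexI[of _ F]) simp_all
      qed
    qed
    moreover have "card C' = card C"
      using aC fin q(3) card_Suc_Diff1[OF fin q(3)] by (simp add: C'_def)
    ultimately show ?thesis by blast
  qed
qed

text \<open>
  If the first two intervals \<open>[a, b]\<close> and \<open>[a', b']\<close> overlap, take \<open>W = [a',
  b]\<close>. Dividing by \<open>x\<^sub>W\<close> turns the family into \<open>[a, a' - 1]\<close> and the
  derived family of \<open>greedy_count\<close>, which does not involve the former's variables. Killing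
  \<open>x\<^sub>W\<close> replaces both intervals by \<open>W\<close>. In both cases a minimal cover of the
  new family yields one of the old family of the same size.
\<close>

theorem coord_split_intervals:
  assumes "admissible_pairs ps" and "\<Union> (intervals ps) \<subseteq> V"
    and "\<And>C. minimal_cover C (intervals ps) \<Longrightarrow> card C \<le> c"
  shows "coord_split V c (avoiding (intervals ps))"
  using assms
proof (induction "length ps" arbitrary: ps c rule: less_induct)
  case less
  note A = less.prems(1) and V = less.prems(2) and c = less.prems(3)
  obtain C0 where C0: "minimal_cover C0 (intervals ps)" "card C0 = greedy_count ps"
    using ex_minimal_cover[OF A] by blast
  have disj: "coord_split V c (avoiding (intervals ps))" if ps: "ps = (a, b) # qs" and qs: "\<forall>(x, y)\<in>set qs. b < x" for a b qs
  proof -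
    have ab: "a \<le> b" "admissible_pairs qs" using A ps by (auto simp: admissible_pairs_Cons)
    have bd: "card C + 1 \<le> c" if C: "minimal_cover C (intervals qs)" for C
      using c[of "insert a C"] insert_minimal_cover[OF qs ab(1) C] C ps by (simp add: minimal_cover_def)
    obtain C1 where "minimal_cover C1 (intervals qs)" using ex_minimal_cover[OF ab(2)] by blast
    then have c1: "c \<ge> 1" using bd by fastforce
    have "coord_split V (c - 1) (avoiding (intervals qs))"
    proof (rule less.hyps)
      show "card C \<le> c - 1" if "minimal_cover C (intervals qs)" for C
        using bd[OF that] by simp
    qed (use ab V ps in auto)
    then have "coord_split V (Suc (c - 1)) {T \<in> avoiding (intervals qs). \<not> {a..b} \<subseteq> T}"
    proof (rule coord_split_avoid[rotated 3])
      fix T v assume "v \<in> {a..b}"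
      then have "v \<notin> F" if "F \<in> intervals qs" for F using qs that by (auto elim!: intervalsE)
      then show "insert v T \<in> avoiding (intervals qs) \<longleftrightarrow> T \<in> avoiding (intervals qs)"
        unfolding avoiding_def by (auto simp: subset_insert)
    qed (use ab V ps in auto)
    also have "{T \<in> avoiding (intervals qs). \<not> {a..b} \<subseteq> T} = avoiding (intervals ps)"
      by (auto simp: avoiding_def ps)
    finally show ?thesis using c1 by simp
  qed
  show ?case
  proof (cases ps rule: greedy_count.cases)
    case 1
    have "coord_split V c {T. T \<inter> {} = {}}" by (rule coord_split.leaf) auto
    then show ?thesis by (simp add: 1 avoiding_def)
  next
    case (2 a b)
    then show ?thesis by (intro disj) auto
  next
    case (3 a b a' b' ps')
    note A' = A[unfolded 3]
    have o: "a < a'" "a \<le> b" "b < b'" using A' by (auto simp: admissible_pairs_Cons)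
    have ps': "a' < x" "b' < y" "b < x \<or> x \<le> b" if "(x, y) \<in> set ps'" for x y
      using A' that by (auto simp: admissible_pairs_Cons)
    show ?thesis
    proof (cases "a' \<le> b")
      case False
      then show ?thesis using 3 A' by (intro disj[of a b "(a', b') # ps'"]) (auto simp: admissible_pairs_Cons)
    next
      case True
      let ?qs = "(b + 1, b') # drop_overlap (b + 1) ps'"
      let ?W = "{a'..b}"
      have bd: "card C + 1 \<le> c" if C: "minimal_cover C (intervals ?qs)" for C
        using c[of "insert a C"] insert_minimal_cover_link[OF A' True C] C 3 by (simp add: minimal_cover_def)
      obtain C1 where "minimal_cover C1 (intervals ?qs)" using ex_minimal_cover[OF admissible_pairs_link[OF A']] by blast
      then have c1: "c \<ge> 1" using bd by fastforce
      have qsV: "\<Union> (intervals ?qs) \<subseteq> V"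
      proof -
        have "{b + 1..b'} \<subseteq> {a'..b'}" using True by auto
        moreover have "intervals (drop_overlap (b + 1) ps') \<subseteq> intervals ps'" by (auto simp: intervals_def)
        ultimately show ?thesis using V unfolding 3 intervals_Cons by blast
      qed
      show ?thesis
      proof (rule coord_split.split[of ?W])
        show "?W \<subseteq> V" using V 3 o by auto
        have "length ?qs < length ps" using 3 by (simp add: le_imp_less_Suc)
        then have "coord_split V (c - 1) (avoiding (intervals ?qs))"
        proof (rule less.hyps)
          show "card C \<le> c - 1" if "minimal_cover C (intervals ?qs)" for C
            using bd[OF that] by simp
        qed (use admissible_pairs_link[OF A'] qsV in simp_all)
        then have "coord_split V (Suc (c - 1)) {T \<in> avoiding (intervals ?qs). \<not> {a..<a'} \<subseteq> T}"
        proof (rule coord_split_avoid[rotated 3])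
          fix T v assume "v \<in> {a..<a'}"
          then have "v \<notin> F" if "F \<in> intervals ?qs" for F using True that by (auto elim!: intervalsE)
          then show "insert v T \<in> avoiding (intervals ?qs) \<longleftrightarrow> T \<in> avoiding (intervals ?qs)"
            unfolding avoiding_def by (auto simp: subset_insert)
        qed (use o V 3 True in auto)
        also have "{T \<in> avoiding (intervals ?qs). \<not> {a..<a'} \<subseteq> T} = {T. T \<union> ?W \<in> avoiding (intervals ps)}"
        proof -
          have e1: "{a..b} \<subseteq> T \<union> ?W \<longleftrightarrow> {a..<a'} \<subseteq> T" for T
            using True o by (auto simp: subset_iff)
          have e2: "{x..y} \<subseteq> T \<union> ?W \<longleftrightarrow> {b + 1..y} \<subseteq> T" if "a' \<le> x" "x \<le> b + 1" for x y T
          proof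
            assume h: "{x..y} \<subseteq> T \<union> ?W"
            show "{b + 1..y} \<subseteq> T"
            proof
              fix u assume "u \<in> {b + 1..y}"
              then show "u \<in> T" using subsetD[OF h, of u] that by auto
            qed
          qed (use that in auto)
          have e3: "{x..y} \<subseteq> T \<union> ?W \<longleftrightarrow> {x..y} \<subseteq> T" if "b + 1 < x" for x y T
          proof
            assume h: "{x..y} \<subseteq> T \<union> ?W"
            show "{x..y} \<subseteq> T"
            proof
              fix u assume "u \<in> {x..y}"
              then show "u \<in> T" using subsetD[OF h, of u] that by auto
            qed
          qed auto
          have "(T \<in> avoiding (intervals ?qs) \<and> \<not> {a..<a'} \<subseteq> T) \<longleftrightarrow> T \<union> ?W \<in> avoiding (intervals ps)" for T
          proof -
            have "T \<union> ?W \<in> avoiding (intervals ps) \<longleftrightarrow> \<not> {a..<a'} \<subseteq> T \<and> \<not> {b + 1..b'} \<subseteq> T \<and>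
                (\<forall>(x, y)\<in>set ps'. \<not> {x..y} \<subseteq> T \<union> ?W)"
              using e1[of T] e2[of a' b' T] True by (auto simp: avoiding_def 3 intervals_def)
            also have "\<dots> \<longleftrightarrow> \<not> {a..<a'} \<subseteq> T \<and> \<not> {b + 1..b'} \<subseteq> T \<and>
                (\<forall>(x, y)\<in>set ps'. b + 1 < x \<longrightarrow> \<not> {x..y} \<subseteq> T)"
            proof -
              have "\<not> {x..y} \<subseteq> T \<union> ?W" if "(x, y) \<in> set ps'" "\<not> b + 1 < x" "\<not> {b + 1..b'} \<subseteq> T" for x y
              proof -
                have "{b + 1..b'} \<subseteq> {b + 1..y}" using ps'[OF that(1)] by auto
                then have "\<not> {b + 1..y} \<subseteq> T" using that(3) by (meson subset_trans)
                then show ?thesis using e2[of x y T] that(2) ps'[OF that(1)] by simp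
              qed
              then show ?thesis using e3 by blast
            qed
            also have "\<dots> \<longleftrightarrow> T \<in> avoiding (intervals ?qs) \<and> \<not> {a..<a'} \<subseteq> T"
              by (auto simp: avoiding_def intervals_def)
            finally show ?thesis by blast
          qed
          then show ?thesis by blast
        qed
        finally show "coord_split V c {T. T \<union> ?W \<in> avoiding (intervals ps)}" using c1 by simp
        have "coord_split V c (avoiding (intervals ((a', b) # ps')))"
        proof (rule less.hyps)
          show "admissible_pairs ((a', b) # ps')" using A' True by (auto simp: admissible_pairs_Cons)
          show "\<Union> (intervals ((a', b) # ps')) \<subseteq> V" using V 3 o by auto
          show "card C \<le> c" if C: "minimal_cover C (intervals ((a', b) # ps'))" for C
          proof -
          obtain C' where C': "minimal_cover C' (intervals ps)" "card C' = card C"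
            using minimal_cover_delete[OF A' True C] 3 by blast
          from c[OF C'(1)] C'(2) show ?thesis by simp
        qed
        qed (use 3 in simp)
        also have "avoiding (intervals ((a', b) # ps')) = {T \<in> avoiding (intervals ps). \<not> ?W \<subseteq> T}"
        proof -
          have "?W \<subseteq> {a..b}" "?W \<subseteq> {a'..b'}" using o by auto
          then show ?thesis unfolding 3 intervals_Cons by (rule avoiding_insert_subset)
        qed
        finally show "coord_split V c {T \<in> avoiding (intervals ps). \<not> ?W \<subseteq> T}" .
      qed auto
    qed
  qed
qed

section \<open>Smallest covers\<close>

text \<open>
  The point of \<open>C\<close> in the first interval hits none of the intervals that start beyond
  \<open>b\<close>.
\<close>

lemma disjoint_count_le_card:
  "admissible_pairs ps \<Longrightarrow> finite C \<Longrightarrow> (\<forall>F\<in>intervals ps. F \<inter> C \<noteq> {}) \<Longrightarrow> disjoint_count ps \<le> card C"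
proof (induction ps arbitrary: C rule: disjoint_count.induct)
  case (2 a b ps)
  have "{a..b} \<inter> C \<noteq> {}" using 2 by simp
  then obtain p where p: "p \<in> C" "p \<in> {a..b}" by blast
  have "\<forall>F\<in>intervals (drop_overlap b ps). F \<inter> (C - {p}) \<noteq> {}"
  proof
    fix F assume F: "F \<in> intervals (drop_overlap b ps)"
    then have "F \<in> intervals ps" "p \<notin> F" using p by (auto elim!: intervalsE intro: intervalsI)
    then show "F \<inter> (C - {p}) \<noteq> {}" using 2 by auto
  qed
  then have "disjoint_count (drop_overlap b ps) \<le> card (C - {p})"
    using 2 by (intro "2.IH") (auto simp: admissible_pairs_Cons admissible_pairs_filter)
  moreover have "card C = Suc (card (C - {p}))"
    using p(1) 2 card_Suc_Diff1[of C p] by metis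
  ultimately show ?case by simp
qed simp

text \<open>
  The right endpoint \<open>b\<close> of the first interval hits all intervals that start at \<open>b\<close>
  or before.
\<close>

lemma ex_cover_disjoint_count:
  "admissible_pairs ps \<Longrightarrow> \<exists>C. finite C \<and> C \<subseteq> \<Union> (intervals ps) \<and> (\<forall>F\<in>intervals ps. F \<inter> C \<noteq> {}) \<and> card C = disjoint_count ps"
proof (induction ps rule: disjoint_count.induct)
  case (2 a b ps)
  then have A: "admissible_pairs (drop_overlap b ps)" "a \<le> b" by (auto simp: admissible_pairs_Cons admissible_pairs_filter)
  then obtain C where C: "finite C" "C \<subseteq> \<Union> (intervals (drop_overlap b ps))"
    "\<forall>F\<in>intervals (drop_overlap b ps). F \<inter> C \<noteq> {}" "card C = disjoint_count (drop_overlap b ps)"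
    using "2.IH" by blast
  have "b \<notin> C" using C(2) by (auto simp: intervals_def)
  moreover have "F \<inter> insert b C \<noteq> {}" if F: "F \<in> intervals ((a, b) # ps)" for F
  proof -
    obtain x y where xy: "(x, y) \<in> set ((a, b) # ps)" "F = {x..y}" using F by (rule intervalsE)
    show ?thesis
    proof (cases "b < x")
      case True
      then have "F \<in> intervals (drop_overlap b ps)" using xy A by (auto intro!: intervalsI)
      then show ?thesis using C by auto
    next
      case False
      have "b \<le> y" using xy 2 by (auto simp: admissible_pairs_Cons)
      then have "b \<in> F" using False xy by auto
      then show ?thesis by auto
    qed
  qed
  moreover have "insert b C \<subseteq> \<Union> (intervals ((a, b) # ps))"
    using C(2) A by (auto simp: intervals_def)
  ultimately show ?case using C by (intro exI[of _ "insert b C"]) auto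
qed (auto simp: intervals_def)

section \<open>The numbers \<open>phi\<close> and \<open>psi\<close> in terms of covers\<close>

lemma filter_less_eq_drop:
  assumes "sorted_wrt (<) as" and "length as = length bs" and "k \<le> length as"
    and "\<And>i. i < k \<Longrightarrow> as ! i \<le> b" and "\<And>i. k \<le> i \<Longrightarrow> i < length as \<Longrightarrow> b < as ! i"
  shows "drop_overlap b (zip as bs) = zip (drop k as) (drop k bs)"
proof -
  let ?ps = "zip as bs"
  have "drop_overlap b ?ps = drop_overlap b (take k ?ps) @ drop_overlap b (drop k ?ps)"
    by (metis append_take_drop_id filter_append)
  also have "drop_overlap b (take k ?ps) = []"
    using assms by (force simp: filter_empty_conv in_set_conv_nth)
  also have "drop_overlap b (drop k ?ps) = drop k ?ps"
    using assms by (force simp: filter_id_conv in_set_conv_nth)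
  finally show ?thesis by (simp add: drop_zip)
qed

lemma jidx_char:
  assumes s: "sorted_wrt (<) as" and ne: "as \<noteq> []" and h: "as ! 0 \<le> bs ! 0"
  shows "i < jidx as bs \<Longrightarrow> as ! i \<le> bs ! 0"
    and "jidx as bs \<le> i \<Longrightarrow> i < length as \<Longrightarrow> bs ! 0 < as ! i"
proof -
  let ?A = "{i \<in> {1..length as}. as ! (i - 1) \<le> bs ! 0}"
  have "1 \<in> ?A" using ne h by (cases as) auto
  then have "Max ?A \<in> ?A" by (intro Max_in) auto
  then have m: "1 \<le> jidx as bs" "jidx as bs \<le> length as" "as ! (jidx as bs - 1) \<le> bs ! 0"
    by (auto simp: jidx_def)
  show "as ! i \<le> bs ! 0" if "i < jidx as bs"
  proof (cases "i = jidx as bs - 1")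
    case False
    then have "as ! i < as ! (jidx as bs - 1)"
      using that m s by (intro sorted_wrt_nth_less[of "(<)"]) auto
    then show ?thesis using m by simp
  qed (use m in simp)
  show "bs ! 0 < as ! i" if "jidx as bs \<le> i" "i < length as"
  proof (rule ccontr)
    assume "\<not> bs ! 0 < as ! i"
    then have "Suc i \<in> ?A" using that by auto
    then have "Suc i \<le> Max ?A" by (intro Max_ge) auto
    with that show False by (simp add: jidx_def)
  qed
qed

lemma admissible_pairs_zip:
  assumes "length as = length bs"
  shows "admissible_pairs (zip as bs) \<longleftrightarrow> sorted_wrt (<) as \<and> sorted_wrt (<) bs \<and> (\<forall>i<length as. as ! i \<le> bs ! i)"
  using assms by (auto simp: admissible_pairs_def sorted_wrt_iff_nth_less all_set_conv_all_nth)

lemma psi_eq_disjoint_count: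
  "length as = length bs \<Longrightarrow> admissible_pairs (zip as bs) \<Longrightarrow> psi n as bs = int n - int (disjoint_count (zip as bs))"
proof (induction "length as" arbitrary: as bs rule: less_induct)
  case less
  show ?case
  proof (cases as)
    case Nil
    then show ?thesis by (subst psi.simps) simp
  next
    case (Cons a as')
    then obtain b bs' where bs: "bs = b # bs'" using less by (cases bs) auto
    have s: "sorted_wrt (<) as" and all: "\<forall>i<length as. as ! i \<le> bs ! i"
      using less.prems admissible_pairs_zip by blast+
    then have h: "as ! 0 \<le> bs ! 0" "a \<le> b"
      using spec[OF all, of 0] Cons bs by simp_all
    have ne: "as \<noteq> []" using Cons by simp
    let ?j = "jidx as bs"
    note j = jidx_bounds[OF ne h(1)] jidx_char[OF s ne h(1)]
    have d: "drop_overlap b (zip as bs) = zip (drop ?j as) (drop ?j bs)"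
      using j bs by (intro filter_less_eq_drop s less.prems) auto
    moreover have "drop_overlap b (zip as bs) = drop_overlap b (zip as' bs')"
      using h by (simp add: Cons bs)
    moreover have "admissible_pairs (zip (drop ?j as) (drop ?j bs))"
      using admissible_pairs_filter[OF less.prems(2)] d by metis
    ultimately have "psi n (drop ?j as) (drop ?j bs) = int n - int (disjoint_count (drop_overlap b (zip as' bs')))"
      using less.hyps[of "drop ?j as" "drop ?j bs"] less.prems j ne by (simp add: length_greater_0_conv)
    then show ?thesis
      using ne h by (subst psi.simps) (simp add: alpha'_def beta'_def Cons bs)
  qed
qed

text \<open>
  As the \<open>a\<^sub>i\<close> increase, dropping the first \<open>j\<close> entries, or \<open>j +
  1\<close> of them if \<open>a\<^bsub>j+1\<^esub> = b\<^sub>1 + 1\<close>, keeps exactly the intervals that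
  start beyond \<open>b\<^sub>1 + 1\<close>.
\<close>

lemma phi_eq_greedy_count:
  "length as = length bs \<Longrightarrow> admissible_pairs (zip as bs) \<Longrightarrow> phi n as bs = int n - int (greedy_count (zip as bs))"
proof (induction "length as" arbitrary: as bs rule: less_induct)
  case less
  show ?case
  proof (cases as)
    case Nil
    then show ?thesis by (subst phi.simps) simp
  next
    case (Cons a as')
    then obtain b bs' where bs: "bs = b # bs'" using less by (cases bs) auto
    have s: "sorted_wrt (<) as" and all: "\<forall>i<length as. as ! i \<le> bs ! i"
      using less.prems admissible_pairs_zip by blast+
    then have h: "as ! 0 \<le> bs ! 0" "a \<le> b"
      using spec[OF all, of 0] Cons bs by simp_all
    have ne: "as \<noteq> []" using Cons by simp
    let ?j = "jidx as bs"
    note j = jidx_bounds[OF ne h(1)] jidx_char[OF s ne h(1)]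
    have phi: "phi n as bs = (if ?j = 1 then phi n (drop ?j as) (drop ?j bs) - 1
        else phi n (alpha'' as bs) (beta'' as bs) - 1)"
      using ne h by (subst phi.simps) (simp add: alpha'_def beta'_def)
    show ?thesis
    proof (cases as')
      case Nil
      then have "?j = 1" using j Cons by simp
      moreover have "phi n [] cs = int n" for cs by (subst phi.simps) simp
      ultimately show ?thesis using phi Nil Cons bs less.prems by simp
    next
      case (Cons a2 as2)
      then obtain b2 bs2 where bs': "bs' = b2 # bs2" using less \<open>as = a # as'\<close> bs by (cases bs') auto
      note as = \<open>as = a # as'\<close>[unfolded Cons] and bs = bs[unfolded bs']
      have len: "length as2 = length bs2" using less.prems as bs by simp
      have A: "admissible_pairs ((a, b) # (a2, b2) # zip as2 bs2)" using less.prems as bs by simp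
      show ?thesis
      proof (cases "a2 \<le> b")
        case False
        have "?j = 1" 
        proof (rule ccontr)
          assume "?j \<noteq> 1"
          then have "1 < ?j" using j by simp
          then show False using j(3)[of 1] False as bs by simp
        qed
        moreover have "phi n (a2 # as2) (b2 # bs2) = int n - int (greedy_count (zip (a2 # as2) (b2 # bs2)))"
          using less.prems A as bs by (intro less.hyps) (auto simp: admissible_pairs_Cons)
        ultimately show ?thesis using phi False as bs by simp
      next
        case True
        have j1: "?j \<noteq> 1" using j(4)[of 1] True as bs by auto
        then have j2: "2 \<le> ?j" using j(1) by simp
        let ?rest = "drop_overlap (b + 1) (zip as2 bs2)"
        have f2: "drop_overlap (b + 1) (zip as bs) = ?rest"
          using True h by (simp add: as bs)
        have k: "?rest = zip (drop k as) (drop k bs)"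
          if "k \<le> length as" "\<And>i. i < k \<Longrightarrow> as ! i \<le> b + 1" "\<And>i. k \<le> i \<Longrightarrow> i < length as \<Longrightarrow> b + 1 < as ! i" for k
          using filter_less_eq_drop[OF s less.prems(1) that] f2 by simp
        have sm: "as ! i < as ! i'" if "i < i'" "i' < length as" for i i'
          using s that by (simp add: sorted_wrt_nth_less)
        have zip: "zip (alpha'' as bs) (beta'' as bs) = (b + 1, b2) # ?rest \<and>
            length (alpha'' as bs) = length (beta'' as bs) \<and> length (alpha'' as bs) < length as"
        proof -
          consider "?j = length as" | "?j < length as" "as ! ?j > b + 1" | "?j < length as" "as ! ?j = b + 1"
            using j(2) j(4)[of ?j] bs by fastforce
          then show ?thesis
          proof cases
            case 1
            have "?rest = zip (drop ?j as) (drop ?j bs)"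
              using j bs 1 by (intro k) (auto intro: le_SucI)
            then show ?thesis using 1 as bs j2 by (simp add: alpha''_def beta''_def Let_def)
          next
            case 2
            have "?rest = zip (drop ?j as) (drop ?j bs)"
            proof (rule k)
              show "b + 1 < as ! i" if "?j \<le> i" "i < length as" for i
                using sm[of ?j i] that 2 by (cases "i = ?j") auto
            qed (use j bs in \<open>auto intro: le_SucI\<close>)
            then show ?thesis using 2 as bs j2 less.prems(1) by (simp add: alpha''_def beta''_def Let_def)
          next
            case 3
            have "?rest = zip (drop (?j + 1) as) (drop (?j + 1) bs)"
            proof (rule k)
              show "b + 1 < as ! i" if "?j + 1 \<le> i" "i < length as" for i
                using sm[of ?j i] that 3 by auto
              show "as ! i \<le> b + 1" if "i < ?j + 1" for i
                using that j(3)[of i] 3 bs by (cases "i = ?j") (auto intro: le_SucI)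
            qed (use 3 in auto)
            then show ?thesis using 3 as bs j2 less.prems(1) by (simp add: alpha''_def beta''_def Let_def)
          qed
        qed
        then have "phi n (alpha'' as bs) (beta'' as bs) = int n - int (greedy_count ((b + 1, b2) # ?rest))"
          using less.hyps[of "alpha'' as bs" "beta'' as bs"] admissible_pairs_link[OF A] by simp
        then show ?thesis using phi j1 True as bs by simp
      qed
    qed
  qed
qed

section \<open>Ideals and regular sequences in a subring\<close>

text \<open>
  All rings \<open>K[V]\<close> are subsets of one type. Ideals, quotients and regular sequences are therefore
  taken relative to a subset \<open>S\<close> of the type.
\<close>

locale subring_of_type =
  fixes S :: "'a::comm_ring_1 set"
  assumes zero_S [simp, intro]: "0 \<in> S" and one_S [simp, intro]: "1 \<in> S"
    and add_S [simp, intro]: "x \<in> S \<Longrightarrow> y \<in> S \<Longrightarrow> x + y \<in> S"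
    and mult_S [simp, intro]: "x \<in> S \<Longrightarrow> y \<in> S \<Longrightarrow> x * y \<in> S"
    and uminus_S [simp, intro]: "x \<in> S \<Longrightarrow> - x \<in> S"
begin

lemma diff_S [simp, intro]: "x \<in> S \<Longrightarrow> y \<in> S \<Longrightarrow> x - y \<in> S"
  using add_S[of x "- y"] by simp

lemma sum_S: "(\<And>i. i \<in> A \<Longrightarrow> f i \<in> S) \<Longrightarrow> sum f A \<in> S"
  by (induction A rule: infinite_finite_induct) auto

lemma power_S [simp, intro]: "x \<in> S \<Longrightarrow> x ^ k \<in> S"
  by (induction k) auto

definition idl :: "'a set \<Rightarrow> bool" where
  "idl J \<longleftrightarrow> J \<subseteq> S \<and> 0 \<in> J \<and> (\<forall>x\<in>J. \<forall>y\<in>J. x + y \<in> J) \<and> (\<forall>s\<in>S. \<forall>x\<in>J. s * x \<in> J)"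

lemma idl_S: "idl S"
  by (auto simp: idl_def)

lemma idl_sub: "idl J \<Longrightarrow> x \<in> J \<Longrightarrow> x \<in> S"
  and idl_zero: "idl J \<Longrightarrow> 0 \<in> J"
  and idl_add: "idl J \<Longrightarrow> x \<in> J \<Longrightarrow> y \<in> J \<Longrightarrow> x + y \<in> J"
  and idl_mult: "idl J \<Longrightarrow> s \<in> S \<Longrightarrow> x \<in> J \<Longrightarrow> s * x \<in> J"
  by (auto simp: idl_def)

lemma idl_mult_right: "idl J \<Longrightarrow> s \<in> S \<Longrightarrow> x \<in> J \<Longrightarrow> x * s \<in> J"
  using idl_mult[of J s x] by (simp add: mult.commute)

lemma idl_uminus: "idl J \<Longrightarrow> x \<in> J \<Longrightarrow> - x \<in> J"
  using idl_mult[of J "- 1" x] by simp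

lemma idl_diff: "idl J \<Longrightarrow> x \<in> J \<Longrightarrow> y \<in> J \<Longrightarrow> x - y \<in> J"
  using idl_add[of J x "- y"] idl_uminus[of J y] by simp

lemma idl_add_cancel: "idl J \<Longrightarrow> y \<in> J \<Longrightarrow> x + y \<in> J \<longleftrightarrow> x \<in> J"
  using idl_add[of J x y] idl_diff[of J "x + y" y] by auto

lemma idl_sum: "idl J \<Longrightarrow> (\<And>i. i \<in> A \<Longrightarrow> f i \<in> J) \<Longrightarrow> sum f A \<in> J"
  by (induction A rule: infinite_finite_induct) (auto simp: idl_zero idl_add)

text \<open>
  The ideal \<open>(J, f)\<close>.
\<close>

definition adjoin :: "'a set \<Rightarrow> 'a \<Rightarrow> 'a set" where
  "adjoin J f = {j + f * u | j u. j \<in> J \<and> u \<in> S}"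

lemma adjoinI: "j \<in> J \<Longrightarrow> u \<in> S \<Longrightarrow> x = j + f * u \<Longrightarrow> x \<in> adjoin J f"
  by (auto simp: adjoin_def)

lemma adjoinE:
  assumes "x \<in> adjoin J f"
  obtains j u where "j \<in> J" "u \<in> S" "x = j + f * u"
  using assms by (auto simp: adjoin_def)

lemma idl_adjoin:
  assumes J: "idl J" and f: "f \<in> S"
  shows "idl (adjoin J f)"
  unfolding idl_def
proof (intro conjI ballI subsetI)
  show "x \<in> S" if "x \<in> adjoin J f" for x
    using that f by (auto elim!: adjoinE dest: idl_sub[OF J])
  show "0 \<in> adjoin J f"
    by (rule adjoinI[of 0 _ 0]) (auto simp: idl_zero[OF J])
  show "x + y \<in> adjoin J f" if x: "x \<in> adjoin J f" and y: "y \<in> adjoin J f" for x y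
  proof -
    obtain j u where 1: "j \<in> J" "u \<in> S" "x = j + f * u" using x by (rule adjoinE)
    obtain j' u' where 2: "j' \<in> J" "u' \<in> S" "y = j' + f * u'" using y by (rule adjoinE)
    show ?thesis
      by (rule adjoinI[of "j + j'" _ "u + u'"]) (use 1 2 in \<open>auto simp: algebra_simps idl_add[OF J]\<close>)
  qed
  show "s * x \<in> adjoin J f" if s: "s \<in> S" and x: "x \<in> adjoin J f" for s x
  proof -
    obtain j u where 1: "j \<in> J" "u \<in> S" "x = j + f * u" using x by (rule adjoinE)
    show ?thesis
      by (rule adjoinI[of "s * j" _ "s * u"]) (use 1 s in \<open>auto simp: algebra_simps idl_mult[OF J] idl_mult_right[OF J]\<close>)
  qed
qed

lemma adjoin_superset: "idl J \<Longrightarrow> J \<subseteq> adjoin J f"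
  by (auto intro: adjoinI[of _ J 0])

lemma adjoin_self: "idl J \<Longrightarrow> f \<in> adjoin J f"
  by (auto intro: adjoinI[of 0 J 1] idl_zero)

lemma adjoin_least: "idl L \<Longrightarrow> J \<subseteq> L \<Longrightarrow> f \<in> L \<Longrightarrow> adjoin J f \<subseteq> L"
  by (auto elim!: adjoinE intro!: idl_add simp: mult.commute[of f] idl_mult)

lemma adjoin_commute: "adjoin (adjoin J f) g = adjoin (adjoin J g) f"
proof -
  have "adjoin (adjoin J f) g \<subseteq> adjoin (adjoin J g) f" for f g
  proof
    fix x assume "x \<in> adjoin (adjoin J f) g"
    then obtain j u v where 1: "j \<in> J" "u \<in> S" "v \<in> S" "x = j + f * u + g * v"
      by (auto elim!: adjoinE)
    then show "x \<in> adjoin (adjoin J g) f"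
      by (intro adjoinI[of "j + g * v" _ u] adjoinI[of j J v]) (auto simp: algebra_simps)
  qed
  then show ?thesis by blast
qed

definition regular_mod :: "'a set \<Rightarrow> 'a \<Rightarrow> bool" where
  "regular_mod J f \<longleftrightarrow> (\<forall>x\<in>S. f * x \<in> J \<longrightarrow> x \<in> J)"

text \<open>
  Weak regularity on \<open>S/J\<close>: nothing is said about \<open>S/(J, fs)\<close> being nonzero.
\<close>

fun weakly_regular :: "'a set \<Rightarrow> 'a list \<Rightarrow> bool" where
  "weakly_regular J [] \<longleftrightarrow> True"
| "weakly_regular J (f # fs) \<longleftrightarrow> regular_mod J f \<and> weakly_regular (adjoin J f) fs"

definition colon :: "'a set \<Rightarrow> 'a \<Rightarrow> 'a set" where
  "colon J w = {x \<in> S. w * x \<in> J}"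

lemma colon_adjoin:
  assumes J: "idl J" and w: "w \<in> S" and f: "f \<in> S" and reg: "regular_mod (adjoin J w) f"
  shows "colon (adjoin J f) w = adjoin (colon J w) f"
proof
  show "colon (adjoin J f) w \<subseteq> adjoin (colon J w) f"
  proof
    fix x assume "x \<in> colon (adjoin J f) w"
    then obtain i y where x: "x \<in> S" and i: "i \<in> J" and y: "y \<in> S" and e: "w * x = i + f * y"
      by (auto simp: colon_def elim!: adjoinE)
    have "f * y \<in> adjoin J w"
      by (rule adjoinI[of "- i" _ x]) (use i x e idl_uminus[OF J] in auto)
    then have "y \<in> adjoin J w"
      using reg y by (auto simp: regular_mod_def)
    then obtain i' z where i': "i' \<in> J" and z: "z \<in> S" and y': "y = i' + w * z"
      by (rule adjoinE)
    have "w * (x - f * z) = i + f * i'"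
      using e y' by (simp add: algebra_simps)
    also have "\<dots> \<in> J"
      using i i' f by (intro idl_add[OF J] idl_mult[OF J])
    finally have "x - f * z \<in> colon J w"
      using x f z by (auto simp: colon_def)
    then show "x \<in> adjoin (colon J w) f"
      by (rule adjoinI[of _ _ z]) (use z in auto)
  qed
  show "adjoin (colon J w) f \<subseteq> colon (adjoin J f) w"
  proof
    fix x assume "x \<in> adjoin (colon J w) f"
    then obtain j u where j: "j \<in> S" "w * j \<in> J" and u: "u \<in> S" and x: "x = j + f * u"
      by (auto simp: colon_def elim!: adjoinE)
    have "w * x \<in> adjoin J f"
      by (rule adjoinI[of "w * j" _ "w * u"]) (use j u x w in \<open>auto simp: algebra_simps\<close>)
    then show "x \<in> colon (adjoin J f) w"
      using j u x f by (auto simp: colon_def)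
  qed
qed

text \<open>
  This is regularity on the middle term of the exact sequence \<open>0 \<rightarrow> S/(J : w) \<rightarrow>
  S/J \<rightarrow> S/(J, w) \<rightarrow> 0\<close>, given regularity on the outer terms. Since the first
  element is regular on \<open>S/(J, w)\<close>, the sequence stays exact modulo that element, which is the
  content of \<open>colon_adjoin\<close>.
\<close>

lemma weakly_regular_of_colon_and_adjoin:
  assumes "idl J" and "w \<in> S" and "set fs \<subseteq> S"
    and "weakly_regular (colon J w) fs" and "weakly_regular (adjoin J w) fs"
  shows "weakly_regular J fs"
  using assms
proof (induction fs arbitrary: J)
  case (Cons f fs)
  have f: "f \<in> S" and fs: "set fs \<subseteq> S" using Cons.prems by auto
  have rc: "regular_mod (colon J w) f" and ra: "regular_mod (adjoin J w) f"
    using Cons.prems by auto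
  have "regular_mod J f"
    unfolding regular_mod_def
  proof (intro ballI impI)
    fix x assume x: "x \<in> S" and fx: "f * x \<in> J"
    have "x \<in> adjoin J w"
      using ra x fx adjoin_superset[OF Cons.prems(1)] by (auto simp: regular_mod_def)
    then obtain i z where i: "i \<in> J" and z: "z \<in> S" and x': "x = i + w * z"
      by (rule adjoinE)
    have "w * (f * z) = f * x - f * i"
      using x' by (simp add: algebra_simps)
    also have "\<dots> \<in> J"
      using idl_diff[OF Cons.prems(1) fx idl_mult[OF Cons.prems(1) f i]] .
    finally have "f * z \<in> colon J w"
      using f z by (auto simp: colon_def)
    then have "z \<in> colon J w"
      using rc z by (auto simp: regular_mod_def)
    then show "x \<in> J"
      using i x' by (auto simp: colon_def idl_add[OF Cons.prems(1)])
  qed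
  moreover have "weakly_regular (adjoin J f) fs"
  proof (rule Cons.IH)
    show "idl (adjoin J f)" using Cons.prems f by (intro idl_adjoin)
    show "weakly_regular (colon (adjoin J f) w) fs"
      using Cons.prems f ra by (simp add: colon_adjoin)
    show "weakly_regular (adjoin (adjoin J f) w) fs"
      using Cons.prems by (simp add: adjoin_commute[of J f w])
  qed (use Cons.prems fs in auto)
  ultimately show ?case by simp
qed simp

lemma regular_mod_cong:
  assumes J: "idl J" and "f - g \<in> J" and g: "regular_mod J g"
  shows "regular_mod J f"
  unfolding regular_mod_def
proof (intro ballI impI)
  fix x assume x: "x \<in> S" and fx: "f * x \<in> J"
  have "g * x = f * x - x * (f - g)" by (simp add: algebra_simps)
  also have "\<dots> \<in> J" using idl_diff[OF J fx idl_mult[OF J x assms(2)]] .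
  finally show "x \<in> J" using g x by (auto simp: regular_mod_def)
qed

lemma adjoin_cong:
  assumes J: "idl J" and "f \<in> S" "g \<in> S" and d: "f - g \<in> J"
  shows "adjoin J f = adjoin J g"
proof -
  have *: "adjoin J f \<subseteq> adjoin J g" if "f - g \<in> J" "g \<in> S" for f g
  proof (rule adjoin_least[OF idl_adjoin[OF J that(2)] adjoin_superset[OF J]])
    show "f \<in> adjoin J g" by (rule adjoinI[of "f - g" _ 1]) (use that in auto)
  qed
  show ?thesis
    using *[OF d] *[of g f] assms idl_uminus[OF J d] by auto
qed

end

text \<open>
  The product of the \<open>f i\<close> with exponents from a list. The head of the list belongs to the
  element of largest index, so that the list without its head is a product of the preceding elements.
\<close>

fun mon_val :: "(nat \<Rightarrow> 'a::comm_ring_1) \<Rightarrow> nat list \<Rightarrow> 'a" where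
  "mon_val f [] = 1"
| "mon_val f (i # l) = f (length l) ^ i * mon_val f l"

text \<open>
  The smallest exponent \<open>i\<close> of the last element \<open>f r\<close> is factored out, and the terms
  in which no further \<open>f r\<close> is left are collected.
\<close>

lemma sum_mon_val_Suc:
  fixes f :: "nat \<Rightarrow> 'a::comm_ring_1"
  assumes A: "finite A" "A \<noteq> {}" "\<forall>l\<in>A. length l = Suc r"
  shows "\<exists>i A'. finite A' \<and> A' \<noteq> {} \<and> (\<forall>l\<in>A'. i # l \<in> A) \<and> (\<forall>l\<in>A. i \<le> hd l) \<and>
    (\<Sum>l\<in>A. c l * mon_val f l) =
      f r ^ i * ((\<Sum>l\<in>A'. c (i # l) * mon_val f l) +
        f r * (\<Sum>l\<in>{l \<in> A. i < hd l}. c l * (f r ^ (hd l - i - 1) * mon_val f (tl l))))"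
proof -
  define i where "i = Min (hd ` A)"
  define A' where "A' = {l. i # l \<in> A}"
  have i: "i \<le> hd l" if "l \<in> A" for l
    using A that by (auto simp: i_def)
  have mv: "mon_val f l = f r ^ hd l * mon_val f (tl l)" if "l \<in> A" for l
    using bspec[OF A(3) that] by (cases l) auto
  have "i \<in> hd ` A"
    using A unfolding i_def by (intro Min_in) auto
  then obtain l where "l \<in> A" "hd l = i" by auto
  with bspec[OF A(3), of l] have "tl l \<in> A'" by (cases l) (auto simp: A'_def)
  then have ne: "A' \<noteq> {}" by auto
  have fin: "finite A'"
    unfolding A'_def using finite_vimageI[OF A(1), of "(#) i"] by (simp add: vimage_def)
  have "(\<Sum>l\<in>A. c l * mon_val f l) = (\<Sum>l\<in>{l\<in>A. hd l = i}. c l * mon_val f l) + (\<Sum>l\<in>{l\<in>A. i < hd l}. c l * mon_val f l)"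
    using A(1) i by (subst sum.union_disjoint[symmetric]) (force intro: sum.cong)+
  also have "(\<Sum>l\<in>{l\<in>A. hd l = i}. c l * mon_val f l) = (\<Sum>l\<in>A'. c (i # l) * mon_val f (i # l))"
  proof (rule sum.reindex_bij_witness[of _ "(#) i" tl])
    fix l assume "l \<in> {l\<in>A. hd l = i}"
    then show "i # tl l = l" "tl l \<in> A'" "c (i # tl l) * mon_val f (i # tl l) = c l * mon_val f l"
      using bspec[OF A(3), of l] by (cases l; auto simp: A'_def)+
  qed (auto simp: A'_def)
  also have "\<dots> = f r ^ i * (\<Sum>l\<in>A'. c (i # l) * mon_val f l)"
    unfolding sum_distrib_left
  proof (rule sum.cong)
    show "c (i # l) * mon_val f (i # l) = f r ^ i * (c (i # l) * mon_val f l)" if "l \<in> A'" for l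
      using bspec[OF A(3), of "i # l"] that by (simp add: A'_def mult.left_commute)
  qed simp
  also have "(\<Sum>l\<in>{l\<in>A. i < hd l}. c l * mon_val f l) =
      f r ^ i * (f r * (\<Sum>l\<in>{l \<in> A. i < hd l}. c l * (f r ^ (hd l - i - 1) * mon_val f (tl l))))"
    unfolding sum_distrib_left
  proof (rule sum.cong)
    fix l assume l: "l \<in> {l \<in> A. i < hd l}"
    then have "f r ^ hd l = f r ^ (i + Suc (hd l - i - 1))" by simp
    then have "f r ^ hd l = f r ^ i * (f r * f r ^ (hd l - i - 1))" by (simp only: power_add power_Suc)
    then show "c l * mon_val f l = f r ^ i * (f r * (c l * (f r ^ (hd l - i - 1) * mon_val f (tl l))))"
      using l by (simp add: mv mult_ac)
  qed simp
  finally show ?thesis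
    using fin ne i by (intro exI[of _ i] exI[of _ A']) (auto simp: A'_def distrib_left)
qed

section \<open>Regular sequences are quasi-regular\<close>

text \<open>
  \<open>f 0, f 1, \<dots>\<close> is meant to be a regular sequence on \<open>S/I\<close>; the regularity is
  assumed in the lemmas, only for as many elements as they use.
\<close>

locale regular_chain = subring_of_type S for S :: "'a::comm_ring_1 set" +
  fixes I :: "'a set" and f :: "nat \<Rightarrow> 'a"
  assumes idl_I: "idl I" and f_S [simp, intro]: "f i \<in> S"
begin

text \<open>
  For \<open>k > 0\<close> this is \<open>I + (f\<^sub>0, \<dots>, f\<^bsub>r-1\<^esub>)\<^sup>k L\<close>.
  The recursion splits the products of \<open>k\<close> elements into those without and those with the last
  element. The case \<open>L = S\<close> is the adic filtration of \<open>S/I\<close>; the general case keeps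
  track of coefficients in the associated graded module, where \<open>L\<close> contains \<open>(I, f\<^sub>0,
  \<dots>, f\<^bsub>r-1\<^esub>)\<close>.
\<close>

fun fil :: "nat \<Rightarrow> nat \<Rightarrow> 'a set \<Rightarrow> 'a set" where
  "fil r 0 L = L"
| "fil 0 (Suc k) L = I"
| "fil (Suc r) (Suc k) L = {g + f r * h | g h. g \<in> fil r (Suc k) L \<and> h \<in> fil (Suc r) k L}"

text \<open>
  The ideal \<open>(I, f\<^sub>0, \<dots>, f\<^bsub>r-1\<^esub>)\<close>.
\<close>

definition J :: "nat \<Rightarrow> 'a set" where
  "J r = fil r 1 S"

lemma J_0: "J 0 = I"
  by (simp add: J_def)

lemma J_Suc: "J (Suc r) = adjoin (J r) (f r)"
  by (auto simp: J_def adjoin_def)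

lemma fil_SucI: "g \<in> fil r (Suc k) L \<Longrightarrow> h \<in> fil (Suc r) k L \<Longrightarrow> x = g + f r * h \<Longrightarrow> x \<in> fil (Suc r) (Suc k) L"
  by auto

lemma fil_SucE:
  assumes "x \<in> fil (Suc r) (Suc k) L"
  obtains g h where "g \<in> fil r (Suc k) L" "h \<in> fil (Suc r) k L" "x = g + f r * h"
  using assms by auto

declare fil.simps(3) [simp del]

lemma idl_fil: "idl L \<Longrightarrow> idl (fil r k L)"
proof (induction r k L rule: fil.induct)
  case (3 r k L)
  then have g: "idl (fil r (Suc k) L)" and h: "idl (fil (Suc r) k L)" by auto
  show ?case
    unfolding idl_def
  proof (intro conjI ballI subsetI)
    show "x \<in> S" if "x \<in> fil (Suc r) (Suc k) L" for x
      using that by (auto elim!: fil_SucE dest: idl_sub[OF g] idl_sub[OF h])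
    show "0 \<in> fil (Suc r) (Suc k) L"
      by (rule fil_SucI[of 0 _ _ _ 0]) (auto simp: idl_zero g h)
    show "x + y \<in> fil (Suc r) (Suc k) L"
      if x: "x \<in> fil (Suc r) (Suc k) L" and y: "y \<in> fil (Suc r) (Suc k) L" for x y
    proof -
      obtain j u where 1: "j \<in> fil r (Suc k) L" "u \<in> fil (Suc r) k L" "x = j + f r * u"
        using x by (rule fil_SucE)
      obtain j' u' where 2: "j' \<in> fil r (Suc k) L" "u' \<in> fil (Suc r) k L" "y = j' + f r * u'"
        using y by (rule fil_SucE)
      show ?thesis
        by (rule fil_SucI[of "j + j'" _ _ _ "u + u'"])
          (use 1 2 in \<open>auto simp: algebra_simps idl_add[OF g] idl_add[OF h]\<close>)
    qed
    show "s * x \<in> fil (Suc r) (Suc k) L" if s: "s \<in> S" and x: "x \<in> fil (Suc r) (Suc k) L" for s x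
    proof -
      obtain j u where 1: "j \<in> fil r (Suc k) L" "u \<in> fil (Suc r) k L" "x = j + f r * u"
        using x by (rule fil_SucE)
      show ?thesis
        by (rule fil_SucI[of "s * j" _ _ _ "s * u"])
          (use 1 s in \<open>auto simp: algebra_simps idl_mult[OF g] idl_mult[OF h] idl_mult_right[OF g] idl_mult_right[OF h]\<close>)
    qed
  qed
qed (auto simp: idl_I)

lemma idl_J: "idl (J r)"
  by (simp add: J_def idl_fil idl_S)

lemma J_mono: "r \<le> r' \<Longrightarrow> J r \<subseteq> J r'"
  by (induction rule: dec_induct) (use adjoin_superset[OF idl_J] J_Suc in auto)

lemma f_J: "i < r \<Longrightarrow> f i \<in> J r"
  using J_mono[of "Suc i" r] adjoin_self[OF idl_J[of i], of "f i"] by (auto simp: J_Suc)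

lemma I_J: "I \<subseteq> J r"
  using J_mono[of 0 r] by (simp add: J_0)

lemma fil_Suc_Suc: "fil (Suc r) (Suc k) L = {g + f r * h | g h. g \<in> fil r (Suc k) L \<and> h \<in> fil (Suc r) k L}"
  by (rule fil.simps(3))

lemma fil_Suc_mono:
  "fil r (Suc k) L \<subseteq> fil r (Suc k') L' \<Longrightarrow> fil (Suc r) k L \<subseteq> fil (Suc r) k' L'
    \<Longrightarrow> fil (Suc r) (Suc k) L \<subseteq> fil (Suc r) (Suc k') L'"
  unfolding fil_Suc_Suc by blast

lemma fil_mono: "L \<subseteq> L' \<Longrightarrow> fil r k L \<subseteq> fil r k L'"
  by (induction r k L rule: fil.induct) (simp_all add: fil_Suc_mono)

lemma fil_sub_S: "idl L \<Longrightarrow> x \<in> fil r k L \<Longrightarrow> x \<in> S"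
  using idl_fil idl_sub by blast

lemma fil_le_fil_S: "idl L \<Longrightarrow> fil r k L \<subseteq> fil r k S"
  by (rule fil_mono) (auto dest: idl_sub)

lemma fil_Suc_left:
  assumes L: "idl L" and IL: "I \<subseteq> L"
  shows "fil r k L \<subseteq> fil (Suc r) k L"
proof (cases k)
  case (Suc k')
  show ?thesis
    unfolding Suc
  proof
    show "x \<in> fil (Suc r) (Suc k') L" if "x \<in> fil r (Suc k') L" for x
      by (rule fil_SucI[OF that, of 0]) (auto intro: idl_zero idl_fil L)
  qed
qed simp

lemma fil_Suc_sub: "J r \<subseteq> L \<Longrightarrow> fil r (Suc k) S \<subseteq> fil r k L"
proof (induction r k L rule: fil.induct)
  case (1 r L)
  then show ?case by (simp add: J_def)
next
  case (3 r k L)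
  then have "fil r (Suc (Suc k)) S \<subseteq> fil r (Suc k) L" "fil (Suc r) (Suc k) S \<subseteq> fil (Suc r) k L"
    using J_mono[of r "Suc r"] by auto
  then show ?case
    by (rule fil_Suc_mono)
qed auto

lemma fil_antimono: "fil r (Suc k) S \<subseteq> fil r k S"
  using fil_Suc_sub[of r S k] idl_sub[OF idl_J] by blast

lemma mult_fil:
  assumes L: "idl L" and Lr: "I \<subseteq> L" "i < r" and h: "h \<in> fil r k L"
  shows "f i * h \<in> fil r (Suc k) L"
  using Lr(2) h
proof (induction r arbitrary: k h)
  case (Suc r k h)
  note IH = Suc.IH
  show ?case
  proof (cases "i = r")
    case True
    then show ?thesis
      using Suc.prems by (intro fil_SucI[of 0 r k L h] idl_zero idl_fil L) auto
  next
    case False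
    then have ir: "i < r" using Suc.prems by auto
    from Suc.prems(2) show ?thesis
    proof (induction k arbitrary: h)
      case 0
      then show ?case
        using Suc.IH[of h 0] ir fil_Suc_left[OF L Lr(1), of r "Suc 0"] by auto
    next
      case (Suc k)
      obtain a b where ab: "a \<in> fil r (Suc k) L" "b \<in> fil (Suc r) k L" "h = a + f r * b"
        using Suc.prems by (rule fil_SucE)
      have "f i * a \<in> fil r (Suc (Suc k)) L" "f i * b \<in> fil (Suc r) (Suc k) L"
        using IH[OF ir ab(1)] Suc.IH[OF ab(2)] by auto
      then show ?case
        by (rule fil_SucI) (simp add: ab(3) distrib_left mult.left_commute)
    qed
  qed
qed simp

lemma I_fil: "I \<subseteq> fil r k S"
proof (induction r)
  case 0
  then show ?case by (cases k) (auto dest: idl_sub[OF idl_I])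
next
  case (Suc r)
  then show ?case using fil_Suc_left[of S r k] idl_sub[OF idl_I] by (auto simp: idl_S)
qed

lemma fil_J_sub: "r \<le> q \<Longrightarrow> fil r k (J q) \<subseteq> fil q (Suc k) S"
proof (induction r k "J q" rule: fil.induct)
  case (1 r)
  then show ?case by (simp add: J_def)
next
  case (2 k)
  show ?case using I_fil[of q "Suc (Suc k)"] by simp
next
  case (3 r k)
  have "x \<in> fil q (Suc (Suc k)) S" if x: "x \<in> fil (Suc r) (Suc k) (J q)" for x
  proof -
    obtain g h where gh: "g \<in> fil r (Suc k) (J q)" "h \<in> fil (Suc r) k (J q)" "x = g + f r * h"
      using x by (rule fil_SucE)
    have "g \<in> fil q (Suc (Suc k)) S" "h \<in> fil q (Suc k) S"
      using 3 gh by auto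
    moreover have "f r * h \<in> fil q (Suc (Suc k)) S"
      using 3 calculation idl_sub[OF idl_I] by (intro mult_fil) (auto simp: idl_S)
    ultimately show ?thesis
      using gh(3) idl_add[OF idl_fil[OF idl_S]] by simp
  qed
  then show ?case by blast
qed

lemma mult_L_fil:
  assumes L: "idl L" and l: "l \<in> L" and h: "h \<in> fil r k S"
  shows "l * h \<in> fil r k L"
  using L l h
proof (induction r k L arbitrary: h rule: fil.induct)
  case (1 r L)
  then show ?case using idl_mult_right[of L h l] by simp
next
  case (2 k L)
  then show ?case using idl_sub[of L] idl_mult[OF idl_I] by simp
next
  case (3 r k L)
  obtain a b where ab: "a \<in> fil r (Suc k) S" "b \<in> fil (Suc r) k S" "h = a + f r * b"
    using "3.prems"(3) by (auto simp: fil_Suc_Suc)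
  have "l * a \<in> fil r (Suc k) L" "l * b \<in> fil (Suc r) k L"
    using 3 ab by auto
  then show ?case
    by (rule fil_SucI) (simp add: ab(3) distrib_left mult.left_commute)
qed

text \<open>
  The assumption improves membership by one step, because \<open>fil r k (J r)\<close> is \<open>fil r (k + 1)
  S\<close>.
\<close>

lemma f_regular_step:
  assumes main: "\<And>g k. g \<in> fil r k S \<Longrightarrow> f r * g \<in> fil r k (J r) \<Longrightarrow> g \<in> fil r k (J r)"
    and y: "y \<in> S" "f r * y \<in> fil r k S"
  shows "y \<in> fil r k S"
  using y
proof (induction k)
  case (Suc k)
  have "y \<in> fil r k S"
    using Suc fil_antimono[of r k] by auto
  moreover have "f r * y \<in> fil r k (J r)"
    using Suc.prems fil_Suc_sub[of r "J r" k] by auto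
  ultimately have "y \<in> fil r k (J r)" by (rule main)
  then show ?case
    using fil_J_sub[of r r k] by auto
qed auto

text \<open>
  An element regular modulo \<open>L\<close> is regular on the graded pieces of the filtration with
  coefficients modulo \<open>L\<close>. Write \<open>g = g\<^sub>0 + f\<^sub>r h\<close> and \<open>x g =
  c\<^sub>0 + f\<^sub>r c\<^sub>1\<close>. Then \<open>f\<^sub>r (x h - c\<^sub>1)\<close> lies in the
  filtration of level \<open>r\<close>, where \<open>f\<^sub>r\<close> can be cancelled by the case
  \<open>r\<close> for \<open>x = f\<^sub>r\<close>. This gives \<open>h\<close> by induction on
  \<open>k\<close>, and then \<open>g\<^sub>0\<close> by induction on \<open>r\<close>.
\<close>

lemma fil_regular:
  assumes L: "idl L" and JL: "J r \<subseteq> L" and x: "x \<in> S" and reg: "regular_mod L x"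
    and fr: "\<And>i. i < r \<Longrightarrow> regular_mod (J i) (f i)"
    and g: "g \<in> fil r k S" and xg: "x * g \<in> fil r k L"
  shows "g \<in> fil r k L"
  using L JL x reg fr g xg
proof (induction r arbitrary: L x g k)
  case (0 L x g k)
  show ?case
  proof (cases k)
    case [simp]: 0
    show ?thesis using "0.prems"(4,6,7) by (simp add: regular_mod_def)
  qed (use "0.prems"(6) in simp)
next
  case (Suc r L x g k)
  note L = Suc.prems(1) and IH = Suc.IH and x = Suc.prems(3) and reg = Suc.prems(4) and fr = Suc.prems(5)
  have JrL: "J r \<subseteq> L" using Suc.prems(2) J_mono[of r "Suc r"] by auto
  have IL: "I \<subseteq> L" using Suc.prems(2) I_J by auto
  have cancel_last: "y \<in> fil r k S" if y: "y \<in> S" "f r * y \<in> fil r k S" for y k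
    by (rule f_regular_step[OF IH[OF idl_J order_refl f_S] y]) (use fr in auto)
  show ?case
    using Suc.prems(6,7)
  proof (induction k arbitrary: g)
    case 0
    then show ?case using Suc.prems(4) by (auto simp: regular_mod_def)
  next
    case (Suc k g)
    obtain g0 h where g: "g0 \<in> fil r (Suc k) S" "h \<in> fil (Suc r) k S" "g = g0 + f r * h"
      using Suc.prems(1) by (rule fil_SucE)
    obtain c0 c1 where c: "c0 \<in> fil r (Suc k) L" "c1 \<in> fil (Suc r) k L" "x * g = c0 + f r * c1"
      using Suc.prems(2) by (rule fil_SucE)
    have gS: "g0 \<in> S" "h \<in> S" "c0 \<in> S" "c1 \<in> S"
      using g c fil_sub_S[OF idl_S] fil_sub_S[OF L] by blast+
    have e: "f r * (x * h - c1) = c0 - x * g0"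
      using g(3) c(3) by (simp add: algebra_simps)
    have "f r * (x * h - c1) \<in> fil r (Suc k) S"
      unfolding e using fil_le_fil_S[OF L, of r "Suc k"] c(1) g(1) x
      by (intro idl_diff idl_mult idl_fil idl_S) auto
    then have d: "x * h - c1 \<in> fil r (Suc k) S"
      using cancel_last gS x by auto
    also have "fil r (Suc k) S \<subseteq> fil r k L"
      using JrL by (rule fil_Suc_sub)
    also have "\<dots> \<subseteq> fil (Suc r) k L"
      using L IL by (rule fil_Suc_left)
    finally have "x * h - c1 + c1 \<in> fil (Suc r) k L"
      using c(2) by (intro idl_add idl_fil L)
    then have "x * h \<in> fil (Suc r) k L" by simp
    with g(2) have h: "h \<in> fil (Suc r) k L"
      by (rule Suc.IH)
    have "f r * (x * h - c1) \<in> fil r (Suc k) L"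
      using mult_L_fil[OF L _ d, of "f r"] f_J[of r "Suc r"] \<open>J (Suc r) \<subseteq> L\<close> by auto
    then have "c0 - f r * (x * h - c1) \<in> fil r (Suc k) L"
      using c(1) by (intro idl_diff idl_fil L)
    then have "x * g0 \<in> fil r (Suc k) L"
      unfolding e by simp
    from IH[OF L JrL x reg _ g(1) this] fr have "g0 \<in> fil r (Suc k) L"
      by auto
    then show ?case
      using h by (rule fil_SucI) (rule g(3))
  qed
qed


lemma f_regular_fil:
  assumes fr: "\<And>i. i \<le> r \<Longrightarrow> regular_mod (J i) (f i)" and y: "y \<in> S" "f r * y \<in> fil r k S"
  shows "y \<in> fil r k S"
  by (rule f_regular_step[OF fil_regular[OF idl_J order_refl f_S] y]) (use fr in auto)

lemma f_cancel_fil: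
  assumes fr: "\<And>i. i \<le> r \<Longrightarrow> regular_mod (J i) (f i)"
    and L: "idl L" and JL: "J (Suc r) \<subseteq> L"
    and h: "h \<in> S" "f r * h \<in> fil (Suc r) (Suc k) L"
  shows "h \<in> fil (Suc r) k L"
proof -
  obtain c0 c1 where c: "c0 \<in> fil r (Suc k) L" "c1 \<in> fil (Suc r) k L" "f r * h = c0 + f r * c1"
    using h(2) by (rule fil_SucE)
  have c1: "c1 \<in> S" using c(2) fil_sub_S[OF L] by blast
  have "f r * (h - c1) = c0"
    using c(3) by (simp add: algebra_simps)
  also have "c0 \<in> fil r (Suc k) S"
    using c(1) fil_le_fil_S[OF L] by auto
  finally have "f r * (h - c1) \<in> fil r (Suc k) S" .
  from f_regular_fil[OF fr _ this] have "h - c1 \<in> fil r (Suc k) S"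
    using h c1 by auto
  then have "h - c1 \<in> fil r k L"
    using fil_Suc_sub[of r L k] JL J_mono[of r "Suc r"] by auto
  then have "h - c1 \<in> fil (Suc r) k L"
    using fil_Suc_left[OF L, of r k] JL I_J by blast
  then have "h - c1 + c1 \<in> fil (Suc r) k L"
    using c(2) by (intro idl_add idl_fil L)
  then show ?thesis by simp
qed

lemma fil_mult:
  assumes L: "idl L" "I \<subseteq> L" and a: "a \<in> fil r e S" and r: "r \<le> r'" and h: "h \<in> fil r' k L"
  shows "a * h \<in> fil r' (k + e) L"
  using a r
proof (induction e arbitrary: r a)
  case 0
  then show ?case using h by (simp add: idl_mult[OF idl_fil[OF L(1)]])
next
  case (Suc e)
  note IHe = Suc.IH
  show ?case
    using Suc.prems
  proof (induction r arbitrary: a)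
    case 0
    have "I \<subseteq> fil r' k L" for k
    proof (induction r')
      case 0
      then show ?case using L(2) by (cases k) auto
    next
      case (Suc r)
      then show ?case using fil_Suc_left[OF L] by blast
    qed
    moreover have "a * h \<in> I"
      using 0 h fil_sub_S[OF L(1)] by (intro idl_mult_right[OF idl_I]) auto
    ultimately show ?case by blast
  next
    case (Suc r)
    obtain b d where bd: "b \<in> fil r (Suc e) S" "d \<in> fil (Suc r) e S" "a = b + f r * d"
      using Suc.prems(1) by (rule fil_SucE)
    have b: "b * h \<in> fil r' (k + Suc e) L"
      using Suc bd by auto
    have "d * h \<in> fil r' (k + e) L"
      using IHe[OF bd(2)] Suc.prems by auto
    then have "f r * (d * h) \<in> fil r' (k + Suc e) L"
      using mult_fil[OF L, of r r'] Suc.prems by auto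
    with b have "b * h + f r * (d * h) \<in> fil r' (k + Suc e) L"
      by (intro idl_add idl_fil L)
    then show ?case by (simp add: bd(3) algebra_simps)
  qed
qed

text \<open>
  Values at \<open>f\<^sub>0, \<dots>, f\<^bsub>r-1\<^esub>\<close> of forms of degree \<open>e\<close>: the
  lowest power of the last variable occurs with a coefficient that is again such a form in the other
  variables, and the innermost coefficient is a unit. All remaining coefficients are arbitrary, which the
  filtration can express. A form over a field with a nonzero coefficient is of this kind.
\<close>

inductive form_val :: "nat \<Rightarrow> nat \<Rightarrow> 'a \<Rightarrow> bool" where
  const: "u \<in> S \<Longrightarrow> v \<in> S \<Longrightarrow> v * u = 1 \<Longrightarrow> form_val 0 0 u"
| low: "form_val r e z \<Longrightarrow> z' \<in> fil (Suc r) (e - 1) S \<Longrightarrow> (e = 0 \<Longrightarrow> z' = 0)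
    \<Longrightarrow> form_val (Suc r) e (z + f r * z')"
| shift: "form_val (Suc r) e z \<Longrightarrow> form_val (Suc r) (Suc e) (f r * z)"

lemma form_val_fil: "form_val r e z \<Longrightarrow> z \<in> fil r e S"
proof (induction rule: form_val.induct)
  case (low r e z z')
  have "f r * z' \<in> fil (Suc r) e S"
  proof (cases e)
    case 0
    then show ?thesis using low by simp
  next
    case (Suc k)
    then show ?thesis using low idl_sub[OF idl_I] by (auto intro!: mult_fil idl_S)
  qed
  moreover have "z \<in> fil (Suc r) e S"
    using low fil_Suc_left[OF idl_S] idl_sub[OF idl_I] by blast
  ultimately show ?case by (intro idl_add idl_fil idl_S)
qed (use idl_sub[OF idl_I] in \<open>auto intro!: mult_fil idl_S\<close>)

text \<open>
  Quasi-regularity: multiplication by the value of such a form of degree \<open>e\<close> is injective from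
  the graded piece of degree \<open>k\<close> to that of degree \<open>k + e\<close>. In the case of a form
  with a term free of \<open>f\<^sub>r\<close>, comparing the parts without \<open>f\<^sub>r\<close> settles
  the component \<open>g\<^sub>0\<close> of \<open>g = g\<^sub>0 + f\<^sub>r h\<close>, and what remains is
  divisible by \<open>f\<^sub>r\<close>.
\<close>

lemma form_val_cancel:
  assumes "form_val r e z" and "idl L" and "J r \<subseteq> L"
    and "\<And>i. i < r \<Longrightarrow> regular_mod (J i) (f i)"
    and "g \<in> fil r k S" and "z * g \<in> fil r (k + e) L"
  shows "g \<in> fil r k L"
  using assms
proof (induction arbitrary: L g k rule: form_val.induct)
  case (const u v)
  show ?case
  proof (cases k)
    case 0
    have "v * (u * g) \<in> L" by (rule idl_mult[OF const.prems(1)]) (use const 0 in auto)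
    also have "v * (u * g) = g" using const(3) by (metis mult.assoc mult_1)
    finally show ?thesis using 0 by simp
  qed (use const in simp)
next
  case (shift r e z)
  have zS: "z \<in> S" using form_val_fil[OF shift.hyps] fil_sub_S[OF idl_S] by blast
  have gS: "g \<in> S" using shift.prems fil_sub_S[OF idl_S] by blast
  have "f r * (z * g) \<in> fil (Suc r) (Suc (k + e)) L"
    using shift.prems(5) by (simp add: mult.assoc)
  then have "z * g \<in> fil (Suc r) (k + e) L"
    by (rule f_cancel_fil[rotated -1]) (use shift.prems zS gS in auto)
  then show ?case
    by (rule shift.IH[rotated -1]) (use shift.prems in auto)
next
  case (low r e z z')
  note L = low.prems(1) and JL = low.prems(2) and fr = low.prems(3)
  have IL: "I \<subseteq> L" and JrL: "J r \<subseteq> L"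
    using JL I_J J_mono[of r "Suc r"] by auto
  have IS: "I \<subseteq> S" using idl_sub[OF idl_I] by auto
  have zr: "z \<in> fil r e S" using form_val_fil[OF low.hyps(1)] .
  have z'': "z + f r * z' \<in> fil (Suc r) e S"
    using form_val_fil[OF form_val.low[OF low.hyps]] .
  have zS: "z \<in> S" "z' \<in> S" using zr low.hyps fil_sub_S[OF idl_S] by blast+
  have main: "g0 \<in> fil r k L"
    if g0: "g0 \<in> fil r k S" and h: "h \<in> S"
      and zg: "(z + f r * z') * (g0 + f r * h) \<in> fil (Suc r) (Suc m) L" and m: "Suc m = k + e" for g0 h k m
  proof -
    obtain c0 c1 where c: "c0 \<in> fil r (Suc m) L" "c1 \<in> fil (Suc r) m L"
        "(z + f r * z') * (g0 + f r * h) = c0 + f r * c1"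
      using zg by (rule fil_SucE)
    define y where "y = z' * (g0 + f r * h) + z * h - c1"
    have e: "f r * y = c0 - z * g0"
      using c(3) by (simp add: y_def algebra_simps)
    have "g0 \<in> S" "c1 \<in> S" using g0 c(2) fil_sub_S[OF L] fil_sub_S[OF idl_S] by blast+
    then have yS: "y \<in> S" using h zS by (auto simp: y_def)
    have "z * g0 \<in> fil r (Suc m) S"
      unfolding m using g0 zr IS by (intro fil_mult[of S _ r]) (auto simp: idl_S)
    then have "f r * y \<in> fil r (Suc m) S"
      unfolding e using fil_le_fil_S[OF L, of r "Suc m"] c(1)
      by (intro idl_diff idl_fil idl_S) auto
    from f_regular_fil[OF _ yS this] have "y \<in> fil r (Suc m) S"
      using fr by auto
    then have "f r * y \<in> fil r (Suc m) L"
      using f_J[of r "Suc r"] JL by (intro mult_L_fil L) auto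
    then have "c0 - f r * y \<in> fil r (Suc m) L"
      using c(1) by (intro idl_diff idl_fil L)
    then have "z * g0 \<in> fil r (k + e) L" unfolding e m by simp
    from low.IH[OF L JrL _ g0 this] show ?thesis using fr by auto
  qed
  show ?case
    using low.prems(4,5)
  proof (induction k arbitrary: g)
    case (0 g)
    show ?case
    proof (cases e)
      case 0
      then have "z * g \<in> fil r (0 + e) L" using "0.prems" low.hyps(3) by auto
      from low.IH[OF L JrL _ _ this] show ?thesis using fr "0.prems" by auto
    next
      case (Suc m)
      have "g \<in> fil r 0 L"
        by (rule main[of g 0 0 m]) (use "0.prems" Suc in auto)
      then show ?thesis by simp
    qed
  next
    case (Suc k g)
    obtain g0 h where g: "g0 \<in> fil r (Suc k) S" "h \<in> fil (Suc r) k S" "g = g0 + f r * h"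
      using Suc.prems(1) by (rule fil_SucE)
    have hS: "h \<in> S" using g(2) fil_sub_S[OF idl_S] by blast
    have g0: "g0 \<in> fil r (Suc k) L"
      by (rule main[OF g(1) hS, of "k + e"]) (use Suc.prems(2) g(3) in auto)
    then have "g0 \<in> fil (Suc r) (Suc k) L"
      using fil_Suc_left[OF L IL] by blast
    then have "(z + f r * z') * g0 \<in> fil (Suc r) (Suc k + e) L"
      by (rule fil_mult[OF L IL z'' order_refl])
    then have "(z + f r * z') * g - (z + f r * z') * g0 \<in> fil (Suc r) (Suc k + e) L"
      using Suc.prems(2) by (intro idl_diff idl_fil L)
    also have "(z + f r * z') * g - (z + f r * z') * g0 = f r * ((z + f r * z') * h)"
      by (simp add: g(3) algebra_simps)
    finally have "f r * ((z + f r * z') * h) \<in> fil (Suc r) (Suc (k + e)) L" by simp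
    then have "(z + f r * z') * h \<in> fil (Suc r) (k + e) L"
      by (rule f_cancel_fil[rotated -1]) (use fr L JL hS zS in auto)
    then have "h \<in> fil (Suc r) k L"
      by (rule Suc.IH[OF g(2)])
    with g0 show ?case
      by (rule fil_SucI) (rule g(3))
  qed
qed

lemma mon_val_fil: "mon_val f l \<in> fil (length l) (sum_list l) S"
proof (induction l)
  case (Cons i l)
  have IS: "I \<subseteq> S" using idl_sub[OF idl_I] by auto
  have "f (length l) ^ i \<in> fil (Suc (length l)) i S" for i
    by (induction i) (use IS in \<open>auto intro!: mult_fil idl_S\<close>)
  moreover have "mon_val f l \<in> fil (Suc (length l)) (sum_list l) S"
    using Cons fil_Suc_left[OF idl_S IS] by blast
  ultimately show ?case
    using fil_mult[OF idl_S IS, of _ "Suc (length l)" i "Suc (length l)" "mon_val f l" "sum_list l"]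
    by (simp add: add.commute)
qed simp

definition unit_S :: "'a \<Rightarrow> bool" where
  "unit_S u \<longleftrightarrow> u \<in> S \<and> (\<exists>v\<in>S. v * u = 1)"

lemma form_val_sum:
  assumes "finite A" "A \<noteq> {}" "\<And>l. l \<in> A \<Longrightarrow> length l = r \<and> sum_list l = e \<and> unit_S (c l)"
  shows "form_val r e (\<Sum>l\<in>A. c l * mon_val f l)"
  using assms
proof (induction r arbitrary: A e c)
  case 0
  then have "\<And>l. l \<in> A \<Longrightarrow> l = []" by auto
  with 0(2) have A: "A = {[]}" by auto
  then show ?case using 0(3)[of "[]"] by (auto simp: unit_S_def intro: form_val.const)
next
  case (Suc r)
  have hyps: "finite A" "A \<noteq> {}" "\<forall>l\<in>A. length l = Suc r"
    using Suc.prems by auto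
  obtain i A' where "finite A' \<and> A' \<noteq> {} \<and> (\<forall>l\<in>A'. i # l \<in> A) \<and> (\<forall>l\<in>A. i \<le> hd l) \<and>
    (\<Sum>l\<in>A. c l * mon_val f l) =
      f r ^ i * ((\<Sum>l\<in>A'. c (i # l) * mon_val f l) +
        f r * (\<Sum>l\<in>{l \<in> A. i < hd l}. c l * (f r ^ (hd l - i - 1) * mon_val f (tl l))))"
    using sum_mon_val_Suc[of A r c f, OF hyps] by (elim exE) (rule that)
  then have A': "finite A'" "A' \<noteq> {}" "\<And>l. l \<in> A' \<Longrightarrow> i # l \<in> A"
    and A'_sum: "(\<Sum>l\<in>A. c l * mon_val f l) =
      f r ^ i * ((\<Sum>l\<in>A'. c (i # l) * mon_val f l) +
        f r * (\<Sum>l\<in>{l \<in> A. i < hd l}. c l * (f r ^ (hd l - i - 1) * mon_val f (tl l))))"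
    by blast+
  let ?R = "\<Sum>l\<in>{l \<in> A. i < hd l}. c l * (f r ^ (hd l - i - 1) * mon_val f (tl l))"
  have e: "i + sum_list l = e" "length l = r" "unit_S (c (i # l))" if "l \<in> A'" for l
    using Suc.prems(3)[OF A'(3)[OF that]] by auto
  have ie: "i \<le> e" using A'(2) e by force
  have 1: "form_val r (e - i) (\<Sum>l\<in>A'. c (i # l) * mon_val f l)"
  proof (rule Suc.IH)
    show "length l = r \<and> sum_list l = e - i \<and> unit_S (c (i # l))" if "l \<in> A'" for l
      using e[OF that] by auto
  qed (use A' in auto)
  have summand: "c l * (f r ^ (hd l - i - 1) * mon_val f (tl l)) \<in> fil (Suc r) (e - i - 1) S"
    and pos: "i < e" if l: "l \<in> {l \<in> A. i < hd l}" for l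
  proof -
    obtain k m where l': "l = k # m" using Suc.prems(3)[of l] l by (cases l) auto
    have km: "length m = r" "k + sum_list m = e" "unit_S (c l)" "i < k"
      using Suc.prems(3)[of l] l l' by auto
    have "mon_val f ((k - i - 1) # m) \<in> fil (Suc r) (k - i - 1 + sum_list m) S"
      using mon_val_fil[of "(k - i - 1) # m"] km by simp
    moreover have "k - i - 1 + sum_list m = e - i - 1" using km by auto
    ultimately show "c l * (f r ^ (hd l - i - 1) * mon_val f (tl l)) \<in> fil (Suc r) (e - i - 1) S"
      using km l' by (auto simp: unit_S_def intro!: idl_mult[OF idl_fil[OF idl_S]])
    show "i < e" using km by auto
  qed
  have "?R \<in> fil (Suc r) (e - i - 1) S"
    using summand by (intro idl_sum idl_fil idl_S)
  moreover have "?R = 0" if "e - i = 0"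
    using pos that by (intro sum.neutral ballI) fastforce
  ultimately have 2: "form_val (Suc r) (e - i) ((\<Sum>l\<in>A'. c (i # l) * mon_val f l) + f r * ?R)"
    by (intro form_val.low 1)
  have "form_val (Suc r) (e' + i) (f r ^ i * z)" if "form_val (Suc r) e' z" for e' z i
    by (induction i) (use that form_val.shift in \<open>auto simp: mult.assoc\<close>)
  from this[OF 2, of i] show ?case
    using ie by (simp add: A'_sum)
qed

text \<open>
  Let \<open>z\<close> be the part of lowest degree \<open>e\<close> of the combination. If the product with
  \<open>w\<close> were in \<open>I\<close>, then \<open>z w\<close> would lie one step deeper in the
  filtration than expected, so \<open>w\<close> would move from step \<open>k\<close> to step \<open>k +
  1\<close> for every \<open>k\<close>.
\<close>

lemma regular_independent:
  assumes fr: "\<And>i. i < r \<Longrightarrow> regular_mod (J i) (f i)"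
    and A: "finite A" "A \<noteq> {}" "\<And>l. l \<in> A \<Longrightarrow> length l = r \<and> unit_S (c l)"
    and w: "w \<in> S" and sep: "w \<notin> fil r k S"
  shows "(\<Sum>l\<in>A. c l * mon_val f l) * w \<notin> I"
proof
  assume sI: "(\<Sum>l\<in>A. c l * mon_val f l) * w \<in> I"
  have IS: "I \<subseteq> S" using idl_sub[OF idl_I] by auto
  define e where "e = Min (sum_list ` A)"
  have e: "e \<le> sum_list l" if "l \<in> A" for l
    using A(1) that by (auto simp: e_def)
  have "e \<in> sum_list ` A" using A unfolding e_def by (intro Min_in) auto
  then have ne: "{l \<in> A. sum_list l = e} \<noteq> {}" by auto
  define z where "z = (\<Sum>l\<in>{l \<in> A. sum_list l = e}. c l * mon_val f l)"
  define z' where "z' = (\<Sum>l\<in>{l \<in> A. e < sum_list l}. c l * mon_val f l)"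
  have zz: "(\<Sum>l\<in>A. c l * mon_val f l) = z + z'"
    unfolding z_def z'_def using A(1) e
    by (subst sum.union_disjoint[symmetric]) (force intro: sum.cong)+
  have z: "form_val r e z"
    unfolding z_def using A ne by (intro form_val_sum) auto
  have "c l * mon_val f l \<in> fil r (Suc e) S" if l: "l \<in> A" "e < sum_list l" for l
  proof -
    have "fil r j S \<subseteq> fil r i S" if "i \<le> j" for i j
      using that by (induction rule: dec_induct) (use fil_antimono in blast)+
    from this[of "Suc e" "sum_list l"] have "mon_val f l \<in> fil r (Suc e) S"
      using mon_val_fil[of l] A(3) l by auto
    then show ?thesis
      using A(3) l by (auto simp: unit_S_def intro!: idl_mult[OF idl_fil[OF idl_S]])
  qed
  then have z': "z' \<in> fil r (Suc e) S"
    unfolding z'_def by (intro idl_sum idl_fil idl_S) auto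
  have "w \<in> fil r k S" for k
  proof (induction k)
    case (Suc k)
    have "z' * w \<in> fil r (k + Suc e) S"
      using fil_mult[OF idl_S IS z' order_refl Suc] .
    moreover have "(z + z') * w \<in> fil r (k + Suc e) S"
      using sI I_fil unfolding zz by blast
    ultimately have "(z + z') * w - z' * w \<in> fil r (Suc (k + e)) S"
      using idl_diff[OF idl_fil[OF idl_S]] by simp
    then have "z * w \<in> fil r (k + e) (J r)"
      using fil_Suc_sub[OF order_refl, of r "k + e"] by (auto simp: algebra_simps)
    then have "w \<in> fil r k (J r)"
      using form_val_cancel[OF z idl_J order_refl fr Suc] by blast
    then show ?case using fil_J_sub[of r r k] by auto
  qed (use w in simp)
  with sep show False by blast
qed

end

context subring_of_type
begin

lemma idl_foldl_adjoin: "idl I \<Longrightarrow> set fs \<subseteq> S \<Longrightarrow> idl (foldl adjoin I fs)"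
  by (induction fs arbitrary: I) (auto simp: idl_adjoin)

lemma weakly_regular_append: "weakly_regular I (fs @ gs) \<longleftrightarrow> weakly_regular I fs \<and> weakly_regular (foldl adjoin I fs) gs"
  by (induction fs arbitrary: I) auto

lemma weakly_regular_iff: "weakly_regular I fs \<longleftrightarrow> (\<forall>i<length fs. regular_mod (foldl adjoin I (take i fs)) (fs ! i))"
  by (induction fs rule: rev_induct) (auto simp: weakly_regular_append less_Suc_eq nth_append)

text \<open>
  The primes descend with the index. After division by the lowest power of \<open>f r\<close>, which is
  outside the prime \<open>Q (r + 1)\<close>, the terms containing \<open>f r\<close> vanish modulo \<open>Q
  r\<close>, and the others are a combination of the same kind in one element less.
\<close>

lemma prime_chain_independent:
  assumes Q: "\<And>i. i \<le> r \<Longrightarrow> idl (Q i) \<and> 1 \<notin> Q i \<and> (\<forall>x\<in>S. \<forall>y\<in>S. x * y \<in> Q i \<longrightarrow> x \<in> Q i \<or> y \<in> Q i)"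
    and f: "\<And>i. i < r \<Longrightarrow> f i \<in> Q i \<and> f i \<notin> Q (Suc i)" "\<And>i. i < r \<Longrightarrow> Q (Suc i) \<subseteq> Q i"
    and A: "finite A" "A \<noteq> {}" "\<And>l. l \<in> A \<Longrightarrow> length l = r \<and> c l \<in> S \<and> (\<exists>v\<in>S. v * c l = 1)"
  shows "(\<Sum>l\<in>A. c l * mon_val f l) \<notin> Q r"
  using assms
proof (induction r arbitrary: A c)
  case 0
  then have "\<And>l. l \<in> A \<Longrightarrow> l = []" by auto
  with 0 have A: "A = {[]}" by auto
  obtain v where v: "v \<in> S" "v * c [] = 1" using 0(6)[of "[]"] A by auto
  then show ?case using 0(1)[of 0] idl_mult[of "Q 0" v "c []"] A by auto
next
  case (Suc r)
  have fS: "f i \<in> S" if "i \<le> r" for i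
    using Suc.prems(1)[of i] Suc.prems(2)[of i] that idl_sub[of "Q i" "f i"] by auto
  have mvS: "mon_val f l \<in> S" if "length l \<le> Suc r" for l
    using that by (induction l) (auto simp: fS)
  have hyps: "finite A" "A \<noteq> {}" "\<forall>l\<in>A. length l = Suc r"
    using Suc.prems by auto
  obtain i A' where "finite A' \<and> A' \<noteq> {} \<and> (\<forall>l\<in>A'. i # l \<in> A) \<and> (\<forall>l\<in>A. i \<le> hd l) \<and>
    (\<Sum>l\<in>A. c l * mon_val f l) =
      f r ^ i * ((\<Sum>l\<in>A'. c (i # l) * mon_val f l) +
        f r * (\<Sum>l\<in>{l \<in> A. i < hd l}. c l * (f r ^ (hd l - i - 1) * mon_val f (tl l))))"
    using sum_mon_val_Suc[of A r c f, OF hyps] by (elim exE) (rule that)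
  then have A': "finite A'" "A' \<noteq> {}" "\<And>l. l \<in> A' \<Longrightarrow> i # l \<in> A"
    and A'_sum: "(\<Sum>l\<in>A. c l * mon_val f l) =
      f r ^ i * ((\<Sum>l\<in>A'. c (i # l) * mon_val f l) +
        f r * (\<Sum>l\<in>{l \<in> A. i < hd l}. c l * (f r ^ (hd l - i - 1) * mon_val f (tl l))))"
    by blast+
  note fQ = Suc.prems(2)
  define T where "T = (\<Sum>l\<in>A'. c (i # l) * mon_val f l)"
  define R where "R = (\<Sum>l\<in>{l \<in> A. i < hd l}. c l * (f r ^ (hd l - i - 1) * mon_val f (tl l)))"
  have "T \<notin> Q r"
    unfolding T_def
  proof (rule Suc.IH)
    show "length l = r \<and> c (i # l) \<in> S \<and> (\<exists>v\<in>S. v * c (i # l) = 1)" if "l \<in> A'" for l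
      using Suc.prems(6)[OF A'(3)[OF that]] by auto
  qed (use Suc.prems A' in auto)
  have T: "T \<in> S"
    unfolding T_def using Suc.prems(6)[OF A'(3)] by (intro sum_S mult_S mvS) auto
  have R: "R \<in> S"
    unfolding R_def using Suc.prems(6) fS by (intro sum_S mult_S mvS power_S) auto
  have Q: "idl (Q r)" "idl (Q (Suc r))"
    and pr: "x \<in> Q (Suc r) \<or> y \<in> Q (Suc r)" if "x \<in> S" "y \<in> S" "x * y \<in> Q (Suc r)" for x y
    using Suc.prems(1)[of r] Suc.prems(1)[of "Suc r"] that by auto
  have pw: "f r ^ i \<notin> Q (Suc r)" for i
  proof (induction i)
    case 0
    then show ?case using Suc.prems(1)[of "Suc r"] by auto
  next
    case (Suc i)
    then show ?case using pr[of "f r" "f r ^ i"] fS[of r] fQ[of r] by auto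
  qed
  show ?case
  proof
    assume "(\<Sum>l\<in>A. c l * mon_val f l) \<in> Q (Suc r)"
    then have "f r ^ i * (T + f r * R) \<in> Q (Suc r)"
      unfolding A'_sum T_def R_def .
    then have "T + f r * R \<in> Q (Suc r)"
      using pw pr[of "f r ^ i" "T + f r * R"] T R fS[of r] by auto
    then have "T + f r * R \<in> Q r" using Suc.prems(3)[of r] by auto
    moreover have "f r * R \<in> Q r"
      using Suc.prems(2)[of r] R Suc.prems(1)[of r] by (auto intro: idl_mult_right)
    ultimately have "T \<in> Q r" using idl_add_cancel[of "Q r"] Suc.prems(1)[of r] by auto
    with \<open>T \<notin> Q r\<close> show False ..
  qed
qed

end

section \<open>Squarefree monomial ideals\<close>

abbreviation keys where "keys \<equiv> Poly_Mapping.keys"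
abbreviation lookup where "lookup \<equiv> Poly_Mapping.lookup"
abbreviation single where "single \<equiv> Poly_Mapping.single"

lemma zero_in_polys [simp]: "0 \<in> polys_in V"
  and one_in_polys [simp]: "1 \<in> polys_in V"
  by (auto simp: polys_in_def)

lemma subring_polys_in: "subring_of_type (polys_in V :: 'k::field mpol set)"
  by unfold_locales (auto simp: polys_in_mult polys_in_add, auto simp: polys_in_def)

global_interpretation P: subring_of_type "polys_in V :: 'k::field mpol set" for V
  by (rule subring_polys_in)

lemma keys_exponent_add: "keys (s + t) = keys s \<union> keys t" for s t :: "nat \<Rightarrow>\<^sub>0 nat"
  by (auto simp: in_keys_iff lookup_add)

lemma single_in_polys: "single t c \<in> polys_in V" if "keys t \<subseteq> V" for c :: "'k::field"
  using that by (auto simp: polys_in_def)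

lemma expand_monomials: "p = (\<Sum>t\<in>keys p. single t (lookup p t))" for p :: "'k::field mpol"
proof (rule poly_mapping_eqI)
  fix s
  have "lookup (\<Sum>t\<in>keys p. single t (lookup p t)) s = (\<Sum>t\<in>keys p. (lookup p t when t = s))"
    by (simp add: lookup_sum lookup_single)
  also have "\<dots> = lookup p s"
    by (simp add: when_def in_keys_iff)
  finally show "lookup p s = lookup (\<Sum>t\<in>keys p. single t (lookup p t)) s" by simp
qed

lemma single_mult_expand:
  "single u c * p = (\<Sum>t\<in>keys p. single (u + t) (c * lookup p t))" for p :: "'k::field mpol"
  by (subst expand_monomials[of p]) (simp add: sum_distrib_left mult_single)

lemma lookup_single_mult: "lookup (single u c * p) (u + t) = c * lookup p t" for p :: "'k::field mpol"
proof -
  have "lookup (single u c * p) (u + t) = (\<Sum>t'\<in>keys p. (c * lookup p t' when t' = t))"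
    by (simp add: single_mult_expand lookup_sum lookup_single)
  also have "\<dots> = c * lookup p t"
    by (simp add: when_def in_keys_iff)
  finally show ?thesis .
qed

lemma lookup_single_mult_0:
  fixes p :: "'k::field mpol"
  assumes "\<And>t. s \<noteq> u + t"
  shows "lookup (single u c * p) s = 0"
proof -
  have "u + t = s \<longleftrightarrow> False" for t using assms[of t] by auto
  then show ?thesis by (simp add: single_mult_expand lookup_sum lookup_single)
qed

lemma keys_single_mult:
  fixes p :: "'k::field mpol"
  assumes c: "c \<noteq> 0"
  shows "keys (single u c * p) = (+) u ` keys p"
proof (intro Set.set_eqI iffI)
  fix s
  show "s \<in> (+) u ` keys p" if s: "s \<in> keys (single u c * p)"
  proof -
    obtain t where "s = u + t"
      using s lookup_single_mult_0[of s u c p] by (auto simp: in_keys_iff)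
    with s c show ?thesis by (auto simp: in_keys_iff lookup_single_mult)
  qed
  show "s \<in> keys (single u c * p)" if "s \<in> (+) u ` keys p"
    using that c by (auto simp: in_keys_iff lookup_single_mult)
qed

text \<open>
  The exponent vector of the product of the variables in \<open>W\<close>.
\<close>

definition sqfree :: "nat set \<Rightarrow> nat \<Rightarrow>\<^sub>0 nat" where
  "sqfree W = (\<Sum>k\<in>W. single k 1)"

lemma lookup_sqfree: "finite W \<Longrightarrow> lookup (sqfree W) k = (if k \<in> W then 1 else 0)"
  by (simp add: sqfree_def lookup_sum lookup_single when_def)

lemma keys_sqfree [simp]: "finite W \<Longrightarrow> keys (sqfree W) = W"
  by (rule Set.set_eqI) (simp add: in_keys_iff lookup_sqfree)

lemma prod_pvar: "finite W \<Longrightarrow> (\<Prod>k\<in>W. pvar k) = (single (sqfree W) 1 :: 'k::field mpol)"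
  by (induction W rule: finite_induct) (auto simp: sqfree_def pvar_def mult_single)

lemma minus_sqfree: "finite W \<Longrightarrow> W \<subseteq> keys t \<Longrightarrow> sqfree W + (t - sqfree W) = t"
proof (rule poly_mapping_eqI)
  fix k assume W: "finite W" "W \<subseteq> keys t"
  have "lookup (t - sqfree W) k = lookup t k - lookup (sqfree W) k"
    by (simp add: minus_poly_mapping.rep_eq)
  moreover have "k \<in> W \<Longrightarrow> lookup t k \<noteq> 0"
    using W by (auto simp: in_keys_iff)
  ultimately show "lookup (sqfree W + (t - sqfree W)) k = lookup t k"
    using W(1) by (auto simp: lookup_add lookup_sqfree)
qed

text \<open>
  The polynomials without monomials supported on a set in \<open>D\<close>. For down-closed \<open>D\<close>
  this is the Stanley-Reisner ideal of \<open>D\<close>.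
\<close>

definition nonface_ideal :: "nat set \<Rightarrow> nat set set \<Rightarrow> 'k::field mpol set" where
  "nonface_ideal V D = {p \<in> polys_in V. \<forall>t\<in>keys p. keys t \<notin> D}"

definition down_closed :: "nat set set \<Rightarrow> bool" where
  "down_closed D \<longleftrightarrow> (\<forall>T\<in>D. \<forall>T'. T' \<subseteq> T \<longrightarrow> T' \<in> D)"

lemma down_closedD: "down_closed D \<Longrightarrow> T \<in> D \<Longrightarrow> T' \<subseteq> T \<Longrightarrow> T' \<in> D"
  unfolding down_closed_def by blast

lemma down_closed_link:
  assumes "down_closed D"
  shows "down_closed {T. T \<union> W \<in> D}"
  unfolding down_closed_def
proof (intro ballI allI impI CollectI)
  fix T T' assume "T \<in> {T. T \<union> W \<in> D}" "T' \<subseteq> T"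
  then show "T' \<union> W \<in> D" using down_closedD[OF assms, of "T \<union> W" "T' \<union> W"] by auto
qed

lemma down_closed_delete:
  assumes "down_closed D"
  shows "down_closed {T \<in> D. \<not> W \<subseteq> T}"
  unfolding down_closed_def
proof (intro ballI allI impI CollectI conjI)
  fix T T' assume T: "T \<in> {T \<in> D. \<not> W \<subseteq> T}" "T' \<subseteq> T"
  then show "T' \<in> D" using down_closedD[OF assms, of T T'] by auto
  show "\<not> W \<subseteq> T'" using T by auto
qed

lemma idl_nonface_ideal:
  assumes D: "down_closed D"
  shows "P.idl V (nonface_ideal V D :: 'k::field mpol set)"
  unfolding P.idl_def
proof (intro conjI ballI)
  show "x + y \<in> nonface_ideal V D" if "x \<in> nonface_ideal V D" "y \<in> nonface_ideal V D" for x y :: "'k mpol"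
    using that Poly_Mapping.keys_add[of x y] unfolding nonface_ideal_def by (auto simp: polys_in_add)
  show "s * x \<in> nonface_ideal V D" if s: "s \<in> polys_in V" and x: "x \<in> nonface_ideal V D" for s x :: "'k mpol"
  proof -
    have "keys t \<notin> D" if "t \<in> keys (s * x)" for t
    proof -
      obtain u w where uw: "u \<in> keys s" "w \<in> keys x" "t = u + w"
        using \<open>t \<in> keys (s * x)\<close> keys_mult[of s x] by blast
      then have "keys w \<notin> D" "keys w \<subseteq> keys t"
        using x by (auto simp: nonface_ideal_def keys_exponent_add)
      then show ?thesis using D by (auto simp: down_closed_def)
    qed
    then show ?thesis using s x by (auto simp: nonface_ideal_def polys_in_mult)
  qed
qed (auto simp: nonface_ideal_def)

lemma single_in_nonface_ideal: "keys t \<subseteq> V \<Longrightarrow> keys t \<notin> D \<Longrightarrow> single t c \<in> nonface_ideal V D"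
  by (auto simp: nonface_ideal_def polys_in_def)

lemma in_idl_if_monomials:
  fixes p :: "'k::field mpol"
  assumes "P.idl V J" and "\<And>t. t \<in> keys p \<Longrightarrow> single t (lookup p t) \<in> J"
  shows "p \<in> J"
  by (subst expand_monomials) (intro P.idl_sum[OF assms(1)] assms(2))

lemma colon_nonface_ideal:
  assumes W: "finite W" "W \<subseteq> V"
  shows "P.colon V (nonface_ideal V D) (single (sqfree W) 1 :: 'k::field mpol) = nonface_ideal V {T. T \<union> W \<in> D}"
proof -
  have "single (sqfree W) 1 * x \<in> nonface_ideal V D \<longleftrightarrow> (\<forall>t\<in>keys x. keys t \<union> W \<notin> D)" if "x \<in> polys_in V" for x :: "'k mpol"
    using that W by (simp add: nonface_ideal_def keys_single_mult keys_exponent_add single_in_polys polys_in_mult Un_commute)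
  then show ?thesis by (auto simp: P.colon_def nonface_ideal_def)
qed

text \<open>
  For the inclusion from right to left, a monomial supported on a set in \<open>D\<close> must be divisible by
  \<open>x\<^sub>W\<close>.
\<close>

lemma adjoin_nonface_ideal:
  assumes D: "down_closed D" and W: "finite W" "W \<subseteq> V"
  shows "P.adjoin V (nonface_ideal V D) (single (sqfree W) 1 :: 'k::field mpol) = nonface_ideal V {T \<in> D. \<not> W \<subseteq> T}"
proof
  have w: "single (sqfree W) 1 \<in> (polys_in V :: 'k mpol set)"
    using W by (simp add: single_in_polys)
  note D' = down_closed_delete[OF D, of W]
  show "P.adjoin V (nonface_ideal V D) (single (sqfree W) 1 :: 'k mpol) \<subseteq> nonface_ideal V {T \<in> D. \<not> W \<subseteq> T}"
  proof (rule P.adjoin_least[OF idl_nonface_ideal[OF D']])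
    show "single (sqfree W) 1 \<in> (nonface_ideal V {T \<in> D. \<not> W \<subseteq> T} :: 'k mpol set)"
      using W by (intro single_in_nonface_ideal) auto
  qed (auto simp: nonface_ideal_def)
  show "nonface_ideal V {T \<in> D. \<not> W \<subseteq> T} \<subseteq> P.adjoin V (nonface_ideal V D) (single (sqfree W) 1 :: 'k mpol)"
  proof
    fix p :: "'k mpol" assume p: "p \<in> nonface_ideal V {T \<in> D. \<not> W \<subseteq> T}"
    show "p \<in> P.adjoin V (nonface_ideal V D) (single (sqfree W) 1)"
    proof (rule in_idl_if_monomials[OF P.idl_adjoin[OF idl_nonface_ideal[OF D] w]])
      fix t assume t: "t \<in> keys p"
      have tV: "keys t \<subseteq> V" using p t by (auto simp: nonface_ideal_def polys_in_def)
      show "single t (lookup p t) \<in> P.adjoin V (nonface_ideal V D) (single (sqfree W) 1)"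
      proof (cases "keys t \<in> D")
        case False
        then show ?thesis using P.adjoin_superset[OF idl_nonface_ideal[OF D]] single_in_nonface_ideal[OF tV] by blast
      next
        case True
        then have Wt: "W \<subseteq> keys t" using p t by (auto simp: nonface_ideal_def)
        have e: "single t (lookup p t) = single (sqfree W) 1 * single (t - sqfree W) (lookup p t)"
          using minus_sqfree[OF W(1) Wt] by (simp add: mult_single)
        have "keys (t - sqfree W) \<subseteq> V"
          using tV keys_exponent_add[of "sqfree W" "t - sqfree W"] minus_sqfree[OF W(1) Wt] by auto
        then show ?thesis
          using e by (intro P.adjoinI[of 0 _ "single (t - sqfree W) (lookup p t)"])
            (auto simp: single_in_polys P.idl_zero[OF idl_nonface_ideal[OF D]])
      qed
    qed
  qed
qed

section \<open>Coefficients with respect to one variable\<close>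

text \<open>
  The exponent vector with the exponent of \<open>v\<close> set to zero.
\<close>

definition strip :: "nat \<Rightarrow> (nat \<Rightarrow>\<^sub>0 nat) \<Rightarrow> nat \<Rightarrow>\<^sub>0 nat" where
  "strip v t = t - single v (lookup t v)"

lemma lookup_strip: "lookup (strip v t) k = (if k = v then 0 else lookup t k)"
  by (simp add: strip_def minus_poly_mapping.rep_eq lookup_single when_def)

lemma strip_add: "strip v (s + t) = strip v s + strip v t"
  by (rule poly_mapping_eqI) (simp add: lookup_strip lookup_add)

lemma strip_eq: "single v (lookup t v) + strip v t = t"
  by (rule poly_mapping_eqI) (simp add: lookup_strip lookup_add lookup_single when_def)

lemma keys_strip: "keys (strip v t) = keys t - {v}"
  by (auto simp: in_keys_iff lookup_strip split: if_splits)

text \<open>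
  The coefficient of \<open>x\<^sub>v\<^sup>i\<close> when \<open>p\<close> is read as a polynomial in
  \<open>x\<^sub>v\<close>.
\<close>

definition coeff_at :: "nat \<Rightarrow> nat \<Rightarrow> 'k::field mpol \<Rightarrow> 'k mpol" where
  "coeff_at v i p = (\<Sum>t\<in>keys p. if lookup t v = i then single (strip v t) (lookup p t) else 0)"

lemma coeff_at_superset:
  assumes "finite A" "keys p \<subseteq> A"
  shows "coeff_at v i p = (\<Sum>t\<in>A. if lookup t v = i then single (strip v t) (lookup p t) else 0)"
  unfolding coeff_at_def using assms by (intro sum.mono_neutral_left) (auto simp: in_keys_iff)

lemma coeff_at_add: "coeff_at v i (p + q) = coeff_at v i p + coeff_at v i q"
proof -
  let ?A = "keys p \<union> keys q"
  have "coeff_at v i (p + q) = (\<Sum>t\<in>?A. if lookup t v = i then single (strip v t) (lookup (p + q) t) else 0)"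
    using Poly_Mapping.keys_add[of p q] by (intro coeff_at_superset) auto
  also have "\<dots> = (\<Sum>t\<in>?A. if lookup t v = i then single (strip v t) (lookup p t) else 0)
      + (\<Sum>t\<in>?A. if lookup t v = i then single (strip v t) (lookup q t) else 0)"
    by (simp add: sum.distrib[symmetric] lookup_add single_add cong: if_cong) (rule sum.cong; simp)
  also have "\<dots> = coeff_at v i p + coeff_at v i q"
    by (simp add: coeff_at_superset[symmetric])
  finally show ?thesis .
qed

lemma coeff_at_zero [simp]: "coeff_at v i 0 = 0"
  by (simp add: coeff_at_def)

lemma coeff_at_sum: "coeff_at v i (sum f A) = (\<Sum>x\<in>A. coeff_at v i (f x))"
  by (induction A rule: infinite_finite_induct) (auto simp: coeff_at_add)

lemma coeff_at_uminus: "coeff_at v i (- p) = - coeff_at v i p"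
  using coeff_at_add[of v i p "- p"] by (simp add: eq_neg_iff_add_eq_0 add.commute)

lemma coeff_at_diff: "coeff_at v i (p - q) = coeff_at v i p - coeff_at v i q"
  using coeff_at_add[of v i p "- q"] by (simp add: coeff_at_uminus)

lemma coeff_at_single: "coeff_at v i (single t c) = (if lookup t v = i then single (strip v t) c else 0)"
  by (simp add: coeff_at_def)

lemma coeff_at_mult: "coeff_at v m (p * q) = (\<Sum>i\<le>m. coeff_at v i p * coeff_at v (m - i) q)" for p q :: "'k::field mpol"
proof -
  have mono: "coeff_at v m (single s a * single t b) = (\<Sum>i\<le>m. coeff_at v i (single s a) * coeff_at v (m - i) (single t b))"
    for s t and a b :: 'k
  proof (cases "lookup s v + lookup t v = m")
    case True
    have "(\<Sum>i\<le>m. coeff_at v i (single s a) * coeff_at v (m - i) (single t b)) =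
        (\<Sum>i\<in>{lookup s v}. coeff_at v i (single s a) * coeff_at v (m - i) (single t b))"
      using True by (intro sum.mono_neutral_right) (auto simp: coeff_at_single)
    also have "\<dots> = single (strip v s) a * single (strip v t) b"
      using True by (auto simp: coeff_at_single)
    finally show ?thesis
      using True by (simp add: mult_single coeff_at_single lookup_add strip_add)
  next
    case False
    then have "(\<Sum>i\<le>m. coeff_at v i (single s a) * coeff_at v (m - i) (single t b)) = 0"
      by (intro sum.neutral) (auto simp: coeff_at_single)
    then show ?thesis
      using False by (simp add: mult_single coeff_at_single lookup_add)
  qed
  let ?p = "\<lambda>t. single t (lookup p t)" and ?q = "\<lambda>t. single t (lookup q t)"
  have "coeff_at v m (p * q) = (\<Sum>s\<in>keys p. \<Sum>t\<in>keys q. coeff_at v m (?p s * ?q t))"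
    by (subst expand_monomials[of p], subst expand_monomials[of q])
      (simp add: sum_product coeff_at_sum)
  also have "\<dots> = (\<Sum>s\<in>keys p. \<Sum>t\<in>keys q. \<Sum>i\<le>m. coeff_at v i (?p s) * coeff_at v (m - i) (?q t))"
    by (simp only: mono)
  also have "\<dots> = (\<Sum>s\<in>keys p. \<Sum>i\<le>m. \<Sum>t\<in>keys q. coeff_at v i (?p s) * coeff_at v (m - i) (?q t))"
    by (intro sum.cong refl sum.swap)
  also have "\<dots> = (\<Sum>i\<le>m. \<Sum>s\<in>keys p. \<Sum>t\<in>keys q. coeff_at v i (?p s) * coeff_at v (m - i) (?q t))"
    by (rule sum.swap)
  also have "\<dots> = (\<Sum>i\<le>m. coeff_at v i p * coeff_at v (m - i) q)"
  proof (rule sum.cong[OF refl])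
    fix i
    have "coeff_at v i p = (\<Sum>s\<in>keys p. coeff_at v i (?p s))" "coeff_at v (m - i) q = (\<Sum>t\<in>keys q. coeff_at v (m - i) (?q t))"
      using coeff_at_sum[of v i ?p "keys p"] coeff_at_sum[of v "m - i" ?q "keys q"]
      by (simp_all flip: expand_monomials)
    then show "(\<Sum>s\<in>keys p. \<Sum>t\<in>keys q. coeff_at v i (?p s) * coeff_at v (m - i) (?q t)) = coeff_at v i p * coeff_at v (m - i) q"
      by (simp add: sum_product)
  qed
  finally show ?thesis .
qed

lemma coeff_at_free:
  assumes "f \<in> polys_in U" "v \<notin> U"
  shows "coeff_at v i f = (if i = 0 then f else 0)"
proof -
  have 0: "lookup t v = 0" "strip v t = t" if "t \<in> keys f" for t
  proof -
    have "v \<notin> keys t" using assms that by (auto simp: polys_in_def)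
    then show "lookup t v = 0" by (simp add: in_keys_iff)
    then show "strip v t = t" by (simp add: strip_def)
  qed
  have "coeff_at v i f = (\<Sum>t\<in>keys f. if i = 0 then single t (lookup f t) else 0)"
    unfolding coeff_at_def by (rule sum.cong) (auto simp: 0)
  then show ?thesis using expand_monomials[of f] by simp
qed

lemma coeff_at_free_mult:
  assumes "f \<in> polys_in U" "v \<notin> U"
  shows "coeff_at v m (f * q) = f * coeff_at v m q"
proof -
  have "coeff_at v m (f * q) = (\<Sum>i\<in>{0}. coeff_at v i f * coeff_at v (m - i) q)"
    unfolding coeff_at_mult using assms by (intro sum.mono_neutral_right) (auto simp: coeff_at_free)
  then show ?thesis using assms by (simp add: coeff_at_free)
qed

lemma coeff_at_pvar: "coeff_at v i (pvar v) = (if i = 1 then 1 else 0)"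
  by (auto simp: pvar_def coeff_at_single strip_def)

lemma coeff_at_pvar_mult_Suc: "coeff_at v (Suc m) (pvar v * q) = coeff_at v m q"
proof -
  have "coeff_at v (Suc m) (pvar v * q) = (\<Sum>i\<in>{1}. coeff_at v i (pvar v) * coeff_at v (Suc m - i) q)"
    unfolding coeff_at_mult by (intro sum.mono_neutral_right) (auto simp: coeff_at_pvar)
  then show ?thesis by (simp add: coeff_at_pvar)
qed

lemma coeff_at_pvar_mult_0: "coeff_at v 0 (pvar v * q) = 0"
  by (simp add: coeff_at_mult coeff_at_pvar)

lemma coeff_at_pvar_power_mult: "coeff_at v i (pvar v ^ e * q) = (if i < e then 0 else coeff_at v (i - e) q)"
proof (induction e arbitrary: i)
  case (Suc e)
  then show ?case
    by (cases i) (auto simp: mult.assoc coeff_at_pvar_mult_Suc coeff_at_pvar_mult_0)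
qed simp

lemma coeff_at_in_polys: "p \<in> polys_in V \<Longrightarrow> coeff_at v i p \<in> polys_in (V - {v})"
  unfolding coeff_at_def by (intro P.sum_S) (auto simp: polys_in_def keys_strip)

lemma pvar_in_polys: "v \<in> V \<Longrightarrow> pvar v \<in> polys_in V"
  by (auto simp: pvar_def polys_in_def)

lemma coeff_at_bound: "\<exists>N. \<forall>i\<ge>N. coeff_at v i p = 0"
proof (intro exI allI impI)
  fix i assume i: "Suc (Max (insert 0 ((\<lambda>t. lookup t v) ` keys p))) \<le> i"
  have "lookup t v \<noteq> i" if "t \<in> keys p" for t
    using i that by (auto simp: Suc_le_eq)
  then show "coeff_at v i p = 0"
    unfolding coeff_at_def by (intro sum.neutral) auto
qed

lemma pvar_power: "pvar v ^ i = single (single v i) 1"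
proof (induction i)
  case (Suc i)
  have "single v 1 + single v i = (single v (Suc i) :: nat \<Rightarrow>\<^sub>0 nat)"
    by (simp add: single_add[symmetric])
  then show ?case using Suc by (simp add: pvar_def mult_single)
qed simp

lemma coeff_at_expand:
  assumes "\<And>i. N \<le> i \<Longrightarrow> coeff_at v i p = 0"
  shows "p = (\<Sum>i<N. pvar v ^ i * coeff_at v i p)"
proof -
  obtain M where M: "\<And>t. t \<in> keys p \<Longrightarrow> lookup t v < M"
  proof
    show "lookup t v < Suc (Max (insert 0 ((\<lambda>t. lookup t v) ` keys p)))" if "t \<in> keys p" for t
      using that by (auto simp: less_Suc_eq_le)
  qed
  have "pvar v ^ i * coeff_at v i p = (\<Sum>t\<in>keys p. if lookup t v = i then single t (lookup p t) else 0)" for i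
    unfolding coeff_at_def sum_distrib_left
    by (rule sum.cong) (auto simp: pvar_power mult_single strip_eq)
  then have "(\<Sum>i<M. pvar v ^ i * coeff_at v i p) = (\<Sum>i<M. \<Sum>t\<in>keys p. if lookup t v = i then single t (lookup p t) else 0)"
    by simp
  also have "\<dots> = (\<Sum>t\<in>keys p. \<Sum>i<M. if lookup t v = i then single t (lookup p t) else 0)"
    by (rule sum.swap)
  also have "\<dots> = (\<Sum>t\<in>keys p. single t (lookup p t))"
    using M by (intro sum.cong) auto
  also have "\<dots> = p" by (rule expand_monomials[symmetric])
  finally have 1: "p = (\<Sum>i<M. pvar v ^ i * coeff_at v i p)" by simp
  have cfM: "coeff_at v i p = 0" if "M \<le> i" for i
    unfolding coeff_at_def using that M by (intro sum.neutral) force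
  have "(\<Sum>i<M. pvar v ^ i * coeff_at v i p) = (\<Sum>i<max M N. pvar v ^ i * coeff_at v i p)"
    using cfM by (intro sum.mono_neutral_left) auto
  also have "\<dots> = (\<Sum>i<N. pvar v ^ i * coeff_at v i p)"
    using assms by (intro sum.mono_neutral_right) auto
  finally show ?thesis using 1 by simp
qed

section \<open>Triangular sequences are regular\<close>

text \<open>
  For an ideal this says that it is extended from the polynomials without the variable \<open>v\<close>.
\<close>

definition extended :: "nat \<Rightarrow> 'k::field mpol set \<Rightarrow> bool" where
  "extended v J \<longleftrightarrow> (\<forall>p\<in>J. \<forall>i. coeff_at v i p \<in> J)"

definition monic_in :: "nat \<Rightarrow> nat \<Rightarrow> 'k::field mpol \<Rightarrow> bool" where
  "monic_in v d g \<longleftrightarrow> coeff_at v d g = 1 \<and> (\<forall>i>d. coeff_at v i g = 0)"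

lemma in_extended_iff:
  assumes J: "P.idl V J" and v: "v \<in> V" and p: "p \<in> polys_in V" and c: "\<And>i. coeff_at v i p \<in> J"
  shows "p \<in> J"
proof -
  obtain N where N: "\<And>i. N \<le> i \<Longrightarrow> coeff_at v i p = 0" using coeff_at_bound[of v p] by blast
  show ?thesis
    by (subst coeff_at_expand[OF N]) (auto intro!: P.idl_sum[OF J] P.idl_mult[OF J] c pvar_in_polys[OF v])
qed

text \<open>
  Otherwise take the coefficient of \<open>z\<close> of largest index \<open>D\<close> outside
  \<open>J\<close>: the coefficient of index \<open>d + D\<close> of \<open>g z\<close> is congruent to it
  modulo \<open>J\<close>, since \<open>g\<close> is monic.
\<close>

lemma in_extended_if_monic_mult:
  assumes J: "P.idl V J" "extended v J" and v: "v \<in> V"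
    and g: "g \<in> polys_in V" "monic_in v d g" and z: "z \<in> polys_in V"
    and gz: "\<And>m. d \<le> m \<Longrightarrow> coeff_at v m (g * z) \<in> J"
  shows "z \<in> J"
proof (rule ccontr)
  assume "z \<notin> J"
  then have "\<exists>i. coeff_at v i z \<notin> J"
    using in_extended_iff[OF J(1) v z] by blast
  moreover obtain N where N: "\<And>i. N \<le> i \<Longrightarrow> coeff_at v i z = 0" using coeff_at_bound[of v z] by blast
  ultimately obtain D where D: "coeff_at v D z \<notin> J" "\<And>i. D < i \<Longrightarrow> coeff_at v i z \<in> J"
  proof -
    assume ex: "\<exists>i. coeff_at v i z \<notin> J"
    have bd: "\<forall>i. coeff_at v i z \<notin> J \<longrightarrow> i \<le> N"
      using N P.idl_zero[OF J(1)] by (metis nat_le_linear)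
    show ?thesis
      using that[of "GREATEST i. coeff_at v i z \<notin> J"] GreatestI_ex_nat[of "\<lambda>i. coeff_at v i z \<notin> J", OF ex]
        Greatest_le_nat[of "\<lambda>i. coeff_at v i z \<notin> J"] bd by (metis leD)
  qed
  have gP: "coeff_at v i g \<in> polys_in V" for i
    using coeff_at_in_polys[OF g(1), of v i] by (auto simp: polys_in_def)
  have "coeff_at v (d + D) (g * z) = (\<Sum>i\<in>{..d + D} - {d}. coeff_at v i g * coeff_at v (d + D - i) z) + coeff_at v d g * coeff_at v D z"
    unfolding coeff_at_mult by (subst sum.remove[of _ d]) (auto simp: add.commute)
  moreover have "(\<Sum>i\<in>{..d + D} - {d}. coeff_at v i g * coeff_at v (d + D - i) z) \<in> J"
  proof (rule P.idl_sum[OF J(1)])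
    fix i assume i: "i \<in> {..d + D} - {d}"
    show "coeff_at v i g * coeff_at v (d + D - i) z \<in> J"
    proof (cases "d < i")
      case True
      then show ?thesis using g(2) P.idl_zero[OF J(1)] by (simp add: monic_in_def)
    next
      case False
      with i have "D < d + D - i" by auto
      then show ?thesis using D(2) gP by (intro P.idl_mult[OF J(1)])
    qed
  qed
  moreover have "coeff_at v (d + D) (g * z) \<in> J" by (rule gz) simp
  ultimately have "coeff_at v d g * coeff_at v D z \<in> J"
    using P.idl_add_cancel[OF J(1)] by (simp add: add.commute)
  with D(1) g(2) show False by (simp add: monic_in_def)
qed

lemma regular_mod_monic:
  assumes J: "P.idl V J" "extended v J" and v: "v \<in> V" and g: "g \<in> polys_in V" "monic_in v d g"
  shows "P.regular_mod V J g"
  unfolding P.regular_mod_def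
proof (intro ballI impI)
  fix x assume x: "x \<in> polys_in V" "g * x \<in> J"
  show "x \<in> J"
    by (rule in_extended_if_monic_mult[OF J v g x(1)]) (use x(2) J(2) in \<open>simp add: extended_def\<close>)
qed

text \<open>
  Modulo a monic \<open>g\<close>, the quotient is free over the polynomials without \<open>v\<close>.
  Concretely, division by \<open>g\<close> reduces to the case that \<open>x\<close> has degree less than
  \<open>d\<close> in \<open>v\<close>. If then \<open>f x = j + g y\<close>, the left side has degree less
  than \<open>d\<close>, which forces \<open>y \<in> J\<close>.
\<close>

lemma regular_mod_adjoin_monic:
  assumes J: "P.idl V J" "extended v J" and v: "v \<in> V" and g: "g \<in> polys_in V" "monic_in v d g"
    and f: "f \<in> polys_in (V - {v})" and reg: "P.regular_mod V J f"
  shows "P.regular_mod V (P.adjoin V J g) f"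
proof -
  have fV: "f \<in> polys_in V" using f by (auto simp: polys_in_def)
  note A = P.idl_adjoin[OF J(1) g(1)]
  have "x \<in> P.adjoin V J g"
    if "x \<in> polys_in V" "f * x \<in> P.adjoin V J g" "\<And>i. N \<le> i \<Longrightarrow> coeff_at v i x = 0" for x N
    using that
  proof (induction N arbitrary: x)
    case 0
    then have "x = 0" using coeff_at_expand[of 0 v x] by simp
    then show ?case using P.idl_zero[OF A] by simp
  next
    case (Suc N x)
    show ?case
    proof (cases "N < d")
      case True
      obtain j y where jy: "j \<in> J" "y \<in> polys_in V" "f * x = j + g * y"
        using Suc.prems(2) by (rule P.adjoinE)
      have "y \<in> J"
      proof (rule in_extended_if_monic_mult[OF J v g jy(2)])
        fix m assume m: "d \<le> m"
        have "coeff_at v m (g * y) = coeff_at v m (f * x) - coeff_at v m j"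
          using jy(3) by (simp add: coeff_at_add)
        also have "coeff_at v m (f * x) = f * coeff_at v m x"
          using f by (rule coeff_at_free_mult) simp
        also have "coeff_at v m x = 0" using Suc.prems(3) m True by simp
        finally show "coeff_at v m (g * y) \<in> J"
          using jy(1) J(2) P.idl_uminus[OF J(1)] by (simp add: extended_def)
      qed
      then have "f * x \<in> J"
        unfolding jy(3) using jy(1) g(1) by (intro P.idl_add[OF J(1)] P.idl_mult[OF J(1)])
      then have "x \<in> J" using reg Suc.prems(1) by (simp add: P.regular_mod_def)
      then show ?thesis using P.adjoin_superset[OF J(1)] by blast
    next
      case False
      define a where "a = coeff_at v N x"
      define u where "u = pvar v ^ (N - d) * a"
      have aV: "a \<in> polys_in (V - {v})" unfolding a_def by (rule coeff_at_in_polys[OF Suc.prems(1)])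
      then have "a \<in> polys_in V" by (auto simp: polys_in_def)
      then have uV: "u \<in> polys_in V" unfolding u_def using v by (auto simp: pvar_in_polys)
      have gu: "g * u \<in> P.adjoin V J g"
        by (rule P.adjoinI[of 0 J u]) (auto simp: uV P.idl_zero[OF J(1)])
      have cu: "coeff_at v i (g * u) = (if i = N then a else 0)" if "N \<le> i" for i
      proof -
        have gu: "g * u = pvar v ^ (N - d) * (a * g)" by (simp only: u_def mult_ac)
        have "coeff_at v i (g * u) = a * coeff_at v (i - (N - d)) g"
          unfolding gu using that False by (simp add: coeff_at_pvar_power_mult coeff_at_free_mult[OF aV])
        moreover have "i - (N - d) = d" if "i = N" using that False by simp
        moreover have "d < i - (N - d)" if "i \<noteq> N" using that False \<open>N \<le> i\<close> by simp
        ultimately show ?thesis using g(2) by (auto simp: monic_in_def)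
      qed
      have "x - g * u \<in> P.adjoin V J g"
      proof (rule Suc.IH)
        show "x - g * u \<in> polys_in V" using Suc.prems(1) g(1) uV by auto
        show "f * (x - g * u) \<in> P.adjoin V J g"
          using Suc.prems(2) gu fV by (simp add: right_diff_distrib P.idl_diff[OF A] P.idl_mult[OF A])
        show "coeff_at v i (x - g * u) = 0" if "N \<le> i" for i
          using that Suc.prems(3)[of i] by (auto simp: coeff_at_diff cu a_def)
      qed
      then have "x - g * u + g * u \<in> P.adjoin V J g" using gu by (rule P.idl_add[OF A])
      then show ?thesis by simp
    qed
  qed
  then show ?thesis
    unfolding P.regular_mod_def using coeff_at_bound[of v] by meson
qed

lemma extended_adjoin:
  assumes J: "extended v J" and f: "f \<in> polys_in (V - {v})"
  shows "extended v (P.adjoin V J f)"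
  unfolding extended_def
proof (intro ballI allI)
  fix p i assume "p \<in> P.adjoin V J f"
  then obtain j u where ju: "j \<in> J" "u \<in> polys_in V" "p = j + f * u" by (rule P.adjoinE)
  have "coeff_at v i p = coeff_at v i j + f * coeff_at v i u"
    unfolding ju(3) coeff_at_add using coeff_at_free_mult[OF f] by simp
  moreover have "coeff_at v i u \<in> polys_in V"
    using coeff_at_in_polys[OF ju(2), of v i] by (auto simp: polys_in_def)
  ultimately show "coeff_at v i p \<in> P.adjoin V J f"
    using J ju(1) by (auto simp: extended_def intro: P.adjoinI)
qed

lemma weakly_regular_adjoin_monic:
  assumes "P.idl V J" "extended v J" and v: "v \<in> V" and g: "g \<in> polys_in V" "monic_in v d g"
    and "set fs \<subseteq> polys_in (V - {v})" and "P.weakly_regular V J fs"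
  shows "P.weakly_regular V (P.adjoin V J g) fs"
  using assms(1,2,6,7)
proof (induction fs arbitrary: J)
  case (Cons f fs)
  then have f: "f \<in> polys_in (V - {v})" and fV: "f \<in> polys_in V" by (auto simp: polys_in_def)
  have "P.weakly_regular V (P.adjoin V (P.adjoin V J f) g) fs"
    using Cons.prems f fV by (intro Cons.IH P.idl_adjoin extended_adjoin) auto
  moreover have "P.regular_mod V (P.adjoin V J g) f"
    using Cons.prems f by (intro regular_mod_adjoin_monic[OF _ _ v g]) auto
  ultimately show ?case by (simp add: P.adjoin_commute[of V J f g])
qed simp

text \<open>
  Each polynomial is monic in its own variable, and the later polynomials do not contain that variable.
\<close>

fun triangular :: "nat set \<Rightarrow> (nat \<times> 'k::field mpol) list \<Rightarrow> bool" where
  "triangular V [] \<longleftrightarrow> True"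
| "triangular V ((v, f) # r) \<longleftrightarrow> v \<in> V \<and> f \<in> polys_in V \<and> (\<exists>d. monic_in v d f) \<and>
    snd ` set r \<subseteq> polys_in (V - {v}) \<and> triangular V r"

lemma weakly_regular_triangular:
  assumes "triangular V r" and "P.idl V J" and "\<And>v. v \<in> fst ` set r \<Longrightarrow> extended v J"
  shows "P.weakly_regular V J (map snd r)"
  using assms
proof (induction r arbitrary: J)
  case (Cons p r)
  obtain v f where p: "p = (v, f)" by force
  then obtain d where d: "monic_in v d f" using Cons.prems(1) by auto
  have "P.weakly_regular V J (map snd r)" using Cons p by auto
  then have "P.weakly_regular V (P.adjoin V J f) (map snd r)"
    using Cons.prems p d by (intro weakly_regular_adjoin_monic[where v = v and d = d]) auto
  moreover have "P.regular_mod V J f"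
    using Cons.prems p d by (intro regular_mod_monic[where v = v and d = d]) auto
  ultimately show ?case by (simp add: p)
qed simp

section \<open>Complete homogeneous polynomials\<close>

text \<open>
  The complete homogeneous symmetric polynomial of degree \<open>k\<close> in the given variables. These
  polynomials are used because setting variables to zero gives the same polynomial in the remaining variables,
  and because they form a regular sequence over every field, whereas linear forms that are regular modulo all
  the coordinate primes need not exist over a finite field.
\<close>

fun complete_hom :: "nat \<Rightarrow> nat list \<Rightarrow> 'k::field mpol" where
  "complete_hom 0 vs = 1"
| "complete_hom (Suc k) [] = 0"
| "complete_hom (Suc k) (v # vs) = complete_hom (Suc k) vs + pvar v * complete_hom k (v # vs)"

lemma complete_hom_in_polys: "set vs \<subseteq> V \<Longrightarrow> complete_hom k vs \<in> polys_in V"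
  by (induction k vs rule: complete_hom.induct) (auto simp: pvar_in_polys)

lemma monic_complete_hom: "v \<notin> set vs \<Longrightarrow> monic_in v k (complete_hom k (v # vs) :: 'k::field mpol)"
proof (induction k)
  case 0
  have "coeff_at v i (1 :: 'k mpol) = (if i = 0 then 1 else 0)" for i
    using coeff_at_free[of 1 "{}" v i] by simp
  then show ?case by (simp add: monic_in_def)
next
  case (Suc k)
  have c: "coeff_at v i (complete_hom (Suc k) vs :: 'k mpol) = 0" if "0 < i" for i
    using coeff_at_free[OF complete_hom_in_polys[where vs = vs and k = "Suc k", OF order_refl], of v i] Suc.prems that by simp
  show ?case
    unfolding monic_in_def
  proof (intro conjI allI impI)
    show "coeff_at v (Suc k) (complete_hom (Suc k) (v # vs) :: 'k mpol) = 1"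
      using Suc c by (simp add: coeff_at_add coeff_at_pvar_mult_Suc monic_in_def)
    show "coeff_at v i (complete_hom (Suc k) (v # vs) :: 'k mpol) = 0" if "Suc k < i" for i
      using Suc c that by (cases i) (auto simp: coeff_at_add coeff_at_pvar_mult_Suc monic_in_def)
  qed
qed

abbreviation coord :: "nat set \<Rightarrow> nat set set" where
  "coord C \<equiv> {T. T \<inter> C = {}}"

lemma down_closed_coord: "down_closed (coord C)"
  by (auto simp: down_closed_def)

lemma pvar_in_coord: "v \<in> V \<Longrightarrow> v \<in> C \<Longrightarrow> pvar v \<in> nonface_ideal V (coord C)"
  unfolding pvar_def by (rule single_in_nonface_ideal) auto

lemma extended_coord: "v \<notin> C \<Longrightarrow> extended v (nonface_ideal V (coord C) :: 'k::field mpol set)"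
  unfolding extended_def
proof (intro ballI allI)
  fix p :: "'k mpol" and i assume v: "v \<notin> C" and p: "p \<in> nonface_ideal V (coord C)"
  show "coeff_at v i p \<in> nonface_ideal V (coord C)"
    unfolding coeff_at_def
  proof (intro P.idl_sum[OF idl_nonface_ideal[OF down_closed_coord]])
    fix t assume "t \<in> keys p"
    then have "keys t \<subseteq> V" "keys t \<inter> C \<noteq> {}" using p by (auto simp: nonface_ideal_def polys_in_def)
    then have "single (strip v t) (lookup p t) \<in> nonface_ideal V (coord C)"
      using v by (intro single_in_nonface_ideal) (auto simp: keys_strip)
    then show "(if lookup t v = i then single (strip v t) (lookup p t) else 0) \<in> nonface_ideal V (coord C)"
      using P.idl_zero[OF idl_nonface_ideal[OF down_closed_coord]] by auto
  qed
qed

lemma complete_hom_mod_coord: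
  assumes "set vs \<subseteq> V"
  shows "complete_hom k vs - complete_hom k (filter (\<lambda>v. v \<notin> C) vs) \<in> (nonface_ideal V (coord C) :: 'k::field mpol set)"
proof -
  note J = idl_nonface_ideal[OF down_closed_coord, of V C, where 'k = 'k]
  show ?thesis
    using assms
  proof (induction k vs rule: complete_hom.induct)
    case (3 k v vs)
    then have I1: "complete_hom (Suc k) vs - complete_hom (Suc k) (filter (\<lambda>v. v \<notin> C) vs) \<in> (nonface_ideal V (coord C) :: 'k mpol set)"
      and I2: "complete_hom k (v # vs) - complete_hom k (filter (\<lambda>v. v \<notin> C) (v # vs)) \<in> (nonface_ideal V (coord C) :: 'k mpol set)"
      by auto
    have v: "pvar v \<in> (polys_in V :: 'k mpol set)" using 3 by (auto simp: pvar_in_polys)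
    show ?case
    proof (cases "v \<in> C")
      case True
      have "pvar v * complete_hom k (v # vs) \<in> (nonface_ideal V (coord C) :: 'k mpol set)"
        using 3 True by (intro P.idl_mult_right[OF J] complete_hom_in_polys pvar_in_coord) auto
      from P.idl_add[OF J I1 this] show ?thesis using True by (simp add: algebra_simps)
    next
      case False
      from P.idl_add[OF J I1 P.idl_mult[OF J v I2]] show ?thesis
        using False by (simp add: algebra_simps)
    qed
  qed (auto intro: P.idl_zero[OF J])
qed

lemma complete_hom_drop_in:
  fixes Q :: "'k::field mpol set"
  assumes Q: "P.idl V Q" and vs: "set vs \<subseteq> V" and h: "\<And>l. 1 \<le> l \<Longrightarrow> l \<le> k \<Longrightarrow> complete_hom l vs \<in> Q"
  shows "i \<le> length vs \<Longrightarrow> i < l \<Longrightarrow> l \<le> k \<Longrightarrow> complete_hom l (drop i vs) \<in> Q"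
proof (induction i arbitrary: l)
  case (Suc i)
  obtain l' where l: "l = Suc l'" using Suc.prems by (cases l) auto
  have d: "drop i vs = vs ! i # drop (Suc i) vs" using Suc.prems by (simp add: Cons_nth_drop_Suc)
  have v: "pvar (vs ! i) \<in> (polys_in V :: 'k mpol set)"
    using Suc.prems vs by (intro pvar_in_polys) (auto simp: subset_iff)
  have "complete_hom l (drop i vs) - pvar (vs ! i) * complete_hom l' (drop i vs) \<in> Q"
    using Suc.prems l v by (intro P.idl_diff[OF Q] P.idl_mult[OF Q] Suc.IH) auto
  then show ?case by (simp add: l d)
qed (use h in auto)

text \<open>
  By the recursion, \<open>h\<^sub>l(vs)\<close> and \<open>h\<^sub>l(tl vs)\<close> differ by a multiple of
  \<open>h\<^bsub>l-1\<^esub>(vs)\<close>. So modulo the preceding polynomials one variable can be omitted for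
  each of them.
\<close>

lemma complete_hom_drop_cong:
  fixes Q :: "'k::field mpol set"
  assumes Q: "P.idl V Q" and vs: "set vs \<subseteq> V" and h: "\<And>l. 1 \<le> l \<Longrightarrow> l \<le> k \<Longrightarrow> complete_hom l vs \<in> Q"
  shows "i \<le> length vs \<Longrightarrow> i \<le> k \<Longrightarrow> complete_hom (Suc k) vs - complete_hom (Suc k) (drop i vs) \<in> Q"
proof (induction i)
  case 0
  then show ?case using P.idl_zero[OF Q] by simp
next
  case (Suc i)
  have d: "drop i vs = vs ! i # drop (Suc i) vs" using Suc.prems by (simp add: Cons_nth_drop_Suc)
  have v: "pvar (vs ! i) \<in> (polys_in V :: 'k mpol set)"
    using Suc.prems vs by (intro pvar_in_polys) (auto simp: subset_iff)
  have "complete_hom (Suc k) vs - complete_hom (Suc k) (drop i vs) + pvar (vs ! i) * complete_hom k (drop i vs) \<in> Q"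
    using Suc.prems v complete_hom_drop_in[OF Q vs h, of k i k] Suc.IH
    by (intro P.idl_add[OF Q] P.idl_mult[OF Q]) auto
  then show ?case by (simp add: d algebra_simps)
qed

lemma weakly_regular_cong:
  assumes J: "P.idl V J" and len: "length fs = length gs"
    and "set fs \<subseteq> polys_in V" "set gs \<subseteq> polys_in V"
    and "\<And>i. i < length fs \<Longrightarrow> fs ! i - gs ! i \<in> foldl (P.adjoin V) J (take i fs)"
    and "P.weakly_regular V J gs"
  shows "P.weakly_regular V J fs"
  using len assms(1,3-)
proof (induction fs gs arbitrary: J rule: list_induct2)
  case (Cons f fs g gs)
  have fg: "f - g \<in> J" "f \<in> polys_in V" "g \<in> polys_in V"
    using Cons.prems(4)[of 0] Cons.prems by auto
  have e: "P.adjoin V J f = P.adjoin V J g"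
    using Cons.prems fg by (intro P.adjoin_cong)
  have "P.regular_mod V J f"
    using Cons.prems fg by (intro P.regular_mod_cong[of V J f g]) auto
  moreover have "P.weakly_regular V (P.adjoin V J f) fs"
  proof (rule Cons.IH)
    show "fs ! i - gs ! i \<in> foldl (P.adjoin V) (P.adjoin V J f) (take i fs)" if "i < length fs" for i
      using Cons.prems(4)[of "Suc i"] that by simp
  qed (use Cons.prems fg e in \<open>auto intro: P.idl_adjoin\<close>)
  ultimately show ?case by simp
qed simp

lemma foldl_adjoin_mono: "P.idl V J \<Longrightarrow> set fs \<subseteq> polys_in V \<Longrightarrow> J \<subseteq> foldl (P.adjoin V) J fs"
proof (induction fs arbitrary: J)
  case (Cons f fs)
  have "J \<subseteq> P.adjoin V J f" using Cons.prems by (intro P.adjoin_superset)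
  also have "\<dots> \<subseteq> foldl (P.adjoin V) (P.adjoin V J f) fs"
    using Cons.prems by (intro Cons.IH P.idl_adjoin) auto
  finally show ?case by simp
qed simp

lemma foldl_adjoin_mem: "P.idl V J \<Longrightarrow> set fs \<subseteq> polys_in V \<Longrightarrow> f \<in> set fs \<Longrightarrow> f \<in> foldl (P.adjoin V) J fs"
proof (induction fs arbitrary: J)
  case (Cons g fs)
  have J': "P.idl V (P.adjoin V J g)" using Cons.prems by (intro P.idl_adjoin) auto
  show ?case
  proof (cases "f = g")
    case True
    have "f \<in> P.adjoin V J g" unfolding True using Cons.prems by (intro P.adjoin_self)
    then show ?thesis using foldl_adjoin_mono[OF J', of fs] Cons.prems by auto
  next
    case False
    then show ?thesis using Cons.IH[OF J'] Cons.prems by auto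
  qed
qed simp

text \<open>
  Modulo the variables in \<open>C\<close>, the polynomials become complete homogeneous polynomials in the
  other variables \<open>us\<close>. Modulo its predecessors, the polynomial of degree \<open>i + 1\<close>
  can be taken in the variables \<open>us\<close> without the first \<open>i\<close>, where it is monic in the
  first remaining variable. This sequence is triangular.
\<close>

lemma weakly_regular_complete_hom_coord:
  assumes vs: "set vs \<subseteq> V" "distinct vs" and len: "m \<le> length (filter (\<lambda>v. v \<notin> C) vs)"
  shows "P.weakly_regular V (nonface_ideal V (coord C) :: 'k::field mpol set) (map (\<lambda>i. complete_hom (Suc i) vs) [0..<m])"
proof -
  let ?J = "nonface_ideal V (coord C) :: 'k mpol set"
  let ?F = "map (\<lambda>i. complete_hom (Suc i) vs) [0..<m] :: 'k mpol list"
  define us where "us = filter (\<lambda>v. v \<notin> C) vs"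
  have us: "set us \<subseteq> V" "distinct us" "m \<le> length us" "\<And>v. v \<in> set us \<Longrightarrow> v \<notin> C"
    using vs len by (auto simp: us_def)
  note J = idl_nonface_ideal[OF down_closed_coord, of V C, where 'k = 'k]
  have tri: "triangular V (map (\<lambda>i. (us ! i, complete_hom (Suc i) (drop i us) :: 'k mpol)) [k..<m])" if "k \<le> m" for k
    using that
  proof (induction rule: inc_induct)
    case (step k)
    have d: "drop k us = us ! k # drop (Suc k) us" using step us by (simp add: Cons_nth_drop_Suc)
    have nd: "us ! k \<notin> set (drop (Suc k) us)"
      using us(2) d by (metis distinct.simps(2) distinct_drop)
    have "\<exists>d. monic_in (us ! k) d (complete_hom (Suc k) (drop k us) :: 'k mpol)"
      unfolding d using monic_complete_hom[OF nd] by blast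
    moreover have "us ! k \<in> V" using step us by (auto simp: subset_iff)
    moreover have "complete_hom (Suc k) (drop k us) \<in> (polys_in V :: 'k mpol set)"
      using us(1) set_drop_subset[of k us] by (intro complete_hom_in_polys) auto
    moreover have "complete_hom (Suc i) (drop i us) \<in> (polys_in (V - {us ! k}) :: 'k mpol set)" if "i \<in> {Suc k..<m}" for i
    proof (rule complete_hom_in_polys)
      have "set (drop i us) \<subseteq> set (drop (Suc k) us)"
        using that by (intro set_drop_subset_set_drop) auto
      then show "set (drop i us) \<subseteq> V - {us ! k}"
        using nd us(1) set_drop_subset[of i us] by auto
    qed
    ultimately show ?case
      using step by (auto simp: upt_conv_Cons)
  qed simp
  have "P.weakly_regular V ?J (map snd (map (\<lambda>i. (us ! i, complete_hom (Suc i) (drop i us) :: 'k mpol)) [0..<m]))"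
    using us by (intro weakly_regular_triangular tri J extended_coord) auto
  then have "P.weakly_regular V ?J (map (\<lambda>i. complete_hom (Suc i) (drop i us)) [0..<m])"
    by (simp add: comp_def)
  then show ?thesis
  proof (rule weakly_regular_cong[OF J, rotated -1])
    show FV: "set ?F \<subseteq> polys_in V"
      using complete_hom_in_polys[OF vs(1)] by auto
    show "set (map (\<lambda>i. complete_hom (Suc i) (drop i us)) [0..<m]) \<subseteq> (polys_in V :: 'k mpol set)"
      using us(1) set_drop_subset[of _ us] by (auto intro!: complete_hom_in_polys)
    fix i assume "i < length ?F"
    then have i: "i < m" by simp
    define Q where "Q = foldl (P.adjoin V) ?J (take i ?F)"
    have FiV: "set (take i ?F) \<subseteq> polys_in V" using FV set_take_subset by fast
    have Q: "P.idl V Q" unfolding Q_def by (rule P.idl_foldl_adjoin[OF J FiV])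
    have JQ: "?J \<subseteq> Q" unfolding Q_def by (rule foldl_adjoin_mono[OF J FiV])
    have vs_us: "complete_hom k vs - complete_hom k us \<in> Q" for k
      using complete_hom_mod_coord[OF vs(1), of k C] JQ by (auto simp: us_def)
    have "complete_hom l us \<in> Q" if "1 \<le> l" "l \<le> i" for l
    proof -
      have "complete_hom l vs \<in> set (take i ?F)"
        using that i by (auto simp: take_map image_iff intro!: bexI[of _ "l - 1"])
      then have "complete_hom l vs \<in> Q" unfolding Q_def by (rule foldl_adjoin_mem[OF J FiV])
      from P.idl_diff[OF Q this vs_us[of l]] show ?thesis by simp
    qed
    then have "complete_hom (Suc i) us - complete_hom (Suc i) (drop i us) \<in> Q"
      using i us by (intro complete_hom_drop_cong[OF Q us(1), of i]) auto
    from P.idl_add[OF Q vs_us[of "Suc i"] this]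
    show "?F ! i - map (\<lambda>i. complete_hom (Suc i) (drop i us)) [0..<m] ! i \<in> foldl (P.adjoin V) ?J (take i ?F)"
      using i by (simp add: Q_def)
  qed simp
qed

text \<open>
  The polynomials form a regular sequence modulo each of the coordinate primes, and the exact sequences of the
  splitting carry this over to \<open>D\<close>.
\<close>

theorem weakly_regular_coord_split:
  assumes "coord_split (set vs) c D" and "down_closed D" and vs: "distinct vs" "m + c \<le> length vs"
  shows "P.weakly_regular (set vs) (nonface_ideal (set vs) D :: 'k::field mpol set) (map (\<lambda>i. complete_hom (Suc i) vs) [0..<m])"
  using assms(1,2)
proof (induction rule: coord_split.induct)
  case empty
  have "P.weakly_regular (set vs) (polys_in (set vs) :: 'k mpol set) fs" if "set fs \<subseteq> polys_in (set vs)" for fs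
    using that
  proof (induction fs)
    case (Cons f fs)
    have "P.adjoin (set vs) (polys_in (set vs)) f = polys_in (set vs)"
      using Cons.prems P.adjoin_superset[OF P.idl_S] P.idl_sub[OF P.idl_adjoin[OF P.idl_S]] by fastforce
    then show ?case using Cons by (auto simp: P.regular_mod_def)
  qed simp
  moreover have "nonface_ideal (set vs) {} = (polys_in (set vs) :: 'k mpol set)" by (auto simp: nonface_ideal_def)
  moreover have "set (map (\<lambda>i. complete_hom (Suc i) vs) [0..<m]) \<subseteq> (polys_in (set vs) :: 'k mpol set)"
    by (auto intro!: complete_hom_in_polys)
  ultimately show ?case by simp
next
  case (leaf C)
  have "length (filter (\<lambda>v. v \<in> C) vs) = card (C \<inter> set vs)"
    using vs by (simp add: distinct_length_filter)
  also have "\<dots> \<le> card C" using leaf by (intro card_mono) auto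
  finally have "m \<le> length (filter (\<lambda>v. v \<notin> C) vs)"
    using leaf(2) vs(2) sum_length_filter_compl[of "\<lambda>v. v \<in> C" vs] by simp
  then show ?case using vs by (intro weakly_regular_complete_hom_coord) auto
next
  case (split W D)
  note dc = down_closed_link[OF split.prems, of W] down_closed_delete[OF split.prems, of W]
  show ?case
  proof (rule P.weakly_regular_of_colon_and_adjoin[OF idl_nonface_ideal[OF split.prems], where w = "single (sqfree W) 1"])
    show "single (sqfree W) 1 \<in> polys_in (set vs)" using split.hyps by (simp add: single_in_polys)
    show "set (map (\<lambda>i. complete_hom (Suc i) vs) [0..<m]) \<subseteq> polys_in (set vs)" by (auto intro!: complete_hom_in_polys)
  qed (use split dc in \<open>simp_all add: colon_nonface_ideal adjoin_nonface_ideal\<close>)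
qed

section \<open>Counting monomials\<close>

lemma underdetermined_system:
  fixes a :: "'a \<Rightarrow> 'b \<Rightarrow> 'k::field"
  assumes "finite B" "finite A" "card B < card A"
  shows "\<exists>c. (\<exists>x\<in>A. c x \<noteq> 0) \<and> (\<forall>y\<in>B. (\<Sum>x\<in>A. c x * a x y) = 0)"
  using assms
proof (induction B arbitrary: A a rule: finite_induct)
  case empty
  then have "A \<noteq> {}" by auto
  then show ?case by (intro exI[of _ "\<lambda>_. 1"]) auto
next
  case (insert b B)
  show ?case
  proof (cases "\<forall>x\<in>A. a x b = 0")
    case True
    have "card B < card A" using insert by simp
    from insert.IH[OF insert.prems(1) this, of a] True show ?thesis by auto
  next
    case False
    then obtain x0 where x0: "x0 \<in> A" "a x0 b \<noteq> 0" by blast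
    define a' where "a' x y = a x y - a x b / a x0 b * a x0 y" for x y
    have "card B < card (A - {x0})" using insert x0 by simp
    then obtain c where c: "\<exists>x\<in>A - {x0}. c x \<noteq> 0" "\<forall>y\<in>B. (\<Sum>x\<in>A - {x0}. c x * a' x y) = 0"
      using insert.IH[of "A - {x0}" a'] insert.prems by auto
    define s where "s = (\<Sum>x\<in>A - {x0}. c x * a x b)"
    define c' where "c' = c(x0 := - s / a x0 b)"
    have split: "(\<Sum>x\<in>A. c' x * a x y) = - s / a x0 b * a x0 y + (\<Sum>x\<in>A - {x0}. c x * a x y)" for y
    proof -
      have "(\<Sum>x\<in>A - {x0}. c' x * a x y) = (\<Sum>x\<in>A - {x0}. c x * a x y)"
        by (rule sum.cong) (auto simp: c'_def)
      then show ?thesis using insert.prems x0 by (subst sum.remove[of _ x0]) (auto simp: c'_def)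
    qed
    have "(\<Sum>x\<in>A. c' x * a x y) = 0" if "y \<in> B" for y
    proof -
      have "(\<Sum>x\<in>A - {x0}. c x * a' x y) = (\<Sum>x\<in>A - {x0}. c x * a x y) - s / a x0 b * a x0 y"
        unfolding a'_def s_def sum_divide_distrib sum_distrib_right sum_subtractf[symmetric]
        by (rule sum.cong) (simp_all add: algebra_simps)
      then show ?thesis using c(2) that by (simp add: split)
    qed
    moreover have "(\<Sum>x\<in>A. c' x * a x b) = 0"
      unfolding split using x0 by (simp add: s_def)
    moreover have "\<exists>x\<in>A. c' x \<noteq> 0" using c(1) by (auto simp: c'_def)
    ultimately show ?thesis by blast
  qed
qed

lemma lookup_const_mult: "lookup (single 0 c * p) t = c * lookup p t" for p :: "'k::field mpol"
  using lookup_single_mult[of 0 c p t] by simp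

text \<open>
  Every exponent in \<open>p\<close> is at most \<open>E\<close>.
\<close>

definition expo_le :: "nat \<Rightarrow> 'k::field mpol \<Rightarrow> bool" where
  "expo_le E p \<longleftrightarrow> (\<forall>t\<in>keys p. \<forall>i. lookup t i \<le> E)"

lemma expo_le_mult: "expo_le E p \<Longrightarrow> expo_le F q \<Longrightarrow> expo_le (E + F) (p * q)"
  unfolding expo_le_def
proof (intro ballI allI)
  fix t i assume pq: "\<forall>t\<in>keys p. \<forall>i. lookup t i \<le> E" "\<forall>t\<in>keys q. \<forall>i. lookup t i \<le> F" "t \<in> keys (p * q)"
  then obtain u w where "u \<in> keys p" "w \<in> keys q" "t = u + w" using keys_mult[of p q] by blast
  then show "lookup t i \<le> E + F" using pq by (simp add: lookup_add add_mono)
qed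

lemma expo_le_one: "expo_le 0 1"
  by (simp add: expo_le_def)

lemma expo_le_power: "expo_le E p \<Longrightarrow> expo_le (k * E) (p ^ k)"
  by (induction k) (auto simp: expo_le_one dest: expo_le_mult)

lemma expo_le_mono: "expo_le E p \<Longrightarrow> E \<le> F \<Longrightarrow> expo_le F p"
  by (auto simp: expo_le_def intro: order_trans)

lemma ex_expo_le: "\<exists>E. expo_le E p"
proof -
  define E where "E = (\<Sum>t\<in>keys p. \<Sum>i\<in>keys t. lookup t i)"
  have "lookup t i \<le> E" if t: "t \<in> keys p" for t i
  proof (cases "i \<in> keys t")
    case True
    then have "lookup t i \<le> (\<Sum>i\<in>keys t. lookup t i)" by (intro member_le_sum) auto
    also have "\<dots> \<le> E" unfolding E_def using t by (intro member_le_sum) auto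
    finally show ?thesis .
  qed (simp add: in_keys_iff)
  then show ?thesis by (auto simp: expo_le_def)
qed

lemma expo_le_mon_val:
  assumes "\<And>i. i < length l \<Longrightarrow> expo_le E (f i)" and "set l \<subseteq> {..<N}"
  shows "expo_le (length l * (N * E)) (mon_val f l)"
  using assms
proof (induction l)
  case (Cons i l)
  have "expo_le (i * E) (f (length l) ^ i)" using Cons.prems by (intro expo_le_power) auto
  then have "expo_le (N * E) (f (length l) ^ i)"
    using Cons.prems by (elim expo_le_mono) auto
  moreover have "expo_le (length l * (N * E)) (mon_val f l)" using Cons by auto
  ultimately show ?case using expo_le_mult by fastforce
qed (simp add: expo_le_one)

lemma card_exponents:
  assumes "finite U"
  shows "finite {t :: nat \<Rightarrow>\<^sub>0 nat. keys t \<subseteq> U \<and> (\<forall>i. lookup t i \<le> E)}" (is "finite ?T")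
    and "card {t :: nat \<Rightarrow>\<^sub>0 nat. keys t \<subseteq> U \<and> (\<forall>i. lookup t i \<le> E)} \<le> (E + 1) ^ card U"
proof -
  let ?h = "\<lambda>t. restrict (lookup t) U"
  have inj: "inj_on ?h ?T"
  proof (rule inj_onI, rule poly_mapping_eqI)
    fix s t i assume st: "s \<in> ?T" "t \<in> ?T" "?h s = ?h t"
    show "lookup s i = lookup t i"
    proof (cases "i \<in> U")
      case True
      then show ?thesis using fun_cong[OF st(3), of i] by simp
    next
      case False
      then have "i \<notin> keys s" "i \<notin> keys t" using st by auto
      then show ?thesis by (simp add: in_keys_iff)
    qed
  qed
  have sub: "?h ` ?T \<subseteq> (\<Pi>\<^sub>E i\<in>U. {..E})" by auto
  have fin: "finite (\<Pi>\<^sub>E i\<in>U. {..E})" using assms by (intro finite_PiE) auto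
  show "finite ?T" using finite_imageD[OF finite_subset[OF sub fin] inj] .
  have "card ?T = card (?h ` ?T)" using inj by (simp add: card_image)
  also have "\<dots> \<le> card (\<Pi>\<^sub>E i\<in>U. {..E})" by (rule card_mono[OF fin sub])
  also have "\<dots> = (E + 1) ^ card U" using assms by (simp add: card_PiE)
  finally show "card ?T \<le> (E + 1) ^ card U" .
qed

lemma nonface_ideal_coord_mult_in:
  fixes p :: "'k::field mpol"
  assumes J: "P.idl V J" and w: "\<And>v. v \<in> C \<Longrightarrow> pvar v * w \<in> J" and p: "p \<in> nonface_ideal V (coord C)"
  shows "p * w \<in> J"
proof -
  have "single t c * w \<in> J" if t: "t \<in> keys p" for t c
  proof -
    obtain v where v: "v \<in> keys t" "v \<in> C" using p t by (auto simp: nonface_ideal_def)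
    have "single v 1 + (t - single v 1) = t"
      using v(1) minus_sqfree[of "{v}" t] by (simp add: sqfree_def)
    then have "single t c = single (t - single v 1) c * pvar v"
      by (simp add: pvar_def mult_single add.commute)
    moreover have "keys (t - single v 1) \<subseteq> keys t"
      by (auto simp: in_keys_iff minus_poly_mapping.rep_eq)
    then have "single (t - single v 1) c \<in> polys_in V"
      using p t by (intro single_in_polys) (auto simp: nonface_ideal_def polys_in_def)
    ultimately show ?thesis
      using P.idl_mult[OF J _ w[OF v(2)]] by (simp add: mult.assoc)
  qed
  moreover have "p * w = (\<Sum>t\<in>keys p. single t (lookup p t) * w)"
    by (subst expand_monomials[of p]) (simp add: sum_distrib_right)
  ultimately show ?thesis by (simp only: P.idl_sum[OF J])
qed

text \<open>
  Modulo the variables in \<open>C\<close>, the products of the \<open>f i\<close> with all exponents below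
  \<open>N\<close> lie in a space spanned by \<open>O(N\<^sup>d)\<close> monomials, where \<open>d = |V -
  C|\<close>. For \<open>r > d\<close> and large \<open>N\<close> there are more of them, namely
  \<open>N\<^sup>r\<close>, so a nontrivial combination lies in the ideal generated by the variables in
  \<open>C\<close>, and its product with \<open>w\<close> lies in \<open>J\<close>.
\<close>

lemma count_bound:
  fixes f :: "nat \<Rightarrow> 'k::field mpol"
  assumes V: "finite V" and C: "C \<subseteq> V" and f: "\<And>i. i < r \<Longrightarrow> f i \<in> polys_in V"
    and J: "P.idl V J" and w: "\<And>v. v \<in> C \<Longrightarrow> pvar v * w \<in> J"
    and indep: "\<And>A c. finite A \<Longrightarrow> A \<noteq> {} \<Longrightarrow> (\<And>l. l \<in> A \<Longrightarrow> length l = r \<and> c l \<noteq> 0) \<Longrightarrow>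
      (\<Sum>l\<in>A. single 0 (c l) * mon_val f l) * w \<notin> J"
  shows "r \<le> card (V - C)"
proof (rule ccontr)
  define d where "d = card (V - C)"
  assume "\<not> r \<le> card (V - C)"
  then have dr: "d < r" by (simp add: d_def)
  have "\<forall>i. \<exists>E. expo_le E (f i)" using ex_expo_le by blast
  then obtain g where g: "\<And>i. expo_le (g i) (f i)" by metis
  define E where "E = (\<Sum>i<r. g i)"
  have fE: "expo_le E (f i)" if "i < r" for i
    using that unfolding E_def by (intro expo_le_mono[OF g] member_le_sum) auto
  define N where "N = (r * E + 1) ^ d + 1"
  define Box where "Box = {l. set l \<subseteq> {..<N} \<and> length l = r}"
  define T where "T = {t :: nat \<Rightarrow>\<^sub>0 nat. keys t \<subseteq> V - C \<and> (\<forall>i. lookup t i \<le> r * (N * E))}"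
  have T: "finite T" "card T \<le> (r * (N * E) + 1) ^ d"
    unfolding T_def d_def using V card_exponents[of "V - C" "r * (N * E)"] by auto
  have Box: "finite Box" "card Box = N ^ r"
    unfolding Box_def by (simp_all add: finite_lists_length_eq card_lists_length_eq)
  have N1: "1 \<le> N" by (simp add: N_def)
  \<comment> \<open>The choice of \<open>N\<close> makes \<open>(rE + 1)\<^sup>d N\<^sup>d < N\<^bsup>d+1\<^esup>\<close>.\<close>
  have "r * (N * E) + 1 \<le> (r * E + 1) * N" using N1 by (simp add: algebra_simps)
  then have "(r * (N * E) + 1) ^ d \<le> ((r * E + 1) * N) ^ d" by (rule power_mono) simp
  also have "\<dots> = (r * E + 1) ^ d * N ^ d" by (rule power_mult_distrib)
  also have "\<dots> < N * N ^ d" using N1 by (intro mult_strict_right_mono) (auto simp: N_def)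
  also have "\<dots> \<le> N ^ r" using dr N1 power_increasing[of "Suc d" r N] by simp
  finally have "card T < card Box" using T Box by simp
  from underdetermined_system[OF T(1) Box(1) this, of "\<lambda>l. lookup (mon_val f l)"]
  obtain c where c: "\<exists>l\<in>Box. c l \<noteq> 0" "\<forall>t\<in>T. (\<Sum>l\<in>Box. c l * lookup (mon_val f l) t) = 0"
    by blast
  define A where "A = {l \<in> Box. c l \<noteq> 0}"
  define p where "p = (\<Sum>l\<in>A. single 0 (c l) * mon_val f l)"
  have lp: "lookup p t = (\<Sum>l\<in>A. c l * lookup (mon_val f l) t)" for t
    by (simp add: p_def lookup_sum lookup_const_mult)
  have mvV: "mon_val f l \<in> polys_in V" if "length l \<le> r" for l
    using that f by (induction l) auto
  have "p \<in> nonface_ideal V (coord C)"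
  proof -
    have "p \<in> polys_in V"
      unfolding p_def A_def Box_def using mvV
      by (intro P.sum_S P.mult_S) (auto simp: single_in_polys)
    moreover have "keys t \<inter> C \<noteq> {}" if t: "t \<in> keys p" for t
    proof
      assume tC: "keys t \<inter> C = {}"
      obtain l where l: "l \<in> A" "lookup (mon_val f l) t \<noteq> 0"
        using t unfolding in_keys_iff lp by (metis (no_types, lifting) mult_zero_right sum.neutral)
      then have "t \<in> keys (mon_val f l)" by (simp add: in_keys_iff)
      moreover have "expo_le (r * (N * E)) (mon_val f l)"
        using expo_le_mon_val[of l E f N] fE l by (auto simp: A_def Box_def)
      ultimately have "t \<in> T"
        using tC t \<open>p \<in> polys_in V\<close> by (auto simp: T_def expo_le_def polys_in_def)
      then have "(\<Sum>l\<in>Box. c l * lookup (mon_val f l) t) = 0" using c(2) by blast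
      moreover have "(\<Sum>l\<in>Box. c l * lookup (mon_val f l) t) = lookup p t"
        unfolding lp A_def using Box(1) by (intro sum.mono_neutral_right) auto
      ultimately show False using t by (simp add: in_keys_iff)
    qed
    ultimately show ?thesis by (simp add: nonface_ideal_def)
  qed
  then have "p * w \<in> J" using nonface_ideal_coord_mult_in[of V J C w p] J w by blast
  moreover have "p * w \<notin> J"
    unfolding p_def
  proof (rule indep)
    show "finite A" using Box(1) by (simp add: A_def)
    show "A \<noteq> {}" using c(1) by (auto simp: A_def)
  qed (auto simp: A_def Box_def)
  ultimately show False by simp
qed

section \<open>Regular sequences are short\<close>

text \<open>
  \<open>count_bound\<close> is applied to the product \<open>w\<close> of the variables outside
  \<open>C\<close>. The required independence holds since \<open>w\<close> is not in all steps of the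
  filtration: as the \<open>f i\<close> have no constant term, step \<open>k\<close> contains only monomials
  of degree at least \<open>k\<close> modulo the ideal.
\<close>

theorem length_weakly_regular_le:
  fixes fs :: "'k::field mpol list"
  assumes V: "finite V" and D: "down_closed D" and C: "C \<subseteq> V" "V - C \<in> D" "\<And>v. v \<in> C \<Longrightarrow> insert v (V - C) \<notin> D"
    and fs: "set fs \<subseteq> polys_in V" "\<And>f. f \<in> set fs \<Longrightarrow> lookup f 0 = 0"
    and reg: "P.weakly_regular V (nonface_ideal V D) fs"
  shows "length fs \<le> card (V - C)"
proof -
  define f where "f i = (if i < length fs then fs ! i else 0)" for i
  have f: "f i \<in> polys_in V" "lookup (f i) 0 = 0" for i
    using fs by (auto simp: f_def)
  interpret R: regular_chain "polys_in V" "nonface_ideal V D" f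
    by unfold_locales (auto simp: idl_nonface_ideal[OF D] f)
  have RJ: "R.J i = foldl (P.adjoin V) (nonface_ideal V D) (take i fs)" if "i \<le> length fs" for i
    using that
  proof (induction i)
    case (Suc i)
    then have "f i = fs ! i" by (simp add: f_def)
    with Suc show ?case by (simp add: R.J_Suc take_Suc_conv_app_nth)
  qed (simp add: R.J_0)
  have regf: "P.regular_mod V (R.J i) (f i)" if "i < length fs" for i
    using reg that RJ[of i] by (simp add: P.weakly_regular_iff f_def)
  define deg where "deg t = (\<Sum>i\<in>V. lookup t i)" for t :: "nat \<Rightarrow>\<^sub>0 nat"
  \<comment> \<open>This is \<open>I + \<mm>\<^sup>k\<close> for the ideal \<open>\<mm>\<close> generated by the variables.\<close>
  define Y where "Y k = {p \<in> (polys_in V :: 'k mpol set). \<forall>t\<in>keys p. keys t \<in> D \<longrightarrow> k \<le> deg t}" for k :: nat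
  have Y_add: "p + q \<in> Y k" if "p \<in> Y k" "q \<in> Y k" for p q :: "'k mpol" and k
    using that Poly_Mapping.keys_add[of p q] unfolding Y_def by (auto simp: polys_in_add)
  have Y_mult: "f i * h \<in> Y (Suc k)" if h: "h \<in> Y k" for i h k
  proof -
    have "Suc k \<le> deg t" if t: "t \<in> keys (f i * h)" "keys t \<in> D" for t
    proof -
      obtain u w where uw: "u \<in> keys (f i)" "w \<in> keys h" "t = u + w"
        using t keys_mult[of "f i" h] by blast
      have "u \<noteq> 0" using uw(1) f(2)[of i] by (auto simp: in_keys_iff)
      then obtain x where x: "x \<in> keys u" by (metis keys_eq_empty ex_in_conv)
      then have "x \<in> V" using uw(1) f(1)[of i] by (auto simp: polys_in_def)
      moreover have "lookup u x \<noteq> 0" using x by (simp add: in_keys_iff)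
      ultimately have "1 \<le> deg u"
        unfolding deg_def using V member_le_sum[of x V "lookup u"] by fastforce
      moreover have "keys w \<in> D"
        using down_closedD[OF D t(2), of "keys w"] uw(3) by (auto simp: keys_exponent_add)
      then have "k \<le> deg w" using h uw(2) by (auto simp: Y_def)
      moreover have "deg t = deg u + deg w" by (simp add: deg_def uw(3) lookup_add sum.distrib)
      ultimately show ?thesis by simp
    qed
    moreover have "h \<in> polys_in V" using h by (simp add: Y_def)
    ultimately show ?thesis using f(1)[of i] by (simp add: Y_def polys_in_mult)
  qed
  have fil_Y: "R.fil r k L \<subseteq> Y k" if "L = polys_in V" for r k L
    using that
  proof (induction r k L rule: R.fil.induct)
    case (1 r L)
    then show ?case by (auto simp: Y_def)
  next
    case (2 k L)
    have "nonface_ideal V D \<subseteq> Y (Suc k)" by (auto simp: Y_def nonface_ideal_def)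
    then show ?case by simp
  next
    case (3 r k L)
    then show ?case using Y_add Y_mult by (auto simp: R.fil_Suc_Suc subset_iff)
  qed
  define w where "w = (single (sqfree (V - C)) 1 :: 'k mpol)"
  have w: "w \<in> polys_in V" using V by (auto simp: w_def single_in_polys)
  have kw: "keys w = {sqfree (V - C)}" by (simp add: w_def)
  have "w \<notin> Y (Suc (deg (sqfree (V - C))))"
    using C(2) V by (simp add: Y_def kw)
  then have sep: "w \<notin> R.fil (length fs) (Suc (deg (sqfree (V - C)))) (polys_in V)"
    using fil_Y by blast
  show ?thesis
  proof (rule count_bound[OF V C(1), of "length fs" f "nonface_ideal V D" w])
    show "pvar v * w \<in> nonface_ideal V D" if v: "v \<in> C" for v
    proof -
      have "pvar v * w = single (single v 1 + sqfree (V - C)) 1"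
        by (simp add: pvar_def w_def mult_single)
      also have "\<dots> \<in> nonface_ideal V D"
        using v C V by (intro single_in_nonface_ideal) (auto simp: keys_exponent_add)
      finally show ?thesis .
    qed
    fix A :: "nat list set" and c :: "nat list \<Rightarrow> 'k"
    assume A: "finite A" "A \<noteq> {}" "\<And>l. l \<in> A \<Longrightarrow> length l = length fs \<and> c l \<noteq> 0"
    have "R.unit_S (single 0 (c l))" if "l \<in> A" for l
      unfolding R.unit_S_def using A(3)[OF that]
      by (intro conjI bexI[of _ "single 0 (inverse (c l))"]) (auto simp: single_in_polys mult_single)
    then show "(\<Sum>l\<in>A. single 0 (c l) * mon_val f l) * w \<notin> nonface_ideal V D"
      using A by (intro R.regular_independent[OF regf _ _ _ w sep]) auto
  qed (auto simp: f idl_nonface_ideal[OF D])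
qed

section \<open>Chains of prime ideals\<close>

definition prime_idl :: "nat set \<Rightarrow> 'k::field mpol set \<Rightarrow> bool" where
  "prime_idl V Q \<longleftrightarrow> P.idl V Q \<and> 1 \<notin> Q \<and>
    (\<forall>x\<in>polys_in V. \<forall>y\<in>polys_in V. x * y \<in> Q \<longrightarrow> x \<in> Q \<or> y \<in> Q)"

text \<open>
  The variables outside \<open>Q 0\<close> form the set \<open>T\<close>: by primality their product is
  outside \<open>Q 0\<close>, hence not in the nonface ideal.
\<close>

theorem prime_chain_le:
  fixes Q :: "nat \<Rightarrow> 'k::field mpol set"
  assumes V: "finite V" and Q: "\<And>i. i \<le> k \<Longrightarrow> prime_idl V (Q i)" and chain: "\<And>i. i < k \<Longrightarrow> Q i \<subset> Q (Suc i)"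
    and D: "nonface_ideal V D \<subseteq> Q 0"
  shows "\<exists>T\<in>D. T \<subseteq> V \<and> k \<le> card T"
proof -
  define C where "C = {v \<in> V. pvar v \<in> Q 0}"
  have Q0: "prime_idl V (Q 0)" using Q by simp
  have "(\<Prod>v\<in>A. pvar v) \<notin> Q 0" if "finite A" "A \<subseteq> V - C" for A
    using that
  proof (induction A rule: finite_induct)
    case empty
    then show ?case using Q0 by (simp add: prime_idl_def)
  next
    case (insert v A)
    have "(\<Prod>v\<in>A. pvar v) \<in> (polys_in V :: 'k mpol set)"
      using insert by (auto simp: prod_pvar intro!: single_in_polys)
    moreover have "pvar v \<in> polys_in V" "pvar v \<notin> Q 0"
      using insert by (auto simp: C_def pvar_in_polys)
    ultimately show ?case
      using insert Q0 by (auto simp: prime_idl_def)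
  qed
  then have "(single (sqfree (V - C)) 1 :: 'k mpol) \<notin> Q 0"
    using V by (simp flip: prod_pvar)
  then have "(single (sqfree (V - C)) 1 :: 'k mpol) \<notin> nonface_ideal V D" using D by blast
  then have VD: "V - C \<in> D" using V by (auto intro!: single_in_nonface_ideal)
  have "\<exists>x. x \<in> Q (Suc i) \<and> x \<notin> Q i" if "i < k" for i using chain[OF that] by blast
  then obtain g where g: "\<And>i. i < k \<Longrightarrow> g i \<in> Q (Suc i) \<and> g i \<notin> Q i" by metis
  \<comment> \<open>The order is reversed, since \<open>prime_chain_independent\<close> expects descending primes.\<close>
  define f where "f i = g (k - Suc i)" for i
  have fQ: "f i \<in> Q (k - i) \<and> f i \<notin> Q (k - Suc i)" if "i < k" for i
    using g[of "k - Suc i"] that by (simp add: f_def Suc_diff_Suc)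
  have "k \<le> card (V - C)"
  proof (rule count_bound[OF V, of C k f "Q 0" 1])
    show "C \<subseteq> V" by (auto simp: C_def)
    show "f i \<in> polys_in V" if "i < k" for i
      using fQ[OF that] Q[of "k - i"] P.idl_sub unfolding prime_idl_def by force
    show "P.idl V (Q 0)" using Q0 by (simp add: prime_idl_def)
    show "pvar v * 1 \<in> Q 0" if "v \<in> C" for v using that by (simp add: C_def)
    fix A :: "nat list set" and c :: "nat list \<Rightarrow> 'k"
    assume A: "finite A" "A \<noteq> {}" "\<And>l. l \<in> A \<Longrightarrow> length l = k \<and> c l \<noteq> 0"
    have "(\<Sum>l\<in>A. single 0 (c l) * mon_val f l) \<notin> Q (k - k)"
    proof (rule P.prime_chain_independent[where Q = "\<lambda>i. Q (k - i)" and V = V])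
      show "P.idl V (Q (k - i)) \<and> 1 \<notin> Q (k - i) \<and>
        (\<forall>x\<in>polys_in V. \<forall>y\<in>polys_in V. x * y \<in> Q (k - i) \<longrightarrow> x \<in> Q (k - i) \<or> y \<in> Q (k - i))" if "i \<le> k" for i
        using Q[of "k - i"] by (simp add: prime_idl_def)
      show "f i \<in> Q (k - i) \<and> f i \<notin> Q (k - Suc i)" if "i < k" for i using fQ[OF that] .
      show "Q (k - Suc i) \<subseteq> Q (k - i)" if "i < k" for i
        using chain[of "k - Suc i"] that by (auto simp: Suc_diff_Suc)
      show "length l = k \<and> single 0 (c l) \<in> polys_in V \<and> (\<exists>v\<in>polys_in V. v * single 0 (c l) = 1)"
        if "l \<in> A" for l
        using A(3)[OF that]
        by (intro conjI bexI[of _ "single 0 (inverse (c l))"]) (auto simp: single_in_polys mult_single)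
    qed (use A in auto)
    then show "(\<Sum>l\<in>A. single 0 (c l) * mon_val f l) * 1 \<notin> Q 0" by simp
  qed
  with VD show ?thesis by blast
qed

text \<open>
  Drop from each factor the monomials that contain a variable from \<open>C\<close>. The remaining parts have
  a nonzero product, none of whose monomials contains a variable from \<open>C\<close>.
\<close>

lemma prime_idl_coord:
  assumes C: "C \<subseteq> V"
  shows "prime_idl V (nonface_ideal V (coord C) :: 'k::field mpol set)"
proof -
  note J = idl_nonface_ideal[OF down_closed_coord, of V C, where 'k = 'k]
  define low where "low p = (\<Sum>t\<in>{t \<in> keys p. keys t \<inter> C = {}}. single t (lookup p t))" for p :: "'k mpol"
  have low: "p - low p \<in> nonface_ideal V (coord C)" "low p \<in> polys_in V" if p: "p \<in> polys_in V" for p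
  proof -
    have kV: "keys t \<subseteq> V" if "t \<in> keys p" for t using p that by (auto simp: polys_in_def)
    have "p = low p + (\<Sum>t\<in>{t \<in> keys p. keys t \<inter> C \<noteq> {}}. single t (lookup p t))"
      unfolding low_def
      by (subst expand_monomials[of p], subst sum.union_disjoint[symmetric]) (auto intro: sum.cong)
    then have "p - low p = (\<Sum>t\<in>{t \<in> keys p. keys t \<inter> C \<noteq> {}}. single t (lookup p t))"
      by (simp add: algebra_simps)
    also have "\<dots> \<in> nonface_ideal V (coord C)"
      using kV by (intro P.idl_sum[OF J] single_in_nonface_ideal) auto
    finally show "p - low p \<in> nonface_ideal V (coord C)" .
    show "low p \<in> polys_in V" unfolding low_def using kV by (intro P.sum_S single_in_polys) auto
  qed
  have klow: "keys t \<inter> C = {}" if "t \<in> keys (low p)" for t p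
    using that keys_sum[of "\<lambda>t. single t (lookup p t)" "{t \<in> keys p. keys t \<inter> C = {}}"]
    unfolding low_def by (auto split: if_splits)
  have "x \<in> nonface_ideal V (coord C) \<or> y \<in> nonface_ideal V (coord C)"
    if xy: "x \<in> polys_in V" "y \<in> polys_in V" "x * y \<in> nonface_ideal V (coord C)" for x y :: "'k mpol"
  proof (rule ccontr)
    assume n: "\<not> ?thesis"
    then have "low x \<noteq> 0" "low y \<noteq> 0" using low(1)[OF xy(1)] low(1)[OF xy(2)] by auto
    then have nz: "low x * low y \<noteq> 0" by simp
    have "low x * low y = x * y - x * (y - low y) - low y * (x - low x)" by (simp add: algebra_simps)
    also have "\<dots> \<in> nonface_ideal V (coord C)"
      using P.idl_diff[OF J P.idl_diff[OF J xy(3) P.idl_mult[OF J xy(1) low(1)[OF xy(2)]]]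
          P.idl_mult[OF J low(2)[OF xy(2)] low(1)[OF xy(1)]]] .
    finally have m: "low x * low y \<in> nonface_ideal V (coord C)" .
    obtain t where t: "t \<in> keys (low x * low y)" using nz by (metis keys_eq_empty ex_in_conv)
    then obtain u w where "u \<in> keys (low x)" "w \<in> keys (low y)" "t = u + w"
      using keys_mult[of "low x" "low y"] by blast
    then have "keys t \<inter> C = {}" using klow by (auto simp: keys_exponent_add)
    with m t show False by (auto simp: nonface_ideal_def)
  qed
  then show ?thesis using J by (auto simp: prime_idl_def nonface_ideal_def)
qed

text \<open>
  The variables of \<open>T\<close> are added one by one to the prime generated by the variables outside
  \<open>T\<close>.
\<close>

lemma ex_prime_chain:
  assumes V: "finite V" and T: "T \<subseteq> V" "T \<in> D" and D: "down_closed D"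
  shows "\<exists>Q :: nat \<Rightarrow> 'k::field mpol set. (\<forall>i\<le>card T. prime_idl V (Q i)) \<and>
    (\<forall>i<card T. Q i \<subset> Q (Suc i)) \<and> (\<forall>i. nonface_ideal V D \<subseteq> Q i)"
proof -
  have fT: "finite T" using V T finite_subset by blast
  obtain xs where xs: "set xs = T" "distinct xs" using finite_distinct_list[OF fT] by blast
  have len: "length xs = card T" using xs distinct_card by fastforce
  define C where "C i = V - set (drop i xs)" for i
  define Q where "Q i = (nonface_ideal V (coord (C i)) :: 'k mpol set)" for i
  have dT: "set (drop i xs) \<subseteq> T" for i using xs set_drop_subset by fast
  show ?thesis
  proof (intro exI[of _ Q] conjI allI impI)
    show "prime_idl V (Q i)" if "i \<le> card T" for i
      unfolding Q_def by (rule prime_idl_coord) (auto simp: C_def)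
    show "Q i \<subset> Q (Suc i)" if i: "i < card T" for i
    proof -
      have d: "drop i xs = xs ! i # drop (Suc i) xs" using i len by (simp add: Cons_nth_drop_Suc)
      have nd: "xs ! i \<notin> set (drop (Suc i) xs)" using xs(2) d by (metis distinct.simps(2) distinct_drop)
      have xV: "xs ! i \<in> V" using dT[of i] d T by auto
      have "C i \<subseteq> C (Suc i)" using d by (auto simp: C_def)
      then have "Q i \<subseteq> Q (Suc i)" by (auto simp: Q_def nonface_ideal_def)
      moreover have "pvar (xs ! i) \<in> Q (Suc i)"
        unfolding Q_def using nd xV by (intro pvar_in_coord) (auto simp: C_def)
      moreover have "pvar (xs ! i) \<notin> Q i"
        using d by (simp add: Q_def nonface_ideal_def pvar_def C_def)
      ultimately show ?thesis by blast
    qed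
    show "nonface_ideal V D \<subseteq> Q i" for i
    proof
      fix p :: "'k mpol" assume p: "p \<in> nonface_ideal V D"
      have "keys t \<inter> C i \<noteq> {}" if t: "t \<in> keys p" for t
      proof
        assume "keys t \<inter> C i = {}"
        moreover have "keys t \<subseteq> V" using p t by (auto simp: nonface_ideal_def polys_in_def)
        ultimately have "keys t \<subseteq> T" using dT[of i] by (auto simp: C_def)
        then have "keys t \<in> D" using down_closedD[OF D T(2)] by blast
        with p t show False by (simp add: nonface_ideal_def)
      qed
      then show "p \<in> Q i" using p by (simp add: Q_def nonface_ideal_def)
    qed
  qed
qed

section \<open>Quotients of polynomial rings\<close>

lemma mpol_ring_simps [simp]:
  "carrier (mpol_ring V) = (polys_in V :: 'k::field mpol set)"
  "monoid.mult (mpol_ring V) = ((*) :: 'k mpol \<Rightarrow> 'k mpol \<Rightarrow> 'k mpol)" "monoid.one (mpol_ring V) = (1 :: 'k mpol)"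
  "ring.zero (mpol_ring V) = (0 :: 'k mpol)" "ring.add (mpol_ring V) = ((+) :: 'k mpol \<Rightarrow> 'k mpol \<Rightarrow> 'k mpol)"
  by (simp_all add: mpol_ring_def)

global_interpretation PR: cring "mpol_ring V :: 'k::field mpol ring" for V
  by (rule cring_mpol_ring)

lemma a_inv_mpol_ring:
  fixes p :: "'k::field mpol"
  assumes "p \<in> polys_in V"
  shows "\<ominus>\<^bsub>mpol_ring V\<^esub> p = - p"
  by (rule PR.minus_equality) (use assms in auto)

lemma ideal_mpol_ring_iff: "ideal J (mpol_ring V) \<longleftrightarrow> P.idl V (J :: 'k::field mpol set)"
proof
  assume J: "ideal J (mpol_ring V)"
  interpret ideal J "mpol_ring V" by (rule J)
  show "P.idl V J"
    unfolding P.idl_def using a_subset zero_closed a_closed I_l_closed by auto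
next
  assume J: "P.idl V J"
  show "ideal J (mpol_ring V)"
  proof (rule idealI)
    show "subgroup J (add_monoid (mpol_ring V))"
    proof (rule group.subgroupI[OF PR.add.is_group])
      show "inv\<^bsub>add_monoid (mpol_ring V)\<^esub> a \<in> J" if "a \<in> J" for a
      proof -
        have "inv\<^bsub>add_monoid (mpol_ring V)\<^esub> a = - a"
          using a_inv_mpol_ring[OF P.idl_sub[OF J that]] unfolding a_inv_def .
        then show ?thesis using P.idl_uminus[OF J that] by (simp only:)
      qed
    qed (use P.idl_sub[OF J] P.idl_zero[OF J] P.idl_add[OF J] in auto)
  qed (use P.idl_mult[OF J] P.idl_mult_right[OF J] PR.ring_axioms in auto)
qed

lemma coset_eq: "I +>\<^bsub>mpol_ring V\<^esub> p = (\<lambda>i. i + p) ` I"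
  by (auto simp: a_r_coset_def')

lemma Idl_squarefree:
  assumes H: "\<And>F. F \<in> H \<Longrightarrow> finite F \<and> F \<subseteq> V"
  shows "Idl\<^bsub>mpol_ring V\<^esub> ((\<lambda>F. \<Prod>k\<in>F. pvar k) ` H) = (nonface_ideal V (avoiding H) :: 'k::field mpol set)"
proof
  let ?G = "(\<lambda>F. \<Prod>k\<in>F. pvar k) ` H :: 'k mpol set"
  have dc: "down_closed (avoiding H)" unfolding down_closed_def avoiding_def by blast
  have g: "(\<Prod>k\<in>F. pvar k) = (single (sqfree F) 1 :: 'k mpol)" "(\<Prod>k\<in>F. pvar k) \<in> (polys_in V :: 'k mpol set)"
    if "F \<in> H" for F
    using H[OF that] by (auto simp: prod_pvar intro!: single_in_polys)
  show "Idl\<^bsub>mpol_ring V\<^esub> ?G \<subseteq> nonface_ideal V (avoiding H)"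
  proof (rule PR.genideal_minimal)
    show "ideal (nonface_ideal V (avoiding H)) (mpol_ring V)" by (simp add: ideal_mpol_ring_iff idl_nonface_ideal[OF dc])
    show "?G \<subseteq> nonface_ideal V (avoiding H)"
    proof clarify
      fix F assume F: "F \<in> H"
      show "(\<Prod>k\<in>F. pvar k) \<in> (nonface_ideal V (avoiding H) :: 'k mpol set)"
        unfolding g(1)[OF F] using H[OF F] F by (intro single_in_nonface_ideal) (auto simp: avoiding_def)
    qed
  qed
  have G: "?G \<subseteq> carrier (mpol_ring V)" using g(2) by auto
  have J: "P.idl V (Idl\<^bsub>mpol_ring V\<^esub> ?G)"
    using PR.genideal_ideal[OF G] by (simp add: ideal_mpol_ring_iff)
  show "nonface_ideal V (avoiding H) \<subseteq> Idl\<^bsub>mpol_ring V\<^esub> ?G"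
  proof
    fix p :: "'k mpol" assume p: "p \<in> nonface_ideal V (avoiding H)"
    show "p \<in> Idl\<^bsub>mpol_ring V\<^esub> ?G"
    proof (rule in_idl_if_monomials[OF J])
      fix t assume t: "t \<in> keys p"
      obtain F where F: "F \<in> H" "F \<subseteq> keys t" using p t by (auto simp: nonface_ideal_def avoiding_def)
      have e: "sqfree F + (t - sqfree F) = t" using F H[OF F(1)] by (intro minus_sqfree) auto
      have "keys t \<subseteq> V" using p t by (auto simp: nonface_ideal_def polys_in_def)
      then have "keys (t - sqfree F) \<subseteq> V" using keys_exponent_add[of "sqfree F" "t - sqfree F"] e by auto
      then have "single (t - sqfree F) (lookup p t) * (\<Prod>k\<in>F. pvar k) \<in> Idl\<^bsub>mpol_ring V\<^esub> ?G"
        using F(1) PR.genideal_self[OF G] by (intro P.idl_mult[OF J] single_in_polys) auto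
      then show "single t (lookup p t) \<in> Idl\<^bsub>mpol_ring V\<^esub> ?G"
        using e by (simp add: g(1)[OF F(1)] mult_single add.commute)
    qed
  qed
qed

locale poly_quotient =
  fixes V :: "nat set" and I :: "'k::field mpol set"
  assumes idl_I: "P.idl V I"
begin

abbreviation R where "R \<equiv> mpol_ring V :: 'k mpol ring"
abbreviation M where "M \<equiv> quot_module R I"
abbreviation cls where "cls p \<equiv> I +>\<^bsub>R\<^esub> p"

lemma ideal_I: "ideal I R"
  using idl_I by (simp add: ideal_mpol_ring_iff)

sublocale Q: ring "R Quot I"
  by (rule ideal.quotient_is_ring[OF ideal_I])

lemma cls_eq_iff: "p \<in> polys_in V \<Longrightarrow> q \<in> polys_in V \<Longrightarrow> cls p = cls q \<longleftrightarrow> p - q \<in> I"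
proof
  assume pq: "p \<in> polys_in V" "q \<in> polys_in V"
  show "p - q \<in> I" if "cls p = cls q"
  proof -
    have "0 + p \<in> (\<lambda>i. i + q) ` I"
      using that P.idl_zero[OF idl_I] unfolding coset_eq by blast
    then show ?thesis by auto
  qed
  show "cls p = cls q" if d: "p - q \<in> I"
  proof -
    have "(\<lambda>i. i + p) ` I \<subseteq> (\<lambda>i. i + q) ` I" if "p - q \<in> I" for p q
    proof clarify
      fix i assume "i \<in> I"
      then show "i + p \<in> (\<lambda>i. i + q) ` I"
        using P.idl_add[OF idl_I, of i "p - q"] that by (intro image_eqI[of _ _ "i + (p - q)"]) auto
    qed
    from this[OF d] this[of q p] P.idl_uminus[OF idl_I d] show ?thesis
      unfolding coset_eq by auto
  qed
qed

lemma cls_eq_zero_iff: "p \<in> polys_in V \<Longrightarrow> cls p = I \<longleftrightarrow> p \<in> I"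
  using cls_eq_iff[of p 0] by (simp add: coset_eq)

lemma carrier_quot: "carrier (R Quot I) = cls ` polys_in V"
  by (auto simp: FactRing_def A_RCOSETS_def')

lemma carrier_M: "carrier M = cls ` polys_in V"
  by (simp add: quot_module_def carrier_quot)

lemma zero_quot: "\<zero>\<^bsub>R Quot I\<^esub> = I"
  by (simp add: FactRing_def)

lemma mult_cls: "p \<in> polys_in V \<Longrightarrow> q \<in> polys_in V \<Longrightarrow> cls p \<otimes>\<^bsub>R Quot I\<^esub> cls q = cls (p * q)"
  using ring_hom_mult[OF ideal.rcos_ring_hom[OF ideal_I], of p q] by simp

lemma add_cls: "p \<in> polys_in V \<Longrightarrow> q \<in> polys_in V \<Longrightarrow> cls p \<oplus>\<^bsub>R Quot I\<^esub> cls q = cls (p + q)"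
  using ring_hom_add[OF ideal.rcos_ring_hom[OF ideal_I], of p q] by simp

lemma smult_cls: "p \<in> polys_in V \<Longrightarrow> q \<in> polys_in V \<Longrightarrow> p \<odot>\<^bsub>M\<^esub> cls q = cls (p * q)"
  by (simp add: quot_module_def mult_cls)

lemma finsum_M: "finsum M = finsum (R Quot I)"
  by (intro ext) (simp add: finsum_def finprod_def quot_module_def)

lemma finsum_cls:
  assumes "finite A" "\<And>i. i \<in> A \<Longrightarrow> p i \<in> polys_in V" "\<And>i. i \<in> A \<Longrightarrow> v i = cls (p i)"
  shows "finsum M v A = cls (\<Sum>i\<in>A. p i)"
  using assms
proof (induction A rule: finite_induct)
  case empty
  have "finsum M v {} = I" by (simp add: finsum_M zero_quot)
  then show ?case by (simp add: coset_eq)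
next
  case (insert x A)
  have "finsum M v (insert x A) = v x \<oplus>\<^bsub>R Quot I\<^esub> finsum M v A"
    unfolding finsum_M using insert by (intro Q.finsum_insert) (auto simp: carrier_quot)
  also have "\<dots> = cls (p x) \<oplus>\<^bsub>R Quot I\<^esub> cls (\<Sum>i\<in>A. p i)" using insert by simp
  also have "\<dots> = cls (p x + (\<Sum>i\<in>A. p i))" using insert by (intro add_cls P.sum_S) auto
  finally show ?case using insert by simp
qed

text \<open>
  The coefficients \<open>u\<close> are required to lie in \<open>K[V]\<close> at all indices, so that a new
  one can be appended without further conditions.
\<close>

lemma foldl_adjoin_iff:
  "set fs \<subseteq> polys_in V \<Longrightarrow> p \<in> foldl (P.adjoin V) I fs \<longleftrightarrow>
    (\<exists>j\<in>I. \<exists>u. (\<forall>i. u i \<in> polys_in V) \<and> p = j + (\<Sum>i<length fs. fs ! i * u i))"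
proof (induction fs arbitrary: p rule: rev_induct)
  case Nil
  show ?case by (auto intro: exI[of _ "\<lambda>_. 0"])
next
  case (snoc f fs)
  let ?fs = "fs @ [f]"
  have sum: "(\<Sum>i<length ?fs. ?fs ! i * u i) = (\<Sum>i<length fs. fs ! i * u i) + f * u (length fs)" for u
    by (simp add: nth_append)
  show ?case
  proof
    assume "p \<in> foldl (P.adjoin V) I ?fs"
    then obtain q c where q: "q \<in> foldl (P.adjoin V) I fs" "c \<in> polys_in V" "p = q + f * c"
      by (auto elim: P.adjoinE)
    then obtain j u where u: "j \<in> I" "\<forall>i. u i \<in> polys_in V" "q = j + (\<Sum>i<length fs. fs ! i * u i)"
      using snoc by auto
    have "(\<Sum>i<length fs. fs ! i * (u(length fs := c)) i) = (\<Sum>i<length fs. fs ! i * u i)"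
      by (rule sum.cong) auto
    then show "\<exists>j\<in>I. \<exists>u. (\<forall>i. u i \<in> polys_in V) \<and> p = j + (\<Sum>i<length ?fs. ?fs ! i * u i)"
      unfolding sum using q u
      by (intro bexI[OF _ u(1)] exI[of _ "u(length fs := c)"]) (auto simp: add.assoc)
  next
    assume "\<exists>j\<in>I. \<exists>u. (\<forall>i. u i \<in> polys_in V) \<and> p = j + (\<Sum>i<length ?fs. ?fs ! i * u i)"
    then obtain j u where u: "j \<in> I" "\<forall>i. u i \<in> polys_in V"
      "p = j + (\<Sum>i<length fs. fs ! i * u i) + f * u (length fs)"
      unfolding sum by (auto simp: add.assoc)
    then have "j + (\<Sum>i<length fs. fs ! i * u i) \<in> foldl (P.adjoin V) I fs"
      using snoc by auto
    then show "p \<in> foldl (P.adjoin V) I ?fs" using u by (auto intro: P.adjoinI)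
  qed
qed

lemma seq_submodule_eq:
  assumes fs: "set fs \<subseteq> polys_in V"
  shows "seq_submodule M fs = cls ` foldl (P.adjoin V) I fs"
proof -
  have fsV: "fs ! i \<in> polys_in V" if "i < length fs" for i using fs that by auto
  show ?thesis
  proof (intro Set.set_eqI iffI)
    fix x assume "x \<in> seq_submodule M fs"
    then obtain v where v: "v \<in> {..<length fs} \<rightarrow> carrier M" "x = finsum M (\<lambda>i. (fs ! i) \<odot>\<^bsub>M\<^esub> v i) {..<length fs}"
      by (auto simp: seq_submodule_def)
    have "\<forall>i\<in>{..<length fs}. \<exists>u\<in>polys_in V. v i = cls u" using v(1) by (auto simp: carrier_M)
    then obtain u where u: "\<And>i. i < length fs \<Longrightarrow> u i \<in> polys_in V \<and> v i = cls (u i)"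
      by (metis lessThan_iff)
    have x: "x = cls (\<Sum>i<length fs. fs ! i * u i)"
      unfolding v(2) using u fsV by (intro finsum_cls) (auto simp: smult_cls)
    have "(\<Sum>i<length fs. fs ! i * u i) = (\<Sum>i<length fs. fs ! i * (if i < length fs then u i else 0))"
      by (rule sum.cong) auto
    then have "(\<Sum>i<length fs. fs ! i * u i) \<in> foldl (P.adjoin V) I fs"
      unfolding foldl_adjoin_iff[OF fs] using u P.idl_zero[OF idl_I]
      by (intro bexI[of _ 0] exI[of _ "\<lambda>i. if i < length fs then u i else 0"]) auto
    then show "x \<in> cls ` foldl (P.adjoin V) I fs" using x by blast
  next
    fix x assume "x \<in> cls ` foldl (P.adjoin V) I fs"
    then obtain p where p: "p \<in> foldl (P.adjoin V) I fs" "x = cls p" by blast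
    then obtain j u where ju: "j \<in> I" "\<forall>i. u i \<in> polys_in V" "p = j + (\<Sum>i<length fs. fs ! i * u i)"
      unfolding foldl_adjoin_iff[OF fs] by blast
    then have u: "j \<in> I" "\<And>i. u i \<in> polys_in V" "x = cls (j + (\<Sum>i<length fs. fs ! i * u i))"
      using p by simp_all
    have "(\<Sum>i<length fs. fs ! i * u i) \<in> polys_in V" using u fsV by (intro P.sum_S) auto
    then have "x = cls (\<Sum>i<length fs. fs ! i * u i)"
      using u P.idl_sub[OF idl_I] by (simp add: cls_eq_iff)
    also have "\<dots> = finsum M (\<lambda>i. (fs ! i) \<odot>\<^bsub>M\<^esub> cls (u i)) {..<length fs}"
      using u fsV by (intro finsum_cls[symmetric]) (auto simp: smult_cls)
    finally show "x \<in> seq_submodule M fs"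
      unfolding seq_submodule_def using u
      by (intro CollectI exI[of _ "\<lambda>i. cls (u i)"] conjI) (auto simp: carrier_M)
  qed
qed

lemma cls_in_image_iff:
  assumes J: "P.idl V J" "I \<subseteq> J" and p: "p \<in> polys_in V"
  shows "cls p \<in> cls ` J \<longleftrightarrow> p \<in> J"
proof
  assume "cls p \<in> cls ` J"
  then obtain q where "q \<in> J" "cls p = cls q" by auto
  then have "p - q \<in> J" using p P.idl_sub[OF J(1)] J(2) by (auto simp: cls_eq_iff)
  from P.idl_add[OF J(1) this \<open>q \<in> J\<close>] show "p \<in> J" by simp
qed auto

text \<open>
  All ideals in question contain \<open>I\<close>, so membership can be tested in \<open>K[V]\<close> instead
  of its quotient.
\<close>

lemma regular_sequence_iff:
  assumes fs: "set fs \<subseteq> polys_in V"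
  shows "regular_sequence M fs \<longleftrightarrow> P.weakly_regular V I fs \<and> 1 \<notin> foldl (P.adjoin V) I fs"
proof -
  have J: "P.idl V (foldl (P.adjoin V) I gs)" "I \<subseteq> foldl (P.adjoin V) I gs" if "set gs \<subseteq> polys_in V" for gs
    using P.idl_foldl_adjoin[OF idl_I that] foldl_adjoin_mono[OF idl_I that] by auto
  have tk: "set (take k fs) \<subseteq> polys_in V" for k using fs set_take_subset by fast
  have mem: "cls x \<in> seq_submodule M (take k fs) \<longleftrightarrow> x \<in> foldl (P.adjoin V) I (take k fs)"
    if "x \<in> polys_in V" for k x
    using cls_in_image_iff[OF J[OF tk] that] by (simp add: seq_submodule_eq[OF tk])
  have "(\<forall>x\<in>carrier M. (fs ! k) \<odot>\<^bsub>M\<^esub> x \<in> seq_submodule M (take k fs) \<longrightarrow> x \<in> seq_submodule M (take k fs))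
      \<longleftrightarrow> P.regular_mod V (foldl (P.adjoin V) I (take k fs)) (fs ! k)" if "k < length fs" for k
  proof -
    have "fs ! k \<in> polys_in V" using fs that by auto
    then show ?thesis by (simp add: carrier_M P.regular_mod_def smult_cls mem)
  qed
  moreover have "seq_submodule M fs \<noteq> carrier M \<longleftrightarrow> 1 \<notin> foldl (P.adjoin V) I fs"
  proof -
    have "1 \<in> foldl (P.adjoin V) I fs \<longleftrightarrow> polys_in V \<subseteq> foldl (P.adjoin V) I fs"
      using P.idl_mult_right[OF J(1)[OF fs], of _ 1] by auto
    moreover have "seq_submodule M fs = carrier M \<longleftrightarrow> polys_in V \<subseteq> foldl (P.adjoin V) I fs"
    proof
      assume e: "seq_submodule M fs = carrier M"
      show "polys_in V \<subseteq> foldl (P.adjoin V) I fs"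
      proof
        fix p :: "'k mpol" assume p: "p \<in> polys_in V"
        then have "cls p \<in> cls ` foldl (P.adjoin V) I fs"
          using e by (simp add: seq_submodule_eq[OF fs] carrier_M)
        then show "p \<in> foldl (P.adjoin V) I fs" using cls_in_image_iff[OF J[OF fs] p] by simp
      qed
    next
      assume "polys_in V \<subseteq> foldl (P.adjoin V) I fs"
      then have "foldl (P.adjoin V) I fs = polys_in V" using P.idl_sub[OF J(1)[OF fs]] by blast
      then show "seq_submodule M fs = carrier M" by (simp add: seq_submodule_eq[OF fs] carrier_M)
    qed
    ultimately show ?thesis by blast
  qed
  ultimately show ?thesis by (simp add: regular_sequence_def P.weakly_regular_iff)
qed

lemma prime_idl_preimage:
  assumes Pr: "primeideal Z (R Quot I)"
  shows "prime_idl V {p \<in> polys_in V. cls p \<in> Z}" and "I \<subseteq> {p \<in> polys_in V. cls p \<in> Z}"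
proof -
  interpret Z: primeideal Z "R Quot I" by (rule Pr)
  have "ideal {p \<in> carrier R. cls p \<in> Z} R"
    by (rule ring_hom_ring.ideal_vimage[OF ideal.rcos_ring_hom_ring[OF ideal_I]]) (rule Z.is_ideal)
  then have id: "P.idl V {p \<in> polys_in V. cls p \<in> Z}" by (simp add: ideal_mpol_ring_iff)
  show "I \<subseteq> {p \<in> polys_in V. cls p \<in> Z}"
  proof
    fix p assume p: "p \<in> I"
    then have pV: "p \<in> polys_in V" using P.idl_sub[OF idl_I] by blast
    have "cls p = I" using p pV by (simp add: cls_eq_zero_iff)
    then show "p \<in> {p \<in> polys_in V. cls p \<in> Z}"
      using pV Z.zero_closed by (simp add: zero_quot)
  qed
  have "cls 1 \<notin> Z"
  proof
    assume "cls 1 \<in> Z"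
    moreover have "cls 1 = \<one>\<^bsub>R Quot I\<^esub>" by (simp add: FactRing_def)
    ultimately have "Z = carrier (R Quot I)" using Z.one_imp_carrier by simp
    then show False using Z.I_notcarr by simp
  qed
  moreover have "cls x \<in> Z \<or> cls y \<in> Z" if "x \<in> polys_in V" "y \<in> polys_in V" "cls (x * y) \<in> Z" for x y
    using Z.I_prime[of "cls x" "cls y"] that by (simp add: mult_cls carrier_quot)
  ultimately show "prime_idl V {p \<in> polys_in V. cls p \<in> Z}"
    using id by (auto simp: prime_idl_def)
qed

lemma primeideal_image:
  assumes Pr: "prime_idl V J" and IJ: "I \<subseteq> J"
  shows "primeideal (cls ` J) (R Quot I)"
proof (rule primeidealI)
  have J: "P.idl V J" using Pr by (simp add: prime_idl_def)
  show "ideal (cls ` J) (R Quot I)"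
    using J by (intro PR.ring_ideal_imp_quot_ideal ideal_I) (simp add: ideal_mpol_ring_iff)
  show "cring (R Quot I)" by (rule ideal.quotient_is_cring[OF ideal_I cring_mpol_ring])
  have "cls 1 \<notin> cls ` J"
    using cls_in_image_iff[OF J IJ, of 1] Pr by (simp add: prime_idl_def)
  then show "carrier (R Quot I) \<noteq> cls ` J" by (auto simp: carrier_quot)
  fix a b assume ab: "a \<in> carrier (R Quot I)" "b \<in> carrier (R Quot I)" "a \<otimes>\<^bsub>R Quot I\<^esub> b \<in> cls ` J"
  then obtain x y where xy: "x \<in> polys_in V" "y \<in> polys_in V" "a = cls x" "b = cls y"
    by (auto simp: carrier_quot)
  then have "x * y \<in> J" using ab(3) cls_in_image_iff[OF J IJ, of "x * y"] by (simp add: mult_cls)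
  then show "a \<in> cls ` J \<or> b \<in> cls ` J" using Pr xy by (auto simp: prime_idl_def)
qed

end

section \<open>Depth and dimension of squarefree quotients\<close>

text \<open>
  Boundedness provides the finiteness without which \<open>Max\<close> would be unspecified.
\<close>

lemma Max_eq_bound: "(m :: nat) \<in> A \<Longrightarrow> (\<And>x. x \<in> A \<Longrightarrow> x \<le> m) \<Longrightarrow> Max A = m"
  by (rule Max_eqI) (auto intro: finite_subset[of A "{..m}"])

lemma max_graded_ideal_eq: "max_graded_ideal n = (nonface_ideal {1..n} (coord {1..n}) :: 'k::field mpol set)"
proof -
  have e: "pvar ` {1..n} = (\<lambda>F. \<Prod>k\<in>F. pvar k :: 'k mpol) ` ((\<lambda>i. {i}) ` {1..n})"
    by (simp add: image_image)
  have c: "avoiding ((\<lambda>i. {i}) ` {1..n}) = coord {1..n}" by (auto simp: avoiding_def)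
  have "Idl\<^bsub>mpol_ring {1..n}\<^esub> ((\<lambda>F. \<Prod>k\<in>F. pvar k :: 'k mpol) ` ((\<lambda>i. {i}) ` {1..n})) =
      nonface_ideal {1..n} (avoiding ((\<lambda>i. {i}) ` {1..n}))"
    by (rule Idl_squarefree) auto
  then show ?thesis unfolding max_graded_ideal_def e c .
qed

theorem depth_squarefree:
  fixes D :: "nat set set" and n c :: nat
  defines "V \<equiv> {1..n}"
  assumes D: "down_closed D" and coord_split: "coord_split V c D" and cn: "c \<le> n"
    and C: "C \<subseteq> V" "V - C \<in> D" "\<And>v. v \<in> C \<Longrightarrow> insert v (V - C) \<notin> D" "card C = c"
  shows "depth (max_graded_ideal n) (quot_module (mpol_ring V) (nonface_ideal V D :: 'k::field mpol set)) = n - c"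
proof -
  interpret poly_quotient V "nonface_ideal V D :: 'k mpol set"
    by unfold_locales (rule idl_nonface_ideal[OF D])
  define mx where "mx = (nonface_ideal V (coord V) :: 'k mpol set)"
  note J = idl_nonface_ideal[OF down_closed_coord, of V V, where 'k = 'k, folded mx_def]
  have mx: "max_graded_ideal n = mx" unfolding mx_def V_def by (rule max_graded_ideal_eq)
  have mxV: "p \<in> polys_in V" and mx0: "lookup p 0 = 0" if "p \<in> mx" for p
  proof -
    show "p \<in> polys_in V" using that by (simp add: mx_def nonface_ideal_def)
    have "0 \<notin> keys p" using that by (auto simp: mx_def nonface_ideal_def)
    then show "lookup p 0 = 0" by (simp add: in_keys_iff)
  qed
  have cardV: "card V = n" "card (V - C) = n - c"
    using C by (auto simp: V_def card_Diff_subset finite_subset)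
  show ?thesis
    unfolding depth_def mx
  proof (rule Max_eq_bound)
    define hl where "hl = (map (\<lambda>i. complete_hom (Suc i) [1..<Suc n]) [0..<n - c] :: 'k mpol list)"
    have sV: "set [1..<Suc n] = V" by (auto simp: V_def)
    have hmx: "0 < k \<Longrightarrow> set vs \<subseteq> V \<Longrightarrow> complete_hom k vs \<in> mx" for k vs
    proof (induction k vs rule: complete_hom.induct)
      case (3 k v vs)
      have "pvar v \<in> mx" using 3 by (auto simp: mx_def intro!: pvar_in_coord)
      moreover have "complete_hom k (v # vs) \<in> (polys_in V :: 'k mpol set)" using 3 by (intro complete_hom_in_polys) auto
      ultimately have "pvar v * complete_hom k (v # vs) \<in> mx" by (intro P.idl_mult_right[OF J])
      then show ?case using 3 by (auto intro: P.idl_add[OF J])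
    qed (auto intro: P.idl_zero[OF J])
    have "set hl \<subseteq> range (\<lambda>i. complete_hom (Suc i) [1..<Suc n])" by (auto simp: hl_def)
    moreover have "complete_hom (Suc i) [1..<Suc n] \<in> mx" for i by (rule hmx) (simp_all only: sV order_refl zero_less_Suc)
    ultimately have hl: "set hl \<subseteq> mx" by blast
    have hlV: "set hl \<subseteq> polys_in V" using hl mxV by blast
    have "P.weakly_regular (set [1..<Suc n]) (nonface_ideal (set [1..<Suc n]) D) hl"
      unfolding hl_def using coord_split D cn sV by (intro weakly_regular_coord_split) auto
    then have "P.weakly_regular V (nonface_ideal V D) hl" by (simp only: sV)
    moreover have "1 \<notin> foldl (P.adjoin V) (nonface_ideal V D) hl"
    proof -
      have "{} \<in> D" using down_closedD[OF D C(2)] by simp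
      have "nonface_ideal V D \<subseteq> mx"
      proof
        fix p :: "'k mpol" assume p: "p \<in> nonface_ideal V D"
        have "keys t \<inter> V \<noteq> {}" if "t \<in> keys p" for t
        proof -
          have "keys t \<subseteq> V" "keys t \<noteq> {}"
            using p that \<open>{} \<in> D\<close> by (auto simp: nonface_ideal_def polys_in_def)
          then show ?thesis by blast
        qed
        then show "p \<in> mx" using p by (auto simp: mx_def nonface_ideal_def)
      qed
      have "foldl (P.adjoin V) K hl' \<subseteq> mx" if "set hl' \<subseteq> mx" "K \<subseteq> mx" for K hl'
        using that
      proof (induction hl' arbitrary: K)
        case (Cons a hl')
        then have "P.adjoin V K a \<subseteq> mx" by (intro P.adjoin_least[OF J]) auto
        then show ?case using Cons by simp
      qed simp
      from this[OF hl \<open>nonface_ideal V D \<subseteq> mx\<close>] mx0[of 1] show ?thesis by auto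
    qed
    ultimately have "regular_sequence M hl" by (simp add: regular_sequence_iff[OF hlV])
    then show "n - c \<in> {length fs |fs. set fs \<subseteq> mx \<and> regular_sequence M fs}"
      using hl by (intro CollectI exI[of _ hl]) (auto simp: hl_def)
    fix k assume "k \<in> {length fs |fs. set fs \<subseteq> mx \<and> regular_sequence M fs}"
    then obtain fs where fs: "k = length fs" "set fs \<subseteq> mx" "regular_sequence M fs" by auto
    have fsV: "set fs \<subseteq> polys_in V" using fs mxV by blast
    have "P.weakly_regular V (nonface_ideal V D) fs" using fs(3) by (simp add: regular_sequence_iff[OF fsV])
    then have "length fs \<le> card (V - C)"
      using fs(2) mx0 by (intro length_weakly_regular_le[OF _ D C(1-3) fsV]) (auto simp: V_def)
    then show "k \<le> n - c" using fs(1) cardV by simp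
  qed
qed

theorem krull_dim_squarefree:
  assumes V: "finite V" and D: "down_closed D" and T: "T \<in> D" "T \<subseteq> V"
    and max: "\<And>T'. T' \<in> D \<Longrightarrow> T' \<subseteq> V \<Longrightarrow> card T' \<le> card T"
  shows "krull_dim (mpol_ring V Quot (nonface_ideal V D :: 'k::field mpol set)) = card T"
proof -
  interpret poly_quotient V "nonface_ideal V D :: 'k mpol set"
    by unfold_locales (rule idl_nonface_ideal[OF D])
  show ?thesis
    unfolding krull_dim_def
  proof (rule Max_eq_bound)
    obtain Q :: "nat \<Rightarrow> 'k mpol set" where Q: "\<And>i. i \<le> card T \<Longrightarrow> prime_idl V (Q i)"
      "\<And>i. i < card T \<Longrightarrow> Q i \<subset> Q (Suc i)" "\<And>i. nonface_ideal V D \<subseteq> Q i"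
      using ex_prime_chain[OF V T(2,1) D] by blast
    have "cls ` Q i \<subset> cls ` Q (Suc i)" if i: "i < card T" for i
    proof -
      obtain x where x: "x \<in> Q (Suc i)" "x \<notin> Q i" using Q(2)[OF i] by blast
      have "P.idl V (Q i)" "P.idl V (Q (Suc i))"
        using Q(1)[of i] Q(1)[of "Suc i"] i by (auto simp: prime_idl_def)
      then have "cls x \<notin> cls ` Q i"
        using x P.idl_sub cls_in_image_iff[of "Q i" x] Q(3) by blast
      then show ?thesis using x Q(2)[OF i] by blast
    qed
    then show "card T \<in> {k. \<exists>Z. (\<forall>i\<le>k. primeideal (Z i) (R Quot nonface_ideal V D)) \<and> (\<forall>i<k. Z i \<subset> Z (Suc i))}"
      using Q primeideal_image by (intro CollectI exI[of _ "\<lambda>i. cls ` Q i"]) auto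
    fix k assume "k \<in> {k. \<exists>Z. (\<forall>i\<le>k. primeideal (Z i) (R Quot nonface_ideal V D)) \<and> (\<forall>i<k. Z i \<subset> Z (Suc i))}"
    then obtain Z where Z: "\<And>i. i \<le> k \<Longrightarrow> primeideal (Z i) (R Quot nonface_ideal V D)" "\<And>i. i < k \<Longrightarrow> Z i \<subset> Z (Suc i)"
      by blast
    define Q where "Q i = {p \<in> polys_in V. cls p \<in> Z i}" for i
    have sub: "Z i \<subseteq> cls ` polys_in V" if "i \<le> k" for i
    proof -
      interpret Zi: primeideal "Z i" "R Quot nonface_ideal V D" by (rule Z(1)[OF that])
      show ?thesis using Zi.a_subset by (simp add: carrier_quot)
    qed
    have "\<exists>T'\<in>D. T' \<subseteq> V \<and> k \<le> card T'"
    proof (rule prime_chain_le[OF V])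
      show "prime_idl V (Q i)" if "i \<le> k" for i
        unfolding Q_def by (rule prime_idl_preimage(1)[OF Z(1)[OF that]])
      show "nonface_ideal V D \<subseteq> Q 0"
        unfolding Q_def by (rule prime_idl_preimage(2)[OF Z(1)]) simp
      show "Q i \<subset> Q (Suc i)" if i: "i < k" for i
      proof -
        obtain x where x: "x \<in> Z (Suc i)" "x \<notin> Z i" using Z(2)[OF i] by blast
        then obtain p where "p \<in> polys_in V" "x = cls p" using sub[of "Suc i"] i by auto
        then have "p \<in> Q (Suc i)" "p \<notin> Q i" using x by (auto simp: Q_def)
        moreover have "Q i \<subseteq> Q (Suc i)" using Z(2)[OF i] by (auto simp: Q_def)
        ultimately show ?thesis by blast
      qed
    qed
    then show "k \<le> card T" using max order_trans by blast
  qed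
qed

section \<open>Stanley decompositions of squarefree quotients\<close>

lemma polys_in_mono: "p \<in> polys_in A \<Longrightarrow> A \<subseteq> B \<Longrightarrow> p \<in> polys_in B"
  unfolding polys_in_def by blast

text \<open>
  A pair \<open>(t, Z)\<close> stands for the set of monomials of \<open>x\<^sup>t K[Z]\<close>.
\<close>

definition in_cone :: "(nat \<Rightarrow>\<^sub>0 nat) \<times> nat set \<Rightarrow> (nat \<Rightarrow>\<^sub>0 nat) \<Rightarrow> bool" where
  "in_cone p s \<longleftrightarrow> (\<exists>u. keys u \<subseteq> snd p \<and> s = fst p + u)"

text \<open>
  Counting the cones that contain a monomial expresses disjointness and covering at once, and the counts add
  up when lists are concatenated.
\<close>

definition cone_partition :: "nat set \<Rightarrow> nat set set \<Rightarrow> ((nat \<Rightarrow>\<^sub>0 nat) \<times> nat set) list \<Rightarrow> bool" where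
  "cone_partition V D ps \<longleftrightarrow> (\<forall>(t, Z)\<in>set ps. keys t \<subseteq> V \<and> Z \<subseteq> V) \<and>
    (\<forall>s. keys s \<subseteq> V \<longrightarrow> length (filter (\<lambda>p. in_cone p s) ps) = (if keys s \<in> D then 1 else 0))"

lemma in_cone_shift:
  assumes W: "finite W"
  shows "in_cone (sqfree W + t, Z) s \<longleftrightarrow> W \<subseteq> keys s \<and> in_cone (t, Z) (s - sqfree W)"
proof
  assume "in_cone (sqfree W + t, Z) s"
  then obtain u where u: "keys u \<subseteq> Z" "s = sqfree W + (t + u)" by (auto simp: in_cone_def add.assoc)
  then have "W \<subseteq> keys s" using W by (simp add: keys_exponent_add)
  moreover have "s - sqfree W = t + u" using u(2) by simp
  ultimately show "W \<subseteq> keys s \<and> in_cone (t, Z) (s - sqfree W)" using u(1) by (auto simp: in_cone_def)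
next
  assume a: "W \<subseteq> keys s \<and> in_cone (t, Z) (s - sqfree W)"
  then obtain u where u: "keys u \<subseteq> Z" "s - sqfree W = t + u" by (auto simp: in_cone_def)
  have "s = sqfree W + (t + u)" using minus_sqfree[OF W, of s] a u(2) by simp
  then show "in_cone (sqfree W + t, Z) s" using u(1) by (auto simp: in_cone_def add.assoc)
qed

text \<open>
  For a splitting along \<open>W\<close>, the cones of the part divisible by \<open>x\<^sub>W\<close> are
  shifted by \<open>x\<^sub>W\<close>.
\<close>

lemma cone_partition_coord_split:
  assumes "coord_split V c D" and V: "finite V"
  shows "\<exists>ps. cone_partition V D ps \<and> (\<forall>p\<in>set ps. card V \<le> card (snd p) + c)"
  using assms(1)
proof (induction rule: coord_split.induct)
  case empty
  show ?case by (intro exI[of _ "[]"]) (auto simp: cone_partition_def)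
next
  case (leaf C)
  have "in_cone (0, V - C) s \<longleftrightarrow> keys s \<inter> C = {}" if "keys s \<subseteq> V" for s
    using that by (auto simp: in_cone_def)
  then have "cone_partition V (coord C) [(0, V - C)]" by (auto simp: cone_partition_def)
  moreover have "card V \<le> card (V - C) + c"
    using diff_card_le_card_Diff[OF leaf(1), of V] leaf(2) by simp
  ultimately show ?case by (intro exI[of _ "[(0, V - C)]"]) auto
next
  case (split W D)
  obtain ps1 where ps1: "cone_partition V {T. T \<union> W \<in> D} ps1" "\<forall>p\<in>set ps1. card V \<le> card (snd p) + c"
    using split.IH(1) by blast
  obtain ps2 where ps2: "cone_partition V {T \<in> D. \<not> W \<subseteq> T} ps2" "\<forall>p\<in>set ps2. card V \<le> card (snd p) + c"
    using split.IH(2) by blast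
  let ?sh = "\<lambda>(t, Z). (sqfree W + t, Z)"
  have "cone_partition V D (map ?sh ps1 @ ps2)"
    unfolding cone_partition_def
  proof (intro conjI allI impI)
    have "\<forall>(t, Z)\<in>set ps1. keys t \<subseteq> V \<and> Z \<subseteq> V" "\<forall>(t, Z)\<in>set ps2. keys t \<subseteq> V \<and> Z \<subseteq> V"
      using ps1(1) ps2(1) by (simp_all add: cone_partition_def)
    moreover have "keys (sqfree W + t) \<subseteq> V \<longleftrightarrow> keys t \<subseteq> V" for t
      using split.hyps(1,2) by (simp add: keys_exponent_add)
    ultimately show "\<forall>(t, Z)\<in>set (map ?sh ps1 @ ps2). keys t \<subseteq> V \<and> Z \<subseteq> V"
      unfolding case_prod_unfold set_append set_map ball_Un by simp
    fix s :: "nat \<Rightarrow>\<^sub>0 nat" assume s: "keys s \<subseteq> V"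
    have "length (filter (\<lambda>p. in_cone p s) (map ?sh ps1)) =
        length (filter (\<lambda>p. W \<subseteq> keys s \<and> in_cone p (s - sqfree W)) ps1)"
    proof -
      have "in_cone (?sh p) s \<longleftrightarrow> W \<subseteq> keys s \<and> in_cone p (s - sqfree W)" for p
        using in_cone_shift[OF split.hyps(1)] by (cases p) simp
      then show ?thesis by (simp add: filter_map comp_def)
    qed
    also have "\<dots> = (if W \<subseteq> keys s \<and> keys s \<in> D then 1 else 0)"
    proof (cases "W \<subseteq> keys s")
      case True
      have e: "keys s = W \<union> keys (s - sqfree W)"
        using minus_sqfree[OF split.hyps(1) True] keys_exponent_add[of "sqfree W" "s - sqfree W"] split.hyps(1) by simp
      then have "keys (s - sqfree W) \<subseteq> V" using s by blast
      then have "length (filter (\<lambda>p. in_cone p (s - sqfree W)) ps1) =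
          (if keys (s - sqfree W) \<in> {T. T \<union> W \<in> D} then 1 else 0)"
        using ps1(1) by (simp add: cone_partition_def)
      moreover have "keys (s - sqfree W) \<union> W = keys s" using e by blast
      ultimately show ?thesis using True by simp
    qed simp
    finally have 1: "length (filter (\<lambda>p. in_cone p s) (map ?sh ps1)) = (if W \<subseteq> keys s \<and> keys s \<in> D then 1 else 0)" .
    have 2: "length (filter (\<lambda>p. in_cone p s) ps2) = (if keys s \<in> {T \<in> D. \<not> W \<subseteq> T} then 1 else 0)"
      using ps2(1) s unfolding cone_partition_def by blast
    show "length (filter (\<lambda>p. in_cone p s) (map ?sh ps1 @ ps2)) = (if keys s \<in> D then 1 else 0)"
      unfolding filter_append length_append 1 2 by auto
  qed
  moreover have "\<forall>p\<in>set (map ?sh ps1 @ ps2). card V \<le> card (snd p) + c"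
    using ps1(2) ps2(2) by auto
  ultimately show ?case by blast
qed

context
  fixes n :: nat and D :: "nat set set" and V :: "nat set"
  defines "V \<equiv> {1..n}"
  assumes D: "down_closed D"
begin

text \<open>
  A polynomial decomposes according to the cones that contain its monomials; the monomials contained in no
  cone lie in the ideal.
\<close>

lemma stanley_decomposition_of_cones:
  assumes ps: "cone_partition V D ps"
  shows "stanley_decomposition n (quot_module (mpol_ring V) (nonface_ideal V D :: 'k::field mpol set))
      (quot_component n (nonface_ideal V D))
      (map (\<lambda>(t, Z). (nonface_ideal V D +>\<^bsub>mpol_ring V\<^esub> single t 1, Z)) ps)"
proof -
  interpret poly_quotient V "nonface_ideal V D :: 'k mpol set"
    by unfold_locales (rule idl_nonface_ideal[OF D])
  define L where "L = length ps"
  define t where "t i = fst (ps ! i)" for i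
  define Z where "Z i = snd (ps ! i)" for i
  let ?I = "nonface_ideal V D :: 'k mpol set"
  let ?Ds = "map (\<lambda>(t, Z). (cls (single t 1), Z)) ps"
  have nth: "?Ds ! i = (cls (single (t i) 1), Z i)" if "i < L" for i
    using that by (simp add: L_def t_def Z_def split_beta)
  have tZ: "keys (t i) \<subseteq> V" "Z i \<subseteq> V" if "i < L" for i
  proof -
    have "ps ! i \<in> set ps" using that by (simp add: L_def)
    then show "keys (t i) \<subseteq> V" "Z i \<subseteq> V"
      using ps by (auto simp: cone_partition_def t_def Z_def split_beta)
  qed
  define H where "H s = {i. i < L \<and> in_cone (ps ! i) s}" for s
  have cardH: "card (H s) = (if keys s \<in> D then 1 else 0)" if "keys s \<subseteq> V" for s
    using ps that by (simp add: cone_partition_def length_filter_conv_card H_def L_def)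
  have finH: "finite (H s)" for s by (simp add: H_def)
  have cone: "i \<in> H (t i + y)" "keys (t i + y) \<in> D" "\<And>j. j \<in> H (t i + y) \<Longrightarrow> j = i"
    if i: "i < L" and y: "keys y \<subseteq> Z i" for i y
  proof -
    show m: "i \<in> H (t i + y)" using i y by (auto simp: H_def in_cone_def t_def Z_def)
    have "keys (t i + y) \<subseteq> V" using tZ[OF i] y by (auto simp: keys_exponent_add)
    from cardH[OF this] m have c: "card (H (t i + y)) = 1" and "keys (t i + y) \<in> D"
      using finH[of "t i + y"] by (auto split: if_splits)
    then show "keys (t i + y) \<in> D" by simp
    from c obtain z where "H (t i + y) = {z}" using card_1_singletonE by blast
    then show "j = i" if "j \<in> H (t i + y)" for j using that m by auto
  qed
  have tV: "single (t i) 1 \<in> (polys_in V :: 'k mpol set)" if "i < L" for i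
    using tZ[OF that] by (intro single_in_polys) auto
  have ZV: "u \<in> polys_in V" if "u \<in> polys_in (Z i)" "i < L" for u :: "'k mpol" and i
    using that tZ[OF that(2)] by (auto simp: polys_in_def)
  \<comment> \<open>The cones are disjoint, so no monomial of one summand cancels against another summand.\<close>
  have indep: "d i = 0"
    if d: "\<And>i. i < L \<Longrightarrow> d i \<in> polys_in (Z i)" and s: "(\<Sum>i<L. single (t i) 1 * d i) \<in> ?I" and i: "i < L"
    for d :: "nat \<Rightarrow> 'k mpol" and i
  proof (rule ccontr)
    assume "d i \<noteq> 0"
    then obtain y where y: "y \<in> keys (d i)" by (metis keys_eq_empty ex_in_conv)
    have yZ: "keys y \<subseteq> Z i" using d[OF i] y by (auto simp: polys_in_def)
    let ?s = "t i + y"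
    have "lookup (single (t j) 1 * d j) ?s = 0" if j: "j < L" "j \<noteq> i" for j
    proof (rule ccontr)
      assume "lookup (single (t j) 1 * d j) ?s \<noteq> 0"
      then have "?s \<in> keys (single (t j) 1 * d j)" by (simp add: in_keys_iff)
      then obtain z where z: "z \<in> keys (d j)" "?s = t j + z"
        using keys_single_mult[of "1 :: 'k" "t j" "d j"] by auto
      have "keys z \<subseteq> Z j" using d[OF j(1)] z by (auto simp: polys_in_def)
      then have "j \<in> H ?s" using cone(1)[OF j(1), of z] z(2) by simp
      then show False using cone(3)[OF i yZ] j(2) by blast
    qed
    then have "lookup (\<Sum>i<L. single (t i) 1 * d i) ?s = lookup (single (t i) 1 * d i) ?s"
      unfolding lookup_sum using i by (subst sum.remove[of _ i]) auto
    also have "\<dots> \<noteq> 0" using y by (simp add: lookup_single_mult in_keys_iff)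
    finally have "?s \<in> keys (\<Sum>i<L. single (t i) 1 * d i)" by (simp add: in_keys_iff)
    with s cone(2)[OF i yZ] show False by (auto simp: nonface_ideal_def)
  qed
  have space: "stanley_space M (cls (single (t i) 1)) (Z i) = (\<lambda>u. cls (single (t i) 1 * u)) ` polys_in (Z i)"
    if i: "i < L" for i
  proof -
    have "stanley_space M (cls (single (t i) 1)) (Z i) = (\<lambda>u. u \<odot>\<^bsub>M\<^esub> cls (single (t i) 1)) ` polys_in (Z i)"
      by (auto simp: stanley_space_def)
    also have "\<dots> = (\<lambda>u. cls (single (t i) 1 * u)) ` polys_in (Z i)"
      using tV[OF i] ZV[OF _ i] by (intro image_cong) (simp_all add: smult_cls mult.commute)
    finally show ?thesis .
  qed
  show ?thesis
    unfolding stanley_decomposition_def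
  proof (intro conjI ballI)
    fix mZ assume "mZ \<in> set ?Ds"
    then obtain i where "i < length ?Ds" "?Ds ! i = mZ"
      unfolding in_set_conv_nth by blast
    then have i: "i < L" "mZ = (cls (single (t i) 1), Z i)"
      using nth[of i] by (simp_all only: L_def length_map)
    have "inj_on (\<lambda>u. u \<odot>\<^bsub>M\<^esub> cls (single (t i) 1)) (polys_in (Z i))"
    proof (rule inj_onI)
      fix u u' :: "'k mpol"
      assume u: "u \<in> polys_in (Z i)" "u' \<in> polys_in (Z i)"
        "u \<odot>\<^bsub>M\<^esub> cls (single (t i) 1) = u' \<odot>\<^bsub>M\<^esub> cls (single (t i) 1)"
      then have "single (t i) 1 * (u - u') \<in> ?I"
        using ZV i(1) tV by (simp add: smult_cls cls_eq_iff algebra_simps)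
      moreover define d where "d j = (if j = i then u - u' else 0)" for j
      have "(\<Sum>j<L. single (t j) 1 * d j) = single (t i) 1 * (u - u')"
        using i(1) by (subst sum.remove[of _ i]) (auto simp: d_def)
      ultimately have "d i = 0"
        using u i(1) by (intro indep) (auto simp: d_def)
      then show "u = u'" by (simp add: d_def)
    qed
    moreover have "\<exists>a\<in>Zn n. cls (single (t i) 1) \<in> quot_component n ?I a"
    proof (intro bexI)
      show "cls (single (t i) 1) \<in> quot_component n ?I (\<lambda>k. int (lookup (t i) k))"
        by (auto simp: quot_component_def poly_component_def V_def)
      show "(\<lambda>k. int (lookup (t i) k)) \<in> Zn n"
        using tZ(1)[OF i(1)] by (auto simp: Zn_def V_def in_keys_iff subset_iff)
    qed
    moreover have "cls (single (t i) 1) \<in> carrier M" unfolding carrier_M using tV[OF i(1)] by blast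
    moreover have "Z i \<subseteq> {1..n}" using tZ(2)[OF i(1)] by (simp add: V_def)
    ultimately show "case mZ of (m, Z) \<Rightarrow> m \<in> carrier M \<and> (\<exists>a\<in>Zn n. m \<in> quot_component n ?I a) \<and>
        Z \<subseteq> {1..n} \<and> inj_on (\<lambda>u. u \<odot>\<^bsub>M\<^esub> m) (polys_in Z)"
      unfolding i(2) by simp
  next
    fix x assume "x \<in> carrier M"
    then obtain p where p: "p \<in> polys_in V" "x = cls p" by (auto simp: carrier_M)
    have len: "length ?Ds = L" by (simp add: L_def)
    have PiE: "v \<in> (\<Pi>\<^sub>E i\<in>{..<length ?Ds}. stanley_space M (fst (?Ds ! i)) (snd (?Ds ! i))) \<longleftrightarrow>
        v \<in> extensional {..<L} \<and> (\<forall>i<L. \<exists>u\<in>polys_in (Z i). v i = cls (single (t i) 1 * u))" for v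
      unfolding len PiE_def using nth space by (auto simp: Pi_def image_iff)
    define u where "u i = (\<Sum>s\<in>keys p. if i \<in> H s then single (s - t i) (lookup p s) else 0)" for i
    have uZ: "u i \<in> polys_in (Z i)" for i
      unfolding u_def
    proof (rule P.sum_S)
      fix s
      have "keys (s - t i) \<subseteq> Z i" if "i \<in> H s"
        using that by (auto simp: H_def in_cone_def t_def Z_def)
      then show "(if i \<in> H s then single (s - t i) (lookup p s) else 0) \<in> polys_in (Z i)"
        by (auto intro: single_in_polys)
    qed
    have "(\<Sum>i<L. single (t i) 1 * u i) = (\<Sum>i<L. \<Sum>s\<in>keys p. if i \<in> H s then single s (lookup p s) else 0)"
      unfolding u_def sum_distrib_left
    proof (intro sum.cong refl)
      fix i s
      show "single (t i) 1 * (if i \<in> H s then single (s - t i) (lookup p s) else 0) =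
          (if i \<in> H s then single s (lookup p s) else 0)"
        by (auto simp: mult_single H_def in_cone_def t_def)
    qed
    also have "\<dots> = (\<Sum>s\<in>keys p. \<Sum>i<L. if i \<in> H s then single s (lookup p s) else 0)"
      by (rule sum.swap)
    also have "\<dots> = (\<Sum>s\<in>keys p. if keys s \<in> D then single s (lookup p s) else 0)"
    proof (rule sum.cong[OF refl])
      fix s assume "s \<in> keys p"
      then have s: "keys s \<subseteq> V" using p(1) by (auto simp: polys_in_def)
      have "(\<Sum>i<L. if i \<in> H s then single s (lookup p s) else 0) = (\<Sum>i\<in>H s. single s (lookup p s))"
        by (rule sum.mono_neutral_cong_right) (auto simp: H_def)
      then show "(\<Sum>i<L. if i \<in> H s then single s (lookup p s) else 0) = (if keys s \<in> D then single s (lookup p s) else 0)"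
        using cardH[OF s] by simp
    qed
    finally have su: "(\<Sum>i<L. single (t i) 1 * u i) = (\<Sum>s\<in>keys p. if keys s \<in> D then single s (lookup p s) else 0)" .
    have pu: "p - (\<Sum>i<L. single (t i) 1 * u i) \<in> ?I"
    proof -
      have "p - (\<Sum>i<L. single (t i) 1 * u i) = (\<Sum>s\<in>keys p. if keys s \<in> D then 0 else single s (lookup p s))"
        unfolding su by (subst expand_monomials[of p]) (simp add: sum_subtractf[symmetric] if_distrib cong: if_cong sum.cong)
      also have "\<dots> \<in> ?I"
      proof (rule P.idl_sum[OF idl_nonface_ideal[OF D]])
        fix s assume "s \<in> keys p"
        then have "keys s \<subseteq> V" using p(1) by (auto simp: polys_in_def)
        then show "(if keys s \<in> D then 0 else single s (lookup p s)) \<in> ?I"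
          by (auto intro: single_in_nonface_ideal P.idl_zero[OF idl_nonface_ideal[OF D]])
      qed
      finally show ?thesis .
    qed
    have guV: "single (t i) 1 * u' \<in> (polys_in V :: 'k mpol set)" if "i < L" "u' \<in> polys_in (Z i)" for i u'
      using tV[OF that(1)] ZV[OF that(2,1)] by auto
    have fins: "finsum M v {..<L} = cls (\<Sum>i<L. single (t i) 1 * w i)"
      if "\<And>i. i < L \<Longrightarrow> w i \<in> polys_in (Z i)" "\<And>i. i < L \<Longrightarrow> v i = cls (single (t i) 1 * w i)" for v w
      using that guV by (intro finsum_cls) auto
    have sV: "(\<Sum>i<L. single (t i) 1 * w i) \<in> polys_in V" if "\<And>i. i < L \<Longrightarrow> w i \<in> polys_in (Z i)"
      for w :: "nat \<Rightarrow> 'k mpol"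
      using that guV by (intro P.sum_S) auto
    let ?v = "\<lambda>i\<in>{..<L}. cls (single (t i) 1 * u i)"
    have fin_v: "x = finsum M ?v {..<L}"
    proof -
      have "finsum M ?v {..<L} = cls (\<Sum>i<L. single (t i) 1 * u i)"
        using uZ by (intro fins) auto
      also have "\<dots> = cls p"
        using pu P.idl_uminus[OF idl_nonface_ideal[OF D] pu] p(1) sV[of u] uZ by (simp add: cls_eq_iff)
      finally show ?thesis using p(2) by simp
    qed
    have uniq: "v = ?v" if v: "v \<in> extensional {..<L}"
      "\<forall>i<L. \<exists>u\<in>polys_in (Z i). v i = cls (single (t i) 1 * u)" "x = finsum M v {..<L}" for v
    proof -
      obtain w where w: "\<And>i. i < L \<Longrightarrow> w i \<in> polys_in (Z i) \<and> v i = cls (single (t i) 1 * w i)"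
        using v(2) by metis
      have "cls p = cls (\<Sum>i<L. single (t i) 1 * w i)"
        using v(3) p(2) fins[of w v] w by simp
      then have "p - (\<Sum>i<L. single (t i) 1 * w i) \<in> ?I"
        using p(1) sV[of w] w by (simp add: cls_eq_iff)
      from P.idl_diff[OF idl_nonface_ideal[OF D] this pu]
      have "(\<Sum>i<L. single (t i) 1 * u i) - (\<Sum>i<L. single (t i) 1 * w i) \<in> ?I" by simp
      then have "(\<Sum>i<L. single (t i) 1 * (u i - w i)) \<in> ?I"
        by (simp add: sum_subtractf right_diff_distrib)
      from indep[OF _ this] have "u i - w i = 0" if "i < L" for i
        using that w uZ by auto
      then have "v i = ?v i" if "i < L" for i using that w by simp
      then show "v = ?v" using v(1) by (intro extensionalityI[of v "{..<L}"]) auto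
    qed
    show "\<exists>!v. v \<in> (\<Pi>\<^sub>E i\<in>{..<length ?Ds}. stanley_space M (fst (?Ds ! i)) (snd (?Ds ! i))) \<and>
        x = finsum M v {..<length ?Ds}"
    proof (rule ex1I)
      have "\<forall>i<L. \<exists>u'\<in>polys_in (Z i). ?v i = cls (single (t i) 1 * u')" using uZ by auto
      then show "?v \<in> (\<Pi>\<^sub>E i\<in>{..<length ?Ds}. stanley_space M (fst (?Ds ! i)) (snd (?Ds ! i))) \<and>
          x = finsum M ?v {..<length ?Ds}"
        unfolding PiE unfolding len using fin_v by simp
      show "v = ?v" if "v \<in> (\<Pi>\<^sub>E i\<in>{..<length ?Ds}. stanley_space M (fst (?Ds ! i)) (snd (?Ds ! i))) \<and>
          x = finsum M v {..<length ?Ds}" for v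
        using that unfolding PiE unfolding len by (intro uniq) blast+
    qed
  qed
qed

text \<open>
  Let \<open>w\<close> be the product of the variables outside \<open>C\<close>, and \<open>m K[Z]\<close> a
  summand in which \<open>w\<close> has a nonzero component. Homogeneity makes \<open>m\<close> a multiple of
  a monomial dividing \<open>w\<close>. A variable in \<open>Z \<inter> C\<close> would annihilate
  \<open>w\<close>, and hence a nonzero element of \<open>m K[Z]\<close>, against freeness.
\<close>

lemma sdepth_decomposition_le:
  assumes C: "C \<subseteq> V" "V - C \<in> D" "\<And>v. v \<in> C \<Longrightarrow> insert v (V - C) \<notin> D"
    and SD: "stanley_decomposition n (quot_module (mpol_ring V) (nonface_ideal V D :: 'k::field mpol set))
      (quot_component n (nonface_ideal V D)) Ds"
  shows "sdepth_decomposition Ds \<le> card (V - C)"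
proof -
  interpret poly_quotient V "nonface_ideal V D :: 'k mpol set"
    by unfold_locales (rule idl_nonface_ideal[OF D])
  let ?I = "nonface_ideal V D :: 'k mpol set"
  have finV: "finite V" by (simp add: V_def)
  let ?s = "sqfree (V - C)"
  have ks: "keys ?s = V - C" using finV by simp
  define w where "w = (single ?s 1 :: 'k mpol)"
  have w: "w \<in> polys_in V" using finV by (auto simp: w_def single_in_polys)
  have "cls w \<in> carrier M" using w unfolding carrier_M by blast
  with SD[unfolded stanley_decomposition_def, THEN conjunct2]
  have "\<exists>!v. v \<in> (\<Pi>\<^sub>E i\<in>{..<length Ds}. stanley_space M (fst (Ds ! i)) (snd (Ds ! i))) \<and>
      cls w = finsum M v {..<length Ds}" by (rule bspec)
  then obtain v where v: "v \<in> (\<Pi>\<^sub>E i\<in>{..<length Ds}. stanley_space M (fst (Ds ! i)) (snd (Ds ! i)))"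
    "cls w = finsum M v {..<length Ds}" by (elim ex1E conjE)
  have "\<exists>u p a. v i = u \<odot>\<^bsub>M\<^esub> fst (Ds ! i) \<and> u \<in> polys_in (snd (Ds ! i)) \<and> fst (Ds ! i) = cls p \<and>
      p \<in> poly_component a \<and> p \<in> polys_in V \<and> snd (Ds ! i) \<subseteq> V \<and>
      inj_on (\<lambda>u. u \<odot>\<^bsub>M\<^esub> fst (Ds ! i)) (polys_in (snd (Ds ! i)))" if i: "i < length Ds" for i
  proof -
    have "Ds ! i \<in> set Ds" using i by simp
    then have m: "\<exists>a\<in>Zn n. fst (Ds ! i) \<in> quot_component n ?I a" "snd (Ds ! i) \<subseteq> V"
      "inj_on (\<lambda>u. u \<odot>\<^bsub>M\<^esub> fst (Ds ! i)) (polys_in (snd (Ds ! i)))"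
      using SD unfolding stanley_decomposition_def by (auto simp: V_def split_beta)
    then obtain a p where a: "a \<in> Zn n" "p \<in> poly_component a" "fst (Ds ! i) = cls p"
      by (auto simp: quot_component_def V_def)
    have "keys t \<subseteq> V" if "t \<in> keys p" for t
    proof
      fix k assume "k \<in> keys t"
      moreover have "a k = int (lookup t k)" using a(2) that by (simp add: poly_component_def)
      ultimately have "a k \<noteq> 0" by (simp add: in_keys_iff)
      then show "k \<in> V" using a(1) by (auto simp: Zn_def V_def)
    qed
    then have "p \<in> polys_in V" by (auto simp: polys_in_def)
    moreover have "v i \<in> stanley_space M (fst (Ds ! i)) (snd (Ds ! i))" using v(1) i by (auto simp: PiE_def)
    then obtain u where "u \<in> polys_in (snd (Ds ! i))" "v i = u \<odot>\<^bsub>M\<^esub> fst (Ds ! i)"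
      by (auto simp: stanley_space_def)
    ultimately show ?thesis using a m by blast
  qed
  then obtain u p a where upa: "\<And>i. i < length Ds \<Longrightarrow> v i = u i \<odot>\<^bsub>M\<^esub> fst (Ds ! i) \<and>
      u i \<in> polys_in (snd (Ds ! i)) \<and> fst (Ds ! i) = cls (p i) \<and>
      p i \<in> poly_component (a i) \<and> p i \<in> polys_in V \<and> snd (Ds ! i) \<subseteq> V \<and>
      inj_on (\<lambda>u. u \<odot>\<^bsub>M\<^esub> fst (Ds ! i)) (polys_in (snd (Ds ! i)))"
    by metis
  have uV: "u i \<in> polys_in V" if "i < length Ds" for i
    using upa[OF that] polys_in_mono by blast
  have upV: "u i * p i \<in> polys_in V" if "i < length Ds" for i
    using uV[OF that] upa[OF that] by auto
  have "finsum M v {..<length Ds} = cls (\<Sum>i<length Ds. u i * p i)"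
    using upa uV upV by (intro finsum_cls) (auto simp: smult_cls)
  then have "cls w = cls (\<Sum>i<length Ds. u i * p i)" using v(2) by simp
  moreover have "(\<Sum>i<length Ds. u i * p i) \<in> polys_in V" using upV by (intro P.sum_S) auto
  ultimately have "w - (\<Sum>i<length Ds. u i * p i) \<in> ?I" using w cls_eq_iff by blast
  then have "?s \<notin> keys (w - (\<Sum>i<length Ds. u i * p i))"
    using C(2) ks by (auto simp: nonface_ideal_def)
  then have sum1: "(\<Sum>i<length Ds. lookup (u i * p i) ?s) = 1"
    by (simp add: in_keys_iff lookup_minus lookup_sum w_def)
  have "\<exists>i<length Ds. lookup (u i * p i) ?s \<noteq> 0"
  proof (rule ccontr)
    assume "\<not> ?thesis"
    then have "(\<Sum>i<length Ds. lookup (u i * p i) ?s) = 0" by (intro sum.neutral) auto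
    with sum1 show False by simp
  qed
  then obtain i where i: "i < length Ds" "lookup (u i * p i) ?s \<noteq> 0" by blast
  then have "?s \<in> keys (u i * p i)" by (simp add: in_keys_iff)
  then obtain y t where yt: "y \<in> keys (u i)" "t \<in> keys (p i)" "?s = y + t"
    using keys_mult[of "u i" "p i"] by blast
  have "keys (p i) = {t}"
  proof -
    have "t' = t" if "t' \<in> keys (p i)" for t'
    proof (rule poly_mapping_eqI)
      fix k
      have "int (lookup t' k) = a i k" "int (lookup t k) = a i k"
        using upa[OF i(1)] that yt(2) by (auto simp: poly_component_def)
      then show "lookup t' k = lookup t k" by simp
    qed
    then show ?thesis using yt(2) by blast
  qed
  then have pi: "p i = single t (lookup (p i) t)"
    using expand_monomials[of "p i"] by simp
  have yZ: "keys y \<subseteq> snd (Ds ! i)" using upa[OF i(1)] yt(1) by (auto simp: polys_in_def)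
  have "snd (Ds ! i) \<inter> C = {}"
  proof (rule ccontr)
    assume "snd (Ds ! i) \<inter> C \<noteq> {}"
    then obtain k where k: "k \<in> snd (Ds ! i)" "k \<in> C" by blast
    define g where "g = (single (single k 1 + y) 1 :: 'k mpol)"
    have "lookup g (single k 1 + y) = 1" by (simp add: g_def)
    then have "g \<noteq> 0" by auto
    moreover have "g \<in> polys_in (snd (Ds ! i))"
      unfolding g_def using k(1) yZ by (intro single_in_polys) (simp add: keys_exponent_add)
    ultimately have g: "g \<in> polys_in (snd (Ds ! i))" "g \<noteq> 0" by simp_all
    have gV: "g \<in> polys_in V" using g(1) upa[OF i(1)] polys_in_mono by blast
    have "g * p i = single (single k 1 + ?s) (lookup (p i) t)"
      by (subst pi) (simp add: g_def mult_single yt(3) add.assoc)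
    also have "\<dots> \<in> ?I"
      using k(2) C ks by (intro single_in_nonface_ideal) (auto simp: keys_exponent_add)
    finally have "g * p i - 0 * p i \<in> ?I" by simp
    then have "cls (g * p i) = cls (0 * p i)"
      using gV upa[OF i(1)] by (intro cls_eq_iff[THEN iffD2]) auto
    then have "g \<odot>\<^bsub>M\<^esub> fst (Ds ! i) = 0 \<odot>\<^bsub>M\<^esub> fst (Ds ! i)"
      using gV upa[OF i(1)] by (simp add: smult_cls)
    then have "g = 0" using upa[OF i(1)] g(1) by (auto dest!: inj_onD[of _ _ g 0])
    with g(2) show False by simp
  qed
  then have "snd (Ds ! i) \<subseteq> V - C" using upa[OF i(1)] by blast
  then have "card (snd (Ds ! i)) \<le> card (V - C)" using finV by (intro card_mono) auto
  moreover have "sdepth_decomposition Ds \<le> card (snd (Ds ! i))"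
    unfolding sdepth_decomposition_def using i(1)
    by (intro Min_le) (auto simp: image_iff split_beta intro!: bexI[of _ "Ds ! i"])
  ultimately show ?thesis by simp
qed

theorem sdepth_squarefree:
  assumes coord_split: "coord_split V c D"
    and C: "C \<subseteq> V" "V - C \<in> D" "\<And>v. v \<in> C \<Longrightarrow> insert v (V - C) \<notin> D" "card C = c"
  shows "sdepth n (quot_module (mpol_ring V) (nonface_ideal V D :: 'k::field mpol set)) (quot_component n (nonface_ideal V D)) = n - c"
proof -
  have finV: "finite V" "card V = n" by (simp_all add: V_def)
  have cVC: "card (V - C) = n - c" using C finV by (simp add: card_Diff_subset finite_subset)
  have le: "sdepth_decomposition Ds \<le> n - c"
    if "stanley_decomposition n (quot_module (mpol_ring V) (nonface_ideal V D :: 'k mpol set)) (quot_component n (nonface_ideal V D)) Ds" for Ds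
    using sdepth_decomposition_le[OF C(1-3) that] cVC by simp
  obtain ps where ps: "cone_partition V D ps" "\<forall>p\<in>set ps. card V \<le> card (snd p) + c"
    using cone_partition_coord_split[OF coord_split finV(1)] by blast
  define Ds where "Ds = map (\<lambda>(t, Z). ((nonface_ideal V D :: 'k mpol set) +>\<^bsub>mpol_ring V\<^esub> single t 1, Z)) ps"
  have SD: "stanley_decomposition n (quot_module (mpol_ring V) (nonface_ideal V D :: 'k mpol set)) (quot_component n (nonface_ideal V D)) Ds"
    unfolding Ds_def by (rule stanley_decomposition_of_cones[OF ps(1)])
  have "{} \<in> D" using down_closedD[OF D C(2)] by simp
  then have "length (filter (\<lambda>p. in_cone p 0) ps) = 1" using ps(1) by (simp add: cone_partition_def)
  then have "ps \<noteq> []" by auto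
  have "n - c \<le> sdepth_decomposition Ds"
    unfolding sdepth_decomposition_def
  proof (rule Min.boundedI)
    show "(\<lambda>(m, Z). card Z) ` set Ds \<noteq> {}" using \<open>ps \<noteq> []\<close> by (simp add: Ds_def)
    fix a assume "a \<in> (\<lambda>(m, Z). card Z) ` set Ds"
    then obtain p where "p \<in> set ps" "a = card (snd p)" by (auto simp: Ds_def split_beta)
    then show "n - c \<le> a" using ps(2) finV(2) by fastforce
  qed simp
  then have eq: "sdepth_decomposition Ds = n - c" using le[OF SD] by simp
  show ?thesis
    unfolding sdepth_def
  proof (rule Max_eq_bound)
    show "n - c \<in> {sdepth_decomposition Ds |Ds. stanley_decomposition n
        (quot_module (mpol_ring V) (nonface_ideal V D :: 'k mpol set)) (quot_component n (nonface_ideal V D)) Ds}"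
      using SD eq[symmetric] by blast
  qed (use le in blast)
qed

end

section \<open>Interval ideals\<close>

theorem theorem1p6:
  fixes n s :: nat and as bs :: "nat list" and I :: "'k::field mpol set"
  assumes "n \<ge> 1" and "s \<le> n" and "length as = s" and "length bs = s"
    and "sorted_wrt (<) as" and "sorted_wrt (<) bs"
    and "s \<ge> 1 \<Longrightarrow> 1 \<le> as ! 0" and "s \<ge> 1 \<Longrightarrow> bs ! (s - 1) \<le> n"
    and "\<And>i. i < s \<Longrightarrow> as ! i \<le> bs ! i"
  defines "I \<equiv> interval_ideal n as bs"
  defines "M \<equiv> quot_module (mpol_ring {1..n}) I"
  shows "int (depth (max_graded_ideal n) M) = phi n as bs \<and>
         int (sdepth n M (quot_component n I)) = phi n as bs \<and>
         int (krull_dim (mpol_ring {1..n} Quot I)) = psi n as bs"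
proof -
  define ps where "ps = zip as bs"
  have len: "length as = length bs" using assms by simp
  have A: "admissible_pairs ps"
    unfolding ps_def admissible_pairs_zip[OF len] using assms by auto
  let ?V = "{1..n}" and ?D = "avoiding (intervals ps)"
  have finV: "finite ?V" by simp
  have ends: "1 \<le> as ! i" "bs ! i \<le> n" if i: "i < s" for i
  proof -
    have "as ! 0 \<le> as ! i"
      using assms(3,5) i by (cases "i = 0") (auto simp: sorted_wrt_nth_less less_imp_le)
    then show "1 \<le> as ! i" using assms(7) i by simp
    have "bs ! i \<le> bs ! (s - 1)"
      using assms(4,6) i by (cases "i = s - 1") (auto simp: sorted_wrt_nth_less less_imp_le)
    then show "bs ! i \<le> n" using assms(8) i by simp
  qed
  have inV: "F \<subseteq> ?V" "finite F" if F: "F \<in> intervals ps" for F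
  proof -
    obtain a b where ab: "(a, b) \<in> set ps" "F = {a..b}" using F by (rule intervalsE)
    then obtain i where "i < s" "a = as ! i" "b = bs ! i"
      using assms(3,4) by (auto simp: ps_def set_zip)
    then show "F \<subseteq> ?V" "finite F" using ends ab by auto
  qed
  have UV: "\<Union> (intervals ps) \<subseteq> ?V" using inV by blast
  have D: "down_closed ?D" unfolding down_closed_def avoiding_def by blast
  have I: "I = nonface_ideal ?V ?D"
  proof -
    have "{interval_monomial (as ! i) (bs ! i) :: 'k mpol | i. i < length as} = (\<lambda>F. \<Prod>k\<in>F. pvar k) ` intervals ps"
      unfolding interval_monomial_def intervals_def ps_def using len by (auto simp: set_zip image_iff)
    then show ?thesis
      unfolding I_def interval_ideal_def using inV by (simp only:) (intro Idl_squarefree, blast)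
  qed
  have face: "?V - C \<in> ?D \<longleftrightarrow> (\<forall>F\<in>intervals ps. F \<inter> C \<noteq> {})" for C
    using inV(1) by (fastforce simp: avoiding_def)
  obtain C where C: "minimal_cover C (intervals ps)" "card C = greedy_count ps" using ex_minimal_cover[OF A] by blast
  have CV: "C \<subseteq> ?V"
  proof
    fix q assume "q \<in> C"
    then obtain F where "F \<in> intervals ps" "F \<inter> C = {q}" using minimal_cover_private[OF C(1)] by blast
    then show "q \<in> ?V" using inV(1) by blast
  qed
  have CD: "?V - C \<in> ?D" using face minimal_cover_hit[OF C(1)] by blast
  have Cmax: "insert q (?V - C) \<notin> ?D" if q: "q \<in> C" for q
  proof -
    obtain F where F: "F \<in> intervals ps" "F \<inter> C = {q}" using minimal_cover_private[OF C(1) q] by blast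
    then have "F \<subseteq> insert q (?V - C)" using inV(1)[OF F(1)] by blast
    then show ?thesis using F(1) by (auto simp: avoiding_def)
  qed
  have coord_split: "coord_split ?V (greedy_count ps) ?D"
    by (rule coord_split_intervals[OF A UV]) (rule card_minimal_cover_le[OF A])
  have cn: "greedy_count ps \<le> n" using card_mono[OF finV CV] C(2) by simp
  have phi: "phi n as bs = int (n - greedy_count ps)"
    using phi_eq_greedy_count[OF len, of n] A cn by (simp add: ps_def)
  have depth: "depth (max_graded_ideal n) M = n - greedy_count ps"
    unfolding M_def I by (rule depth_squarefree[OF D coord_split cn CV CD Cmax C(2)])
  have sdepth: "sdepth n M (quot_component n I) = n - greedy_count ps"
    unfolding M_def I by (rule sdepth_squarefree[OF D coord_split CV CD Cmax C(2)])
  obtain B where B: "finite B" "B \<subseteq> \<Union> (intervals ps)" "\<forall>F\<in>intervals ps. F \<inter> B \<noteq> {}" "card B = disjoint_count ps"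
    using ex_cover_disjoint_count[OF A] by blast
  have BV: "B \<subseteq> ?V" using B(2) UV by blast
  have hn: "disjoint_count ps \<le> n" using card_mono[OF finV BV] B(4) by simp
  have cB: "card (?V - B) = n - disjoint_count ps" using B BV by (simp add: card_Diff_subset)
  have "krull_dim (mpol_ring ?V Quot I) = card (?V - B)"
    unfolding I
  proof (rule krull_dim_squarefree[OF finV D])
    show "?V - B \<in> ?D" using face B(3) by blast
    fix T assume T: "T \<in> ?D" "T \<subseteq> ?V"
    have "?V - (?V - T) = T" using T(2) by blast
    then have "\<forall>F\<in>intervals ps. F \<inter> (?V - T) \<noteq> {}" using face[of "?V - T"] T(1) by simp
    then have "disjoint_count ps \<le> card (?V - T)" by (intro disjoint_count_le_card[OF A]) auto
    moreover have "card (?V - T) = n - card T" "card T \<le> n"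
      using T(2) card_mono[OF finV T(2)] by (simp_all add: card_Diff_subset finite_subset)
    ultimately show "card T \<le> card (?V - B)" unfolding cB by linarith
  qed simp
  moreover have "psi n as bs = int (n - disjoint_count ps)"
    using psi_eq_disjoint_count[OF len, of n] A hn by (simp add: ps_def)
  ultimately show ?thesis using phi depth sdepth cB by simp
qed

end
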